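(* Let $n\geq 2$, let $k_1,\dots,k_n$ be relatively prime positive integers, and let $k=(k_1,-k_2,\dots,-k_n)\in\mathbb{Z}^n$. Put $$K=\mathrm{lcm}(k_1,\dots,k_n),\qquad \ell_a=\frac{K}{k_a}\ \ (1\leq a\leq n),\qquad L=\prod_{a=1}^n\ell_a,$$ and define the finite set of multi-indices $$\mathfrak{G}=\left\{(\beta_1,\dots,\beta_n)\in\mathbb{Z}^n \mid 0\leq\beta_1\leq 2k_1-2,\ \text{and } 0\leq\beta_b\leq 2k_b \text{ for each } 2\leq b\leq n\right\}.$$ For $\beta\in\mathfrak{G}$ let $$C(\beta)=\mathsf{D}_K\bigl(2K-\ell_1(\beta_1+1)-1\bigr)\cdot\prod_{b=2}^n\mathsf{D}_{\ell_b}\bigl(\ell_b(\beta_b+1)+\ell_1(\beta_1+1)-2K-1\bigr).$$ Then the Bergman kernel of the elementary Reinhardt domain $\mathscr{H}(k)$ is given, for $z,w\in\mathscr{H}(k)$, by $$\mathbb{B}_{\mathscr{H}(k)}(z,w)=\frac{1}{\pi^n L}\cdot\frac{\displaystyle\sum_{\beta\in\mathfrak{G}}C(\beta)\,t^\beta}{\displaystyle\left(\prod_{b=2}^n t_b^{k_b}-t_1^{k_1}\right)^2\cdot\prod_{b=2}^n(1-t_b)^2},$$ where $t=(t_1,\dots,t_n)\in\mathbb{C}^n$ with $t_a=z_a\overline{w_a}$ for $1\leq a\leq n$, and $t^\beta=t_1^{\beta_1}\cdots t_n^{\beta_n}$.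
   Context: Let $\mathbb{D}^n=\{z\in\mathbb{C}^n \mid |z_j|<1 \text{ for } 1\leq j\leq n\}$ be the unit polydisc. For a multi-index $k\in\mathbb{Z}^n$, the elementary Reinhardt domain associated to $k$ is $$\mathscr{H}(k)=\{z\in\mathbb{D}^n \mid z^k \text{ is defined, and } |z^k|<1\},$$ where $z^k=z_1^{k_1}\cdots z_n^{k_n}$, and $z^k$ fails to be defined only if its evaluation involves division by zero (i.e. some $z_j=0$ with a negative exponent). "Relatively prime" for $k_1,\dots,k_n$ means $\gcd(k_1,\dots,k_n)=1$ (not necessarily pairwise coprime). For integers $\lambda,\mu$ define $$\mathsf{D}_\lambda(\mu)=\begin{cases}0 & \mu\leq -1 \text{ or } \mu\geq 2\lambda-1,\\ \mu+1 & 0\leq\mu\leq\lambda-1,\\ 2\lambda-1-\mu & \lambda\leq\mu\leq 2\lambda-2.\end{cases}$$ For a domain $\Omega\subset\mathbb{C}^n$, the Bergman space $A^2(\Omega)$ is the Hilbert space of holomorphic functions on $\Omega$ that are square integrable with respect to Lebesgue measure $dV$, and the Bergman kernel $\mathbb{B}_\Omega:\Omega\times\Omega\to\mathbb{C}$ is its reproducing kernel: it is holomorphic in the first and anti-holomorphic in the second variable, and $f(z)=\int_\Omega f(w)\,\mathbb{B}_\Omega(z,w)\,dV(w)$ for all $f\in A^2(\Omega)$, $z\in\Omega$. *)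

theory Defs
  imports "HOL-Analysis.Analysis"
begin

text \<open>Complex Frechet differentiability. The derivative is taken in the full neighbourhood filter,
  so the notion is the intended one for open \<open>\<Omega>\<close>.\<close>

definition holomorphic_on_vec :: "(complex ^ 'n \<Rightarrow> complex) \<Rightarrow> (complex ^ 'n) set \<Rightarrow> bool"
  where "holomorphic_on_vec f \<Omega> \<longleftrightarrow>
    (\<forall>z\<in>\<Omega>. \<exists>D. (f has_derivative D) (at z) \<and> (\<forall>c v. D (c *s v) = c * D v))"

text \<open>Only the values on \<open>\<Omega>\<close> are relevant: functions are not identified with restrictions.
  The measure is Lebesgue measure on the underlying real Euclidean space of dimension
  \<open>2 * CARD('n)\<close>.\<close>

definition bergman_space :: "(complex ^ 'n) set \<Rightarrow> (complex ^ 'n \<Rightarrow> complex) set"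
  where "bergman_space \<Omega> =
    {f. holomorphic_on_vec f \<Omega> \<and> set_integrable lborel \<Omega> (\<lambda>z. (norm (f z))\<^sup>2)}"

text \<open>The second clause says that \<open>B z\<close> is anti-holomorphic and square integrable, i.e. that the
  evaluation functional at \<open>z\<close> is represented by an element of the Bergman space.\<close>

definition is_bergman_kernel ::
    "(complex ^ 'n) set \<Rightarrow> (complex ^ 'n \<Rightarrow> complex ^ 'n \<Rightarrow> complex) \<Rightarrow> bool"
  where "is_bergman_kernel \<Omega> B \<longleftrightarrow>
    (\<forall>w\<in>\<Omega>. holomorphic_on_vec (\<lambda>z. B z w) \<Omega>) \<and>
    (\<forall>z\<in>\<Omega>. (\<lambda>w. cnj (B z w)) \<in> bergman_space \<Omega>) \<and>
    (\<forall>f\<in>bergman_space \<Omega>. \<forall>z\<in>\<Omega>.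
      f z = set_lebesgue_integral lborel \<Omega> (\<lambda>w. f w * B z w))"

text \<open>The choice is unique on \<open>\<Omega> \<times> \<Omega>\<close>, and unspecified elsewhere.\<close>

definition bergman_kernel ::
    "(complex ^ 'n) set \<Rightarrow> complex ^ 'n \<Rightarrow> complex ^ 'n \<Rightarrow> complex"
  where "bergman_kernel \<Omega> = (SOME B. is_bergman_kernel \<Omega> B)"

lemma is_bergman_kernel_reproducing:
  assumes "is_bergman_kernel \<Omega> B" "f \<in> bergman_space \<Omega>" "z \<in> \<Omega>"
  shows "f z = set_lebesgue_integral lborel \<Omega> (\<lambda>w. f w * B z w)"
  using assms unfolding is_bergman_kernel_def by blast

lemma is_bergman_kernel_swap:
  assumes A: "is_bergman_kernel \<Omega> A" and B: "is_bergman_kernel \<Omega> B"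
    and z: "z \<in> \<Omega>" and w: "w \<in> \<Omega>"
  shows "B w z = cnj (A z w)"
proof -
  have A': "(\<lambda>v. cnj (A z v)) \<in> bergman_space \<Omega>"
    and B': "(\<lambda>v. cnj (B w v)) \<in> bergman_space \<Omega>"
    using A B z w unfolding is_bergman_kernel_def by blast+
  have "cnj (B w z) = set_lebesgue_integral lborel \<Omega> (\<lambda>v. cnj (B w v) * A z v)"
    by (rule is_bergman_kernel_reproducing [OF A B' z])
  also have "\<dots> = cnj (set_lebesgue_integral lborel \<Omega> (\<lambda>v. cnj (A z v) * B w v))"
    unfolding set_lebesgue_integral_def
    by (subst Bochner_Integration.integral_cnj [symmetric]) (simp add: mult.commute)
  also have "set_lebesgue_integral lborel \<Omega> (\<lambda>v. cnj (A z v) * B w v) = cnj (A z w)"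
    by (rule is_bergman_kernel_reproducing [OF B A' w, symmetric])
  finally show ?thesis
    by (metis complex_cnj_cnj)
qed

lemma is_bergman_kernel_unique:
  assumes "is_bergman_kernel \<Omega> A" "is_bergman_kernel \<Omega> B" "z \<in> \<Omega>" "w \<in> \<Omega>"
  shows "A z w = B z w"
  by (metis assms is_bergman_kernel_swap)

definition polydisc :: "(complex ^ 'n) set"
  where "polydisc = {z. \<forall>j. norm (z $ j) < 1}"

definition monomial :: "complex ^ 'n \<Rightarrow> int ^ 'n \<Rightarrow> complex"
  where "monomial z k = (\<Prod>j\<in>UNIV. (z $ j) powi (k $ j))"

definition monomial_defined :: "complex ^ 'n \<Rightarrow> int ^ 'n \<Rightarrow> bool"
  where "monomial_defined z k \<longleftrightarrow> (\<forall>j. k $ j < 0 \<longrightarrow> z $ j \<noteq> 0)"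

definition elementary_reinhardt :: "int ^ 'n \<Rightarrow> (complex ^ 'n) set"
  where "elementary_reinhardt k =
    {z \<in> polydisc. monomial_defined z k \<and> norm (monomial z k) < 1}"

definition Dcoeff :: "int \<Rightarrow> int \<Rightarrow> int"
  where "Dcoeff l m =
    (if m \<le> - 1 \<or> m \<ge> 2 * l - 1 then 0
     else if m \<le> l - 1 then m + 1
     else 2 * l - 1 - m)"

end

theory Submission
  imports Defs "HOL-Complex_Analysis.Cauchy_Integral_Formula" "HOL-Probability.Infinite_Product_Measure"
begin

text \<open>The domain \<open>H\<close> is the set of \<open>z\<close> with \<open>0 < |z\<^sub>b| < 1\<close> for \<open>b \<noteq> 1\<close> and
\<open>|z\<^sub>1|\<close> to the power \<open>k\<^sub>1\<close> less than the product of the \<open>|z\<^sub>b|\<close> to the power \<open>k\<^sub>b\<close>. It is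
invariant under rotations of the coordinates, so the Laurent monomials \<open>z\<^sup>\<alpha>\<close> are orthogonal, and the
Bergman kernel is the sum of \<open>z\<^sup>\<alpha> cnj(w\<^sup>\<alpha>) / \<parallel>w\<^sup>\<alpha>\<parallel>\<^sup>2\<close> over the square integrable ones. The proof has
three parts.

Kernel as a series. Let \<open>f\<close> be in the Bergman space. By Cauchy's theorem in each coordinate, the
torus average of \<open>f(uz) u\<^sup>-\<^sup>\<alpha>\<close> has the form \<open>a\<^sub>\<alpha> z\<^sup>\<alpha>\<close> with a constant \<open>a\<^sub>\<alpha>\<close>
(\<open>torus_coeff_eq\<close>). Rotation invariance of Lebesgue measure and Fubini's theorem give
\<open>\<integral> f cnj(w\<^sup>\<alpha>) = a\<^sub>\<alpha> \<parallel>w\<^sup>\<alpha>\<parallel>\<^sup>2\<close> (\<open>integral_F_monomial\<close>), and \<open>a\<^sub>\<alpha> = 0\<close> unless \<open>w\<^sup>\<alpha>\<close> is square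
integrable (\<open>coeff_L2\<close>). Termwise integration shows that integrating \<open>f\<close> against the kernel series
at \<open>z\<close> yields the absolutely convergent series of the \<open>a\<^sub>\<alpha> z\<^sup>\<alpha>\<close>. On the torus through \<open>z\<close> this series
and \<open>f\<close> are continuous with the same Fourier coefficients, so they agree by the uniqueness theorem
for Fourier series (\<open>torus_fourier_unique\<close>, \<open>laurent_series\<close>, \<open>reproducing_series\<close>).

Norms. Put \<open>m\<^sub>1(\<alpha>) = \<ell>\<^sub>1(\<alpha>\<^sub>1 + 1)\<close> and \<open>m\<^sub>b(\<alpha>) = \<ell>\<^sub>b(\<alpha>\<^sub>b + 1) + \<ell>\<^sub>1(\<alpha>\<^sub>1 + 1)\<close> for \<open>b \<noteq> 1\<close>. Integrating first
over \<open>z\<^sub>1\<close> and then over the other coordinates, \<open>\<parallel>w\<^sup>\<alpha>\<parallel>\<^sup>2\<close> is the product of the \<open>\<pi> \<ell>\<^sub>a / m\<^sub>a(\<alpha>)\<close> if all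
\<open>m\<^sub>a(\<alpha>)\<close> are positive, and infinite otherwise (\<open>nn_integral_monomial\<close>). Hence the kernel is
\<open>1 / (\<pi>\<^sup>n L)\<close> times the sum of \<open>t\<^sup>\<alpha>\<close> times the product of the \<open>max(0, m\<^sub>a(\<alpha>))\<close>.

Summation. There are exponent vectors \<open>s\<^sub>a\<close>, namely \<open>k = (k\<^sub>1, -k\<^sub>2, \<dots>, -k\<^sub>n)\<close> and the unit vectors \<open>e\<^sub>b\<close> for \<open>b \<noteq> 1\<close>,
such that translating \<open>\<alpha>\<close> by \<open>s\<^sub>a\<close> changes \<open>m\<^sub>a\<close> only, by \<open>K\<close> or by \<open>\<ell>\<^sub>a\<close>. Since \<open>D\<^sub>\<lambda>(m - 1)\<close> is the second difference with
step \<open>\<lambda>\<close> of \<open>max(0, m)\<close>, dividing a series by \<open>(1 - y)\<^sup>2\<close>, where \<open>y\<close> is the monomial with exponent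
\<open>s\<^sub>a\<close>, replaces the factor \<open>D(m\<^sub>a - 1)\<close> of its coefficients by \<open>max(0, m\<^sub>a)\<close>. Starting from the finite sum whose
coefficients are the products of the \<open>D(m\<^sub>a - 1)\<close> and doing this for every coordinate gives the kernel series
(\<open>generating_function\<close>); clearing the negative exponents gives the stated quotient (\<open>ker_series\<close>).\<close>

section \<open>Invariance and product structure of Lebesgue measure\<close>

lemma nn_integral_lborel_translate:
  fixes f :: "'a::euclidean_space \<Rightarrow> ennreal"
  assumes [measurable]: "f \<in> borel_measurable borel"
  shows "(\<integral>\<^sup>+x. f (c + x) \<partial>lborel) = (\<integral>\<^sup>+x. f x \<partial>lborel)"
proof -
  have "(\<integral>\<^sup>+x. f x \<partial>lborel) = (\<integral>\<^sup>+x. f x \<partial>distr lborel borel ((+) c))"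
    by (simp add: lborel_distr_plus)
  also have "\<dots> = (\<integral>\<^sup>+x. f (c + x) \<partial>lborel)"
    by (subst nn_integral_distr) auto
  finally show ?thesis by simp
qed

text \<open>The image measure is translation invariant, hence a multiple of Lebesgue measure; the factor is one
because a linear isometry maps the unit ball to itself.\<close>

lemma distr_lborel_linear_isometry:
  fixes f :: "'a::euclidean_space \<Rightarrow> 'a"
  assumes lin: "linear f" and iso: "\<And>x. norm (f x) = norm x"
  shows "distr lborel borel f = lborel"
proof -
  have cont: "continuous_on UNIV f"
    using lin by (simp add: linear_continuous_on linear_conv_bounded_linear)
  have [measurable]: "f \<in> borel_measurable borel"
    using cont by (rule borel_measurable_continuous_onI)
  have "inj f"
    using lin iso by (metis linear_injective_0 norm_eq_zero)
  then have "surj f"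
    using lin linear_injective_imp_surjective by blast
  define N where "N = distr lborel borel f"
  have sets_N[measurable_cong]: "sets N = sets borel" by (simp add: N_def)
  have N_nn: "(\<integral>\<^sup>+x. g x \<partial>N) = (\<integral>\<^sup>+x. g (f x) \<partial>lborel)" if [measurable]: "g \<in> borel_measurable borel" for g
    unfolding N_def by (subst nn_integral_distr) auto
  have N_trans: "(\<integral>\<^sup>+x. g (c + x) \<partial>N) = (\<integral>\<^sup>+x. g x \<partial>N)" if [measurable]: "g \<in> borel_measurable borel" for g c
  proof -
    obtain b where b: "c = f b" using \<open>surj f\<close> by (metis surjD)
    have "(\<integral>\<^sup>+x. g (c + x) \<partial>N) = (\<integral>\<^sup>+x. g (f (b + x)) \<partial>lborel)"
      using lin by (simp add: N_nn b linear_add)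
    also have "\<dots> = (\<integral>\<^sup>+x. g (f x) \<partial>lborel)"
      by (rule nn_integral_lborel_translate) measurable
    finally show ?thesis by (simp add: N_nn)
  qed
  define D where "D = ball (0::'a) 1"
  have [measurable]: "D \<in> sets borel" by (simp add: D_def)
  have N_ball: "emeasure N (ball 0 r) = emeasure lborel (ball (0::'a) r)" for r
  proof -
    have "f -` ball 0 r = ball 0 r" by (auto simp: iso)
    then show ?thesis unfolding N_def by (subst emeasure_distr) auto
  qed
  interpret N: sigma_finite_measure N
  proof
    show "\<exists>A. countable A \<and> A \<subseteq> sets N \<and> \<Union>A = space N \<and> (\<forall>a\<in>A. emeasure N a \<noteq> \<infinity>)"
    proof (intro exI[of _ "range (\<lambda>n::nat. ball (0::'a) (real n))"] conjI)
      have "x \<in> (\<Union>n::nat. ball (0::'a) (real n))" for x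
        using reals_Archimedean2[of "norm x"] by auto
      then show "\<Union> (range (\<lambda>n::nat. ball (0::'a) (real n))) = space N"
        by (auto simp: N_def)
    qed (auto simp: sets_N N_ball emeasure_ball)
  qed
  interpret P: pair_sigma_finite lborel N
    by unfold_locales
  \<comment> \<open>Uniqueness of Haar measure: substitute \<open>x \<mapsto> y + x\<close>, then \<open>y \<mapsto> y - x\<close>, in the double integral.\<close>
  have key: "emeasure lborel A * emeasure N D = emeasure N A * emeasure lborel D"
    if [measurable]: "A \<in> sets borel" for A
  proof -
    have "emeasure lborel A * emeasure N D
        = (\<integral>\<^sup>+y. (\<integral>\<^sup>+x. indicator A x * indicator D y \<partial>lborel) \<partial>N)"
      by (simp add: nn_integral_multc nn_integral_cmult sets_N)
    also have "\<dots> = (\<integral>\<^sup>+y. (\<integral>\<^sup>+x. indicator A (y + x) * indicator D y \<partial>lborel) \<partial>N)"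
    proof (rule nn_integral_cong)
      fix y
      show "(\<integral>\<^sup>+x. indicator A x * indicator D y \<partial>lborel)
          = (\<integral>\<^sup>+x. indicator A (y + x) * indicator D y \<partial>lborel)"
        by (rule nn_integral_lborel_translate[symmetric]) measurable
    qed
    also have "\<dots> = (\<integral>\<^sup>+x. (\<integral>\<^sup>+y. indicator A (y + x) * indicator D y \<partial>N) \<partial>lborel)"
      by (rule P.Fubini') measurable
    also have "\<dots> = (\<integral>\<^sup>+x. (\<integral>\<^sup>+y. indicator A y * indicator D (y - x) \<partial>N) \<partial>lborel)"
    proof (rule nn_integral_cong)
      fix x
      show "(\<integral>\<^sup>+y. indicator A (y + x) * indicator D y \<partial>N) = (\<integral>\<^sup>+y. indicator A y * indicator D (y - x) \<partial>N)"
        by (subst N_trans[of "\<lambda>y. indicator A y * indicator D (y - x)" x, symmetric])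
           (auto simp: add.commute)
    qed
    also have "\<dots> = (\<integral>\<^sup>+y. (\<integral>\<^sup>+x. indicator A y * indicator D (y - x) \<partial>lborel) \<partial>N)"
      by (rule P.Fubini'[symmetric]) measurable
    also have "\<dots> = (\<integral>\<^sup>+y. indicator A y * emeasure lborel D \<partial>N)"
    proof (rule nn_integral_cong)
      fix y
      have "(\<integral>\<^sup>+x. indicator D (y - x) \<partial>lborel) = (\<integral>\<^sup>+x. indicator (ball y 1) x \<partial>lborel :: ennreal)"
        by (intro nn_integral_cong) (auto simp: D_def indicator_def dist_norm norm_minus_commute)
      also have "\<dots> = emeasure lborel D"
        by (simp add: D_def emeasure_ball)
      finally show "(\<integral>\<^sup>+x. indicator A y * indicator D (y - x) \<partial>lborel) = indicator A y * emeasure lborel D"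
        by (subst nn_integral_cmult) auto
    qed
    also have "\<dots> = emeasure N A * emeasure lborel D"
      by (simp add: nn_integral_multc sets_N)
    finally show ?thesis .
  qed
  have D0: "emeasure lborel D \<noteq> 0" "emeasure lborel D \<noteq> \<infinity>"
    using emeasure_lborel_ball_finite[of "0::'a" 1] by (auto simp: D_def emeasure_ball less_imp_neq[OF unit_ball_vol_pos, symmetric])
  have ND: "emeasure N D = emeasure lborel D" by (simp add: D_def N_ball)
  have "emeasure N A = emeasure lborel A" if "A \<in> sets borel" for A
  proof -
    have "emeasure lborel D * emeasure lborel A = emeasure lborel D * emeasure N A"
      using key[OF that] ND by (metis mult.commute)
    then show ?thesis
      using D0
      unfolding ennreal_mult_cancel_left by auto
  qed
  then show ?thesis
    by (intro measure_eqI) (auto simp: N_def)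
qed

lemma measurable_vec_lambda_PiM [measurable]:
  "(\<lambda>f. \<chi> i. f i) \<in> measurable (PiM UNIV (\<lambda>_::'n::finite. borel :: 'a::euclidean_space measure)) borel"
  by (subst borel_measurable_euclidean_space)
     (auto simp: Basis_vec_def inner_axis)

lemma lborel_vec_eq_distr_PiM:
  "(lborel :: ('a::euclidean_space ^ 'n::finite) measure) = 
    distr (PiM UNIV (\<lambda>_::'n. lborel :: 'a measure)) borel (\<lambda>f. \<chi> i. f i)"
proof (rule lborel_eqI)
  interpret product_sigma_finite "\<lambda>_::'n. lborel :: 'a measure" by standard
  fix l u :: "'a ^ 'n"
  assume lu: "\<And>b. b \<in> Basis \<Longrightarrow> l \<bullet> b \<le> u \<bullet> b"
  have lu': "l $ i \<bullet> b \<le> u $ i \<bullet> b" if "b \<in> Basis" for i b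
    using lu[of "axis i b"] that by (simp add: inner_axis axis_in_Basis_iff)
  have "(\<lambda>f. \<chi> i. f i) -` box l u = (\<Pi>\<^sub>E i\<in>UNIV. box (l $ i) (u $ i))"
    by (auto simp: mem_box Basis_vec_def inner_axis PiE_def Pi_def)
  then have "emeasure (distr (PiM UNIV (\<lambda>_::'n. lborel :: 'a measure)) borel (\<lambda>f. \<chi> i. f i)) (box l u) =
      emeasure (PiM UNIV (\<lambda>_::'n. lborel :: 'a measure)) (\<Pi>\<^sub>E i\<in>UNIV. box (l $ i) (u $ i))"
    by (subst emeasure_distr) (auto simp: space_PiM cong: measurable_cong_sets)
  also have "\<dots> = (\<Prod>i\<in>UNIV. \<Prod>b\<in>Basis. (u $ i - l $ i) \<bullet> b)"
    by (subst emeasure_PiM) (auto simp: emeasure_lborel_box lu' prod_ennreal inner_diff_left prod_nonneg)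
  also have "(\<Prod>i\<in>UNIV. \<Prod>b\<in>Basis. (u $ i - l $ i) \<bullet> b) = (\<Prod>b\<in>Basis. (u - l) \<bullet> b)"
  proof -
    have "(\<Prod>b\<in>Basis. (u - l) \<bullet> b) = (\<Prod>b\<in>(\<lambda>(i, b). axis i b) ` (UNIV \<times> Basis). (u - l) \<bullet> b)"
      by (rule prod.cong) (auto simp: Basis_vec_def)
    also have "\<dots> = (\<Prod>(i, b)\<in>UNIV \<times> Basis. (u $ i - l $ i) \<bullet> b)"
      by (subst prod.reindex)
         (auto simp: inj_on_def axis_eq_axis inner_axis intro!: prod.cong)
    finally show ?thesis by (simp add: prod.cartesian_product)
  qed
  finally show "emeasure (distr (PiM UNIV (\<lambda>_::'n. lborel :: 'a measure)) borel (\<lambda>f. \<chi> i. f i)) (box l u) = 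
      (\<Prod>b\<in>Basis. (u - l) \<bullet> b)" .
qed simp

lemma nn_integral_lborel_vec:
  fixes g :: "'a::euclidean_space ^ 'n::finite \<Rightarrow> ennreal"
  assumes [measurable]: "g \<in> borel_measurable borel"
  shows "(\<integral>\<^sup>+z. g z \<partial>lborel) = (\<integral>\<^sup>+x. g (\<chi> i. x i) \<partial>(PiM UNIV (\<lambda>_. lborel)))"
    and "(\<lambda>x. g (\<chi> i. x i)) \<in> borel_measurable (PiM UNIV (\<lambda>_. lborel))"
proof -
  have [measurable]: "(\<lambda>x. \<chi> i. x i) \<in> measurable (PiM UNIV (\<lambda>_::'n. lborel :: 'a measure)) borel"
    using measurable_vec_lambda_PiM[where 'a='a and 'n='n] by (simp cong: measurable_cong_sets sets_PiM_cong)
  show "(\<lambda>x. g (\<chi> i. x i)) \<in> borel_measurable (PiM UNIV (\<lambda>_. lborel))" by measurable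
  show "(\<integral>\<^sup>+z. g z \<partial>lborel) = (\<integral>\<^sup>+x. g (\<chi> i. x i) \<partial>(PiM UNIV (\<lambda>_. lborel)))"
    by (subst lborel_vec_eq_distr_PiM, subst nn_integral_distr) auto
qed

section \<open>Radial integrals over discs\<close>

text \<open>Under \<open>w \<mapsto> |w|\<^sup>2\<close>, planar Lebesgue measure becomes \<open>\<pi>\<close> times Lebesgue measure on the positive half-line, since the disc
of squared radius \<open>R\<close> has area \<open>\<pi> R\<close>.\<close>

lemma distr_norm_squared_ball:
  fixes R :: real
  assumes "R > 0"
  shows "distr (density lborel (indicator (ball (0::complex) (sqrt R)))) borel (\<lambda>w. (norm w)\<^sup>2)
       = density lborel (\<lambda>s. ennreal pi * indicator {0<..<R} s)"
    (is "?M = ?N")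
proof (rule measure_eqI_lessThan)
  have M: "emeasure ?M {x<..} = ennreal (pi * (R - max 0 (min R x)))" for x
  proof -
    define y where "y = max 0 (min R x)"
    have y: "0 \<le> y" "y \<le> R" using assms by (auto simp: y_def)
    have "emeasure ?M {x<..} = (\<integral>\<^sup>+w. indicator (ball 0 (sqrt R)) w * indicator {x<..} ((norm w)\<^sup>2) \<partial>(lborel :: complex measure))"
    proof -
      have "(\<lambda>w::complex. (norm w)\<^sup>2) -` {x<..} \<in> sets borel"
        by (intro borel_open open_vimage continuous_intros)
      then show ?thesis
        by (subst emeasure_distr, simp, simp, simp, subst emeasure_density)
          (auto intro!: nn_integral_cong borel_measurable_indicator simp: indicator_def)
    qed
    also have "\<dots> = (\<integral>\<^sup>+w. indicator (ball 0 (sqrt R) - (if x < 0 then {} else cball 0 (sqrt y))) w \<partial>(lborel :: complex measure))"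
    proof (intro nn_integral_cong)
      fix w :: complex
      have 1: "norm w < sqrt R \<longleftrightarrow> (norm w)\<^sup>2 < R"
        by (metis abs_norm_cancel real_less_rsqrt real_sqrt_abs real_sqrt_less_iff)
      have 2: "norm w \<le> sqrt y \<longleftrightarrow> (norm w)\<^sup>2 \<le> y"
        by (metis abs_norm_cancel real_sqrt_abs real_sqrt_le_iff)
      have 3: "x < 0 \<Longrightarrow> x < (norm w)\<^sup>2" by (meson less_le_trans zero_le_power2)
      show "indicator (ball 0 (sqrt R)) w * indicator {x<..} ((norm w)\<^sup>2) =
        (indicator (ball 0 (sqrt R) - (if x < 0 then {} else cball 0 (sqrt y))) w :: ennreal)"
        using 1 2 3 by (auto simp: indicator_def y_def)
    qed
    also have "\<dots> = emeasure lborel (ball 0 (sqrt R) - (if x < 0 then {} else cball (0::complex) (sqrt y)))"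
      by (rule nn_integral_indicator) auto
    also have "\<dots> = ennreal (pi * (R - y))"
    proof (cases "x < 0")
      case True
      then have "y = 0" using assms by (simp add: y_def)
      then show ?thesis using True assms by (simp add: emeasure_ball unit_ball_vol_2)
    next
      case False
      show ?thesis
      proof (cases "y < R")
        case True
        then have "emeasure lborel (ball 0 (sqrt R) - cball (0::complex) (sqrt y))
           = emeasure lborel (ball (0::complex) (sqrt R)) - emeasure lborel (cball (0::complex) (sqrt y))"
          using y True by (intro emeasure_Diff) (auto simp: emeasure_cball intro: le_less_trans[OF _ real_sqrt_less_mono])
        also have "\<dots> = ennreal (pi * R) - ennreal (pi * y)"
          using y assms by (simp add: emeasure_ball emeasure_cball unit_ball_vol_2)
        also have "\<dots> = ennreal (pi * R - pi * y)"
          using y by (simp add: ennreal_minus)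
        finally show ?thesis using False by (simp add: right_diff_distrib)
      next
        case False': False
        then have "y = R" using y by simp
        moreover have *: "ball 0 (sqrt R) - cball (0::complex) (sqrt R) = {}" by auto
        have "emeasure lborel (ball 0 (sqrt R) - cball (0::complex) (sqrt R)) = 0"
          by (subst *) simp
        ultimately show ?thesis using False by simp
      qed
    qed
    finally show ?thesis by (simp add: y_def)
  qed
  show "emeasure ?M {x<..} < \<infinity>" for x by (simp add: M)
  have N: "emeasure ?N {x<..} = ennreal (pi * (R - max 0 (min R x)))" for x
  proof -
    define y where "y = max 0 (min R x)"
    have y: "0 \<le> y" "y \<le> R" using assms by (auto simp: y_def)
    have "emeasure ?N {x<..} = (\<integral>\<^sup>+s. ennreal pi * indicator {y<..<R} s \<partial>lborel)"
      by (subst emeasure_density) (auto intro!: nn_integral_cong simp: indicator_def y_def)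
    also have "\<dots> = ennreal pi * emeasure lborel {y<..<R}"
      by (rule nn_integral_cmult_indicator) auto
    also have "\<dots> = ennreal (pi * (R - y))"
      using y by (simp add: ennreal_mult)
    finally show ?thesis by (simp add: y_def)
  qed
  show "emeasure ?M {x<..} = emeasure ?N {x<..}" for x by (simp add: M N)
qed auto

lemma nn_integral_powr_0:
  fixes q R :: real
  assumes "R > 0"
  shows "(\<integral>\<^sup>+s. ennreal (s powr (q - 1)) * indicator {0<..<R} s \<partial>lborel)
       = (if q > 0 then ennreal (R powr q / q) else \<infinity>)"
proof -
  have pos: "(\<integral>\<^sup>+s. ennreal (s powr (q - 1)) * indicator {0<..<R} s \<partial>lborel) = ennreal (R powr q / q)"
    if "q > 0" "R > 0" for q R :: real
  proof -
    have "((\<lambda>s. s powr (q - 1)) has_integral (R powr q / q)) {0..R}"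
      using has_integral_powr_from_0[of "q - 1" R] that by simp
    then have "(\<integral>\<^sup>+s. ennreal (indicator {0..R} s * (s powr (q - 1))) \<partial>lborel) = ennreal (R powr q / q)"
      using that
      by (intro nn_integral_has_integral_lebesgue[THEN trans[rotated]]) auto
    moreover have "(\<integral>\<^sup>+s. ennreal (s powr (q - 1)) * indicator {0<..<R} s \<partial>lborel)
        = (\<integral>\<^sup>+s. ennreal (indicator {0..R} s * (s powr (q - 1))) \<partial>lborel)"
    proof (rule nn_integral_cong_AE)
      have "AE s in lborel. s \<noteq> 0 \<and> s \<noteq> R"
        using AE_lborel_singleton[of "0::real"] AE_lborel_singleton[of R] by eventually_elim auto
      then show "AE s in lborel. ennreal (s powr (q - 1)) * indicator {0<..<R} s = ennreal (indicator {0..R} s * (s powr (q - 1)))"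
        by eventually_elim (auto simp: indicator_def)
    qed
    ultimately show ?thesis by simp
  qed
  show ?thesis
  proof (cases "q > 0")
    case True
    then show ?thesis using pos assms by simp
  next
    case False
    define m where "m = min 1 R"
    have m: "0 < m" "m \<le> 1" "m \<le> R" using assms by (auto simp: m_def)
    \<comment> \<open>On \<open>(0, 1)\<close> the integrand dominates \<open>s powr (d - 1)\<close> for every \<open>d > 0\<close>; let \<open>d\<close> tend to zero.\<close>
    have ge: "(\<integral>\<^sup>+s. ennreal (s powr (q - 1)) * indicator {0<..<R} s \<partial>lborel) \<ge> ennreal (m * real (Suc n))" for n
    proof -
      define d where "d = 1 / real (Suc n)"
      have d: "0 < d" "d \<le> 1" by (auto simp: d_def)
      have "m * real (Suc n) = m powr 1 / d" using m by (simp add: d_def)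
      also have "\<dots> \<le> m powr d / d"
        using m d by (intro divide_right_mono powr_mono') auto
      finally have "ennreal (m * real (Suc n)) \<le> ennreal (m powr d / d)" by (rule ennreal_leI)
      also have "\<dots> = (\<integral>\<^sup>+s. ennreal (s powr (d - 1)) * indicator {0<..<m} s \<partial>lborel)"
        using pos[OF d(1) m(1)] by simp
      also have "\<dots> \<le> (\<integral>\<^sup>+s. ennreal (s powr (q - 1)) * indicator {0<..<R} s \<partial>lborel)"
        using m d False
        by (intro nn_integral_mono) (auto simp: indicator_def intro!: ennreal_leI powr_mono')
      finally show ?thesis .
    qed
    have "(\<integral>\<^sup>+s. ennreal (s powr (q - 1)) * indicator {0<..<R} s \<partial>lborel) = \<infinity>"
    proof (rule ccontr)
      assume "\<not> ?thesis"
      then obtain r where r: "r \<ge> 0" "(\<integral>\<^sup>+s. ennreal (s powr (q - 1)) * indicator {0<..<R} s \<partial>lborel) = ennreal r"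
        by (cases "(\<integral>\<^sup>+s. ennreal (s powr (q - 1)) * indicator {0<..<R} s \<partial>lborel)") auto
      obtain n where "r / m < real n" using reals_Archimedean2 by blast
      then have "r < m * real (Suc n)" using m by (simp add: field_simps)
      with ge[of n] r show False by (simp add: ennreal_le_iff)
    qed
    then show ?thesis using False by simp
  qed
qed

lemma nn_integral_norm_powr_disc:
  fixes q \<rho> :: real
  assumes "\<rho> > 0"
  shows "(\<integral>\<^sup>+w. ennreal (norm w powr (2 * q - 2)) * indicator (ball 0 \<rho>) w \<partial>(lborel :: complex measure))
       = (if q > 0 then ennreal (pi / q) else \<infinity>) * ennreal (\<rho> powr (2 * q))"
proof -
  define R where "R = \<rho>\<^sup>2"
  have R: "R > 0" "sqrt R = \<rho>" using assms by (auto simp: R_def)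
  have "(\<integral>\<^sup>+w. ennreal (norm w powr (2 * q - 2)) * indicator (ball 0 \<rho>) w \<partial>(lborel :: complex measure))
     = (\<integral>\<^sup>+w. ennreal (((norm w)\<^sup>2) powr (q - 1)) \<partial>(density lborel (indicator (ball (0::complex) (sqrt R)))))"
  proof (subst nn_integral_density)
    have "norm w powr (2 * q - 2) = ((norm w)\<^sup>2) powr (q - 1)" for w :: complex
    proof (cases "w = 0")
      case False
      then have *: "(norm w)\<^sup>2 = norm w powr 2"
        by (simp add: powr_numeral)
      show ?thesis unfolding * powr_powr by (simp add: algebra_simps)
    qed auto
    then show "(\<integral>\<^sup>+w. ennreal (norm w powr (2 * q - 2)) * indicator (ball 0 \<rho>) w \<partial>(lborel :: complex measure)) =
      (\<integral>\<^sup>+w. indicator (ball 0 (sqrt R)) w * ennreal (((norm w)\<^sup>2) powr (q - 1)) \<partial>(lborel :: complex measure))"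
      by (simp add: R mult.commute)
  qed (auto intro!: borel_measurable_indicator)
  also have "\<dots> = (\<integral>\<^sup>+s. ennreal (s powr (q - 1)) \<partial>distr (density lborel (indicator (ball (0::complex) (sqrt R)))) borel (\<lambda>w. (norm w)\<^sup>2))"
    by (subst nn_integral_distr) auto
  also have "\<dots> = (\<integral>\<^sup>+s. ennreal pi * (ennreal (s powr (q - 1)) * indicator {0<..<R} s) \<partial>lborel)"
    unfolding distr_norm_squared_ball[OF R(1)]
    by (subst nn_integral_density) (auto intro!: nn_integral_cong simp: mult_ac)
  also have "\<dots> = ennreal pi * (if q > 0 then ennreal (R powr q / q) else \<infinity>)"
    by (subst nn_integral_cmult) (auto simp: nn_integral_powr_0 R)
  also have "\<dots> = (if q > 0 then ennreal (pi / q) else \<infinity>) * ennreal (\<rho> powr (2 * q))"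
  proof -
    have "R powr q = \<rho> powr (2 * q)" using assms
      by (simp add: R_def powr_powr flip: powr_numeral)
    then show ?thesis
      using assms by (auto simp: ennreal_mult_top ennreal_top_mult simp flip: ennreal_mult)
  qed
  finally show ?thesis .
qed

section \<open>Series over countable index types\<close>

text \<open>Termwise integration; the index type is transported to the natural numbers, with zero terms outside the
range of the enumeration.\<close>

lemma
  fixes f :: "'i::countable \<Rightarrow> 'a \<Rightarrow> complex"
  assumes int: "\<And>i. integrable M (f i)"
    and sm: "(\<lambda>i. \<integral>x. norm (f i x) \<partial>M) summable_on UNIV"
    and ptw: "\<And>x. x \<in> space M \<Longrightarrow> ((\<lambda>i. f i x) has_sum F x) UNIV"
  shows integrable_has_sum: "integrable M F"
    and has_sum_integral: "((\<lambda>i. \<integral>x. f i x \<partial>M) has_sum (\<integral>x. F x \<partial>M)) UNIV"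
proof -
  define A where "A = range (to_nat :: 'i \<Rightarrow> nat)"
  define g where "g n x = (if n \<in> A then f (from_nat n) x else 0)" for n x
  have bij: "bij_betw (to_nat :: 'i \<Rightarrow> nat) UNIV A"
    by (simp add: A_def bij_betw_def)
  have g_to: "g (to_nat i) = f i" for i by (auto simp: g_def A_def)
  have g_out: "g n = (\<lambda>_. 0)" if "n \<notin> A" for n using that by (auto simp: g_def)
  have hs: "((\<lambda>n. h n) has_sum s) UNIV \<longleftrightarrow> ((\<lambda>i. h (to_nat (i::'i))) has_sum s) UNIV"
    if "\<And>n. n \<notin> A \<Longrightarrow> h n = 0" for h :: "nat \<Rightarrow> 'b::{comm_monoid_add, topological_space}" and s
  proof -
    have "((\<lambda>n. h n) has_sum s) UNIV \<longleftrightarrow> (h has_sum s) A"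
      by (rule has_sum_cong_neutral) (use that in auto)
    also have "\<dots> \<longleftrightarrow> ((\<lambda>i. h (to_nat (i::'i))) has_sum s) UNIV"
      using has_sum_reindex_bij_betw[OF bij, of h s] by simp
    finally show ?thesis .
  qed
  have gint: "integrable M (g n)" for n
  proof -
    have "g n = (if n \<in> A then f (from_nat n) else (\<lambda>_. 0))" by (auto simp: g_def)
    then show ?thesis using int by simp
  qed
  have "((\<lambda>i. \<integral>x. norm (f i x) \<partial>M) has_sum (infsum (\<lambda>i. \<integral>x. norm (f i x) \<partial>M) UNIV)) UNIV"
    using sm by (rule has_sum_infsum)
  then have "((\<lambda>n. \<integral>x. norm (g n x) \<partial>M) has_sum (infsum (\<lambda>i. \<integral>x. norm (f i x) \<partial>M) UNIV)) UNIV"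
    by (subst hs) (simp_all add: g_to g_out)
  then have s1: "summable (\<lambda>n. \<integral>x. norm (g n x) \<partial>M)"
    by (meson has_sum_imp_sums sums_summable)
  have gp: "((\<lambda>n. g n x) has_sum F x) UNIV" if "x \<in> space M" for x
    using ptw[OF that] by (subst hs) (simp_all add: g_to g_out)
  have gs: "(\<Sum>n. g n x) = F x" if "x \<in> space M" for x
    using gp[OF that] by (metis has_sum_imp_sums sums_unique)
  have AE: "AE x in M. summable (\<lambda>n. norm (g n x))"
  proof (rule AE_I2)
    fix x assume "x \<in> space M"
    then have "(\<lambda>n. g n x) summable_on UNIV" using gp summable_on_def by blast
    then have "(\<lambda>n. norm (g n x)) summable_on UNIV"
      by (simp add: summable_on_iff_abs_summable_on_complex)
    then show "summable (\<lambda>n. norm (g n x))" by (rule summable_on_imp_summable)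
  qed
  show "integrable M F"
    using integrable_suminf[OF gint AE s1] by (rule Bochner_Integration.integrable_cong[THEN iffD1, rotated -1]) (auto simp: gs)
  have "(\<lambda>n. \<integral>x. g n x \<partial>M) sums (\<integral>x. (\<Sum>n. g n x) \<partial>M)"
    by (rule sums_integral[OF gint AE s1])
  also have "(\<integral>x. (\<Sum>n. g n x) \<partial>M) = (\<integral>x. F x \<partial>M)"
    by (rule Bochner_Integration.integral_cong) (auto simp: gs)
  finally have su: "(\<lambda>n. \<integral>x. g n x \<partial>M) sums (\<integral>x. F x \<partial>M)" .
  moreover have "summable (\<lambda>n. norm (\<integral>x. g n x \<partial>M))"
    by (rule summable_comparison_test'[OF s1, of 0]) (use gint in \<open>auto intro!: integral_norm_bound\<close>)
  ultimately have "((\<lambda>n. \<integral>x. g n x \<partial>M) has_sum (\<integral>x. F x \<partial>M)) UNIV"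
    by (intro norm_summable_imp_has_sum)
  then show "((\<lambda>i. \<integral>x. f i x \<partial>M) has_sum (\<integral>x. F x \<partial>M)) UNIV"
    by (subst (asm) hs) (simp_all add: g_to g_out)
qed

text \<open>Cauchy--Schwarz for a weighted sum, from the non-negativity of the sums of \<open>p\<^sub>i (x\<^sub>i - r)\<^sup>2\<close> for all
real \<open>r\<close>.\<close>

lemma has_sum_weighted_square_le:
  fixes p x :: "'i \<Rightarrow> real"
  assumes p: "\<And>i. p i \<ge> 0" and P: "(p has_sum P) UNIV"
    and X: "((\<lambda>i. p i * x i) has_sum X) UNIV"
    and Y: "((\<lambda>i. p i * (x i)\<^sup>2) has_sum Y) UNIV"
  shows "X\<^sup>2 \<le> P * Y"
proof -
  have nonneg: "0 \<le> Y - 2 * s * X + s\<^sup>2 * P" for s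
  proof -
    have "((\<lambda>i. p i * (x i)\<^sup>2 + (- 2 * s) * (p i * x i) + s\<^sup>2 * p i) has_sum (Y + (- 2 * s) * X + s\<^sup>2 * P)) UNIV"
      by (intro has_sum_add has_sum_cmult_right P X Y)
    moreover have "p i * (x i)\<^sup>2 + (- 2 * s) * (p i * x i) + s\<^sup>2 * p i = p i * (x i - s)\<^sup>2" for i
      by (simp add: power2_eq_square algebra_simps)
    ultimately have "((\<lambda>i. p i * (x i - s)\<^sup>2) has_sum (Y + (- 2 * s) * X + s\<^sup>2 * P)) UNIV" by simp
    from has_sum_nonneg[OF this] have "0 \<le> Y + (- 2 * s) * X + s\<^sup>2 * P"
      using p by simp
    then show ?thesis by simp
  qed
  have "P \<ge> 0" using has_sum_nonneg[OF P] p by simp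
  show ?thesis
  proof (cases "P = 0")
    case True
    have "X = 0"
      using nonneg[of "(Y + 1) / (2 * X)"] True by (cases "X = 0") auto
    then show ?thesis using True by simp
  next
    case False
    then have "P > 0" using \<open>P \<ge> 0\<close> by simp
    then show ?thesis
      using nonneg[of "X / P"] by (simp add: power2_eq_square field_simps)
  qed
qed

lemma has_sum_tail_bound:
  fixes t :: "'i \<Rightarrow> complex" and g :: "'i \<Rightarrow> real"
  assumes t: "(t has_sum T) UNIV" and g: "(g has_sum S) UNIV" and le: "\<And>i. norm (t i) \<le> g i" and X: "finite X"
  shows "norm (T - sum t X) \<le> S - sum g X"
proof -
  have "((\<lambda>i. if i \<in> X then t i else 0) has_sum sum t X) UNIV"
    by (rule has_sum_finite_neutralI[OF X]) auto
  from has_sum_add[OF t has_sum_uminusI[OF this]]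
  have "((\<lambda>i. t i + - (if i \<in> X then t i else 0)) has_sum (T - sum t X)) UNIV" by simp
  moreover have "(\<lambda>i. t i + - (if i \<in> X then t i else 0)) = (\<lambda>i. if i \<in> X then 0 else t i)" by auto
  ultimately have 1: "((\<lambda>i. if i \<in> X then 0 else t i) has_sum (T - sum t X)) UNIV" by simp
  have "((\<lambda>i. if i \<in> X then g i else 0) has_sum sum g X) UNIV"
    by (rule has_sum_finite_neutralI[OF X]) auto
  from has_sum_add[OF g has_sum_uminusI[OF this]]
  have "((\<lambda>i. g i + - (if i \<in> X then g i else 0)) has_sum (S - sum g X)) UNIV" by simp
  moreover have "(\<lambda>i. g i + - (if i \<in> X then g i else 0)) = (\<lambda>i. if i \<in> X then 0 else g i)" by auto
  ultimately have 2: "((\<lambda>i. if i \<in> X then 0 else g i) has_sum (S - sum g X)) UNIV" by simp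
  show ?thesis
    by (rule norm_infsum_le[OF 1 2]) (use le in auto)
qed

text \<open>The Weierstrass M-test for unordered sums.\<close>

lemma continuous_on_has_sum:
  fixes t :: "'i \<Rightarrow> 'a::topological_space \<Rightarrow> complex" and g :: "'i \<Rightarrow> real"
  assumes t: "\<And>x. x \<in> A \<Longrightarrow> ((\<lambda>i. t i x) has_sum T x) UNIV" and g: "g summable_on UNIV"
    and le: "\<And>i x. x \<in> A \<Longrightarrow> norm (t i x) \<le> g i" and cont: "\<And>i. continuous_on A (t i)"
  shows "continuous_on A T"
proof -
  define S where "S = infsum g UNIV"
  have S: "(g has_sum S) UNIV" using g by (simp add: S_def)
  have "uniform_limit A (\<lambda>X x. \<Sum>i\<in>X. t i x) T (finite_subsets_at_top UNIV)"
    unfolding uniform_limit_iff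
  proof (intro allI impI)
    fix e :: real assume "e > 0"
    then have "\<forall>\<^sub>F X in finite_subsets_at_top UNIV. dist (sum g X) S < e"
      using S unfolding has_sum_def tendsto_iff by blast
    moreover have "\<forall>\<^sub>F X in finite_subsets_at_top (UNIV :: 'i set). finite X"
      by (rule eventually_finite_subsets_at_top_weakI) simp
    ultimately show "\<forall>\<^sub>F X in finite_subsets_at_top UNIV. \<forall>x\<in>A. dist (\<Sum>i\<in>X. t i x) (T x) < e"
    proof eventually_elim
      case (elim X)
      show ?case
      proof
        fix x assume x: "x \<in> A"
        have "norm (T x - (\<Sum>i\<in>X. t i x)) \<le> S - sum g X"
          by (rule has_sum_tail_bound[OF t[OF x] S le[OF x] elim(2)])
        then show "dist (\<Sum>i\<in>X. t i x) (T x) < e"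
          using elim(1) by (simp add: dist_norm norm_minus_commute)
      qed
    qed
  qed
  moreover have "\<forall>\<^sub>F X in finite_subsets_at_top UNIV. continuous_on A (\<lambda>x. \<Sum>i\<in>X. t i x)"
    by (intro always_eventually allI continuous_on_sum cont)
  ultimately show ?thesis
    by (intro uniform_limit_theorem[rotated]) auto
qed

section \<open>Laurent coefficients in one variable\<close>

text \<open>The mean over a circle does not depend on the radius. Pulled back by the exponential function, \<open>f\<close> lives on
a vertical strip, where it has a primitive \<open>P\<close>; the mean is determined by \<open>P(\<zeta> + 2\<pi>i) - P(\<zeta>)\<close>, which has
derivative zero.\<close>

lemma annulus_mean_eq:
  assumes hol: "f holomorphic_on A" and "open A"
    and conv: "\<And>w1 w2 w. w1 \<in> A \<Longrightarrow> w2 \<in> A \<Longrightarrow> norm w1 \<le> norm w \<Longrightarrow> norm w \<le> norm w2 \<Longrightarrow> w \<in> A"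
    and w: "w1 \<in> A" "w2 \<in> A" "w1 \<noteq> 0" "w2 \<noteq> 0"
  shows "integral {0..2*pi} (\<lambda>\<theta>. f (cis \<theta> * w1)) = integral {0..2*pi} (\<lambda>\<theta>. f (cis \<theta> * w2))"
proof -
  define S where "S = exp -` A"
  have "open S" unfolding S_def using \<open>open A\<close> by (intro open_vimage continuous_intros)
  have conv': "\<zeta> \<in> S" if "\<zeta>1 \<in> S" "\<zeta>2 \<in> S" "Re \<zeta>1 \<le> Re \<zeta>" "Re \<zeta> \<le> Re \<zeta>2" for \<zeta>1 \<zeta>2 \<zeta>
    using conv[of "exp \<zeta>1" "exp \<zeta>2" "exp \<zeta>"] that by (auto simp: S_def)
  have "convex S"
  proof (rule convexI)
    fix x y :: complex and u v :: real
    assume xy: "x \<in> S" "y \<in> S" and uv: "0 \<le> u" "0 \<le> v" "u + v = 1"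
    have u: "u = 1 - v" using uv by simp
    have "Re (u *\<^sub>R x + v *\<^sub>R y) = Re x + v * (Re y - Re x)"
         "Re (u *\<^sub>R x + v *\<^sub>R y) = Re y - u * (Re y - Re x)"
      by (simp_all add: u algebra_simps)
    then show "u *\<^sub>R x + v *\<^sub>R y \<in> S"
      using conv'[OF xy, of "u *\<^sub>R x + v *\<^sub>R y"] conv'[OF xy(2,1), of "u *\<^sub>R x + v *\<^sub>R y"] uv
      by (smt (verit) mult_nonneg_nonneg mult_nonneg_nonpos)
  qed
  have "(\<lambda>\<zeta>. f (exp \<zeta>)) holomorphic_on S"
    by (rule holomorphic_on_compose_gen[OF _ hol, unfolded o_def]) (auto simp: S_def intro!: holomorphic_intros)
  then obtain P where P: "\<And>\<zeta>. \<zeta> \<in> S \<Longrightarrow> (P has_field_derivative f (exp \<zeta>)) (at \<zeta> within S)"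
    using holomorphic_convex_primitive'[OF \<open>convex S\<close> \<open>open S\<close>] by blast
  have P': "(P has_field_derivative f (exp \<zeta>)) (at \<zeta>)" if "\<zeta> \<in> S" for \<zeta>
    using P[OF that] at_within_open[OF that \<open>open S\<close>] by simp
  have per: "\<zeta> + 2 * of_real pi * \<i> \<in> S \<longleftrightarrow> \<zeta> \<in> S" for \<zeta>
    by (simp add: S_def exp_add)
  define Q where "Q \<zeta> = P (\<zeta> + 2 * of_real pi * \<i>) - P \<zeta>" for \<zeta>
  have "(Q has_field_derivative 0) (at \<zeta>)" if "\<zeta> \<in> S" for \<zeta>
  proof -
    have "((\<lambda>\<zeta>. P (\<zeta> + 2 * of_real pi * \<i>)) has_field_derivative f (exp (\<zeta> + 2 * of_real pi * \<i>))) (at \<zeta>)"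
      using P'[of "\<zeta> + 2 * of_real pi * \<i>"] that per by (simp add: DERIV_shift)
    then have "(Q has_field_derivative f (exp (\<zeta> + 2 * of_real pi * \<i>)) - f (exp \<zeta>)) (at \<zeta>)"
      unfolding Q_def[abs_def] by (rule DERIV_diff) (rule P'[OF that])
    then show ?thesis by (simp add: exp_add)
  qed
  then obtain c where c: "\<And>\<zeta>. \<zeta> \<in> S \<Longrightarrow> Q \<zeta> = c"
    using has_field_derivative_zero_constant[OF \<open>convex S\<close>, of Q] has_field_derivative_at_within by blast
  have main: "integral {0..2*pi} (\<lambda>\<theta>. f (cis \<theta> * w)) = c / \<i>" if "w \<in> A" "w \<noteq> 0" for w
  proof -
    define l where "l = Ln w"
    have l: "exp l = w" using that by (simp add: l_def)
    have S: "l + \<i> * of_real \<theta> \<in> S" for \<theta>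
      using conv'[of l l "l + \<i> * of_real \<theta>"] that l by (auto simp: S_def)
    have "((\<lambda>\<theta>. \<i> * f (exp (l + \<i> * of_real \<theta>))) has_integral
        (P (l + \<i> * of_real (2 * pi)) - P (l + \<i> * of_real 0))) {0..2*pi}"
    proof (rule fundamental_theorem_of_calculus)
      fix x :: real
      have "((\<lambda>z. l + \<i> * z) has_field_derivative \<i>) (at (of_real x))"
        by (auto intro!: derivative_eq_intros)
      then have "((\<lambda>\<theta>. l + \<i> * of_real \<theta>) has_vector_derivative \<i>) (at x)"
        by (rule has_vector_derivative_real_field)
      from field_vector_diff_chain_at[OF this P'[OF S]]
      have "((\<lambda>\<theta>. P (l + \<i> * of_real \<theta>)) has_vector_derivative (\<i> * f (exp (l + \<i> * of_real x)))) (at x)"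
        by (simp add: o_def)
      then show "((\<lambda>\<theta>. P (l + \<i> * of_real \<theta>)) has_vector_derivative (\<i> * f (exp (l + \<i> * of_real x)))) (at x within {0..2*pi})"
        by (rule has_vector_derivative_at_within)
    qed simp
    moreover have "P (l + \<i> * of_real (2 * pi)) - P (l + \<i> * of_real 0) = c"
      using c[of l] S[of 0] by (simp add: Q_def mult_ac)
    ultimately have "((\<lambda>\<theta>. \<i> * f (exp (l + \<i> * of_real \<theta>))) has_integral c) {0..2*pi}" by simp
    from has_integral_mult_right[OF this, of "1 / \<i>"]
    have "((\<lambda>\<theta>. f (exp (l + \<i> * of_real \<theta>))) has_integral (c / \<i>)) {0..2*pi}"
      by (simp add: field_simps)
    then show ?thesis
      by (simp add: exp_add l cis_conv_exp mult_ac integral_unique)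
  qed
  show ?thesis using main w by simp
qed

lemma disc_mean_eq:
  fixes f :: "complex \<Rightarrow> complex"
  assumes hol: "f holomorphic_on cball 0 (norm w)"
  shows "integral {0..2*pi} (\<lambda>\<theta>. f (cis \<theta> * w)) = 2 * complex_of_real pi * f 0"
proof -
  define h where "h u = f (u * w)" for u
  have "h holomorphic_on cball 0 1"
    unfolding h_def
    by (rule holomorphic_on_compose_gen[OF _ hol, unfolded o_def])
       (auto intro!: holomorphic_intros simp: norm_mult mult_left_le_one_le)
  then have "((\<lambda>u. h u / (u - 0)) has_contour_integral (2 * of_real pi * \<i> * h 0)) (circlepath 0 1)"
    by (rule Cauchy_integral_circlepath_simple) auto
  then have "((\<lambda>t. h (cis t) / cis t * \<i> * cis t) has_integral (2 * of_real pi * \<i> * h 0)) {0..2*pi}"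
    unfolding circlepath_def by (subst (asm) has_contour_integral_part_circlepath_iff) auto
  then have "((\<lambda>t. \<i> * h (cis t)) has_integral (2 * of_real pi * \<i> * h 0)) {0..2*pi}"
    by (simp add: field_simps)
  from has_integral_mult_right[OF this, of "1 / \<i>"] show ?thesis
    by (simp add: field_simps integral_unique h_def)
qed

text \<open>Normalized arc length on the unit circle, as a measure on the whole plane: the image under \<open>\<theta> \<mapsto> exp(i\<theta>)\<close> of the uniform
distribution on \<open>[0, 2\<pi>]\<close>.\<close>

definition circ :: "complex measure" where
  "circ = distr (density lborel (\<lambda>\<theta>. ennreal (indicator {0..2*pi} \<theta> / (2*pi)))) borel cis"

lemma sets_circ [simp, measurable_cong]: "sets circ = sets borel"
  and space_circ [simp]: "space circ = UNIV"
  by (simp_all add: circ_def)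

lemma measurable_cis [measurable]: "cis \<in> borel_measurable borel"
  by (intro borel_measurable_continuous_onI continuous_intros)

lemma emeasure_circ:
  assumes "A \<in> sets borel"
  shows "emeasure circ A = ennreal (1 / (2*pi)) * emeasure lborel ({0..2*pi} \<inter> cis -` A)"
proof -
  have m: "cis -` A \<in> sets borel" using measurable_sets_borel[OF measurable_cis assms] by simp
  have "emeasure circ A = (\<integral>\<^sup>+\<theta>. ennreal (1 / (2*pi)) * indicator ({0..2*pi} \<inter> cis -` A) \<theta> \<partial>lborel)"
    unfolding circ_def using assms m
    by (subst emeasure_distr, simp, simp, simp, subst emeasure_density)
       (auto intro!: nn_integral_cong split: split_indicator)
  also have "\<dots> = ennreal (1 / (2*pi)) * emeasure lborel ({0..2*pi} \<inter> cis -` A)"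
    using m by (intro nn_integral_cmult_indicator) auto
  finally show ?thesis .
qed

lemma prob_space_circ: "prob_space circ"
proof
  have "emeasure circ UNIV = 1"
    by (subst emeasure_circ) (auto simp flip: ennreal_mult)
  then show "emeasure circ (space circ) = 1" by simp
qed

interpretation circ: prob_space circ by (rule prob_space_circ)

lemma AE_circ_norm: "AE u in circ. norm u = 1"
  unfolding circ_def by (subst AE_distr_iff) auto

lemma emeasure_circ_ball_pos:
  assumes "\<delta> > 0"
  shows "emeasure circ (ball 1 \<delta>) > 0"
proof -
  have "continuous_on UNIV cis" by (intro continuous_intros)
  then have "isCont cis 0" by (simp add: continuous_on_eq_continuous_at)
  then obtain e where e: "e > 0" "\<And>x. dist x 0 < e \<Longrightarrow> dist (cis x) (cis 0) < \<delta>"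
    using assms unfolding continuous_at_eps_delta by meson
  define d where "d = min (e / 2) pi"
  have d: "d > 0" "d < e" "d \<le> 2 * pi" using e by (auto simp: d_def min_def)
  have "0 < ennreal (1 / (2*pi)) * emeasure lborel {0..d}"
    using d by (simp add: ennreal_zero_less_mult_iff)
  also have "\<dots> \<le> emeasure circ (ball 1 \<delta>)"
  proof (subst emeasure_circ)
    have "cis -` ball 1 \<delta> \<in> sets borel" using measurable_sets_borel[OF measurable_cis, of "ball 1 \<delta>"] by simp
    moreover have "{0..d} \<subseteq> {0..2*pi} \<inter> cis -` ball 1 \<delta>"
      using d e(2) by (auto simp: dist_commute)
    ultimately show "ennreal (1 / (2*pi)) * emeasure lborel {0..d} \<le> ennreal (1 / (2*pi)) * emeasure lborel ({0..2*pi} \<inter> cis -` ball 1 \<delta>)"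
      by (intro mult_left_mono emeasure_mono) auto
  qed auto
  finally show ?thesis .
qed

lemma integral_circ:
  fixes g :: "complex \<Rightarrow> complex"
  assumes [measurable]: "g \<in> borel_measurable borel" and cont: "continuous_on (sphere 0 1) g"
  shows "(\<integral>u. g u \<partial>circ) = integral {0..2*pi} (\<lambda>\<theta>. g (cis \<theta>)) / (2 * of_real pi)"
proof -
  have "continuous_on {0..2*pi} (\<lambda>\<theta>. g (cis \<theta>))"
    by (rule continuous_on_compose2[OF cont]) (auto intro!: continuous_intros)
  then have i: "set_integrable lborel {0..2*pi} (\<lambda>\<theta>. g (cis \<theta>))"
    by (rule borel_integrable_atLeastAtMost')
  have "(\<integral>u. g u \<partial>circ) = (\<integral>\<theta>. (indicator {0..2*pi} \<theta> / (2*pi)) *\<^sub>R g (cis \<theta>) \<partial>lborel)"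
    unfolding circ_def
    by (subst integral_distr, simp, simp, subst integral_density) auto
  also have "\<dots> = (\<integral>\<theta>. (indicator {0..2*pi} \<theta> *\<^sub>R g (cis \<theta>)) / (2 * of_real pi) \<partial>lborel)"
    by (intro Bochner_Integration.integral_cong) (auto simp: scaleR_conv_of_real)
  also have "\<dots> = (LINT \<theta>:{0..2*pi}|lborel. g (cis \<theta>)) / (2 * of_real pi)"
    unfolding set_lebesgue_integral_def by (rule integral_divide_zero)
  finally show ?thesis using set_borel_integral_eq_integral(2)[OF i] by simp
qed

lemma measurable_powi [measurable (raw)]:
  fixes f :: "'a \<Rightarrow> complex"
  assumes [measurable]: "f \<in> borel_measurable M"
  shows "(\<lambda>x. f x powi m) \<in> borel_measurable M"
  unfolding power_int_def by (cases "m \<ge> 0") simp_all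

lemma holomorphic_on_powi:
  assumes "f holomorphic_on A" "\<And>z. z \<in> A \<Longrightarrow> f z \<noteq> 0 \<or> m \<ge> 0"
  shows "(\<lambda>z. f z powi m) holomorphic_on A"
  unfolding power_int_def using assms
  by (cases "m \<ge> 0") (auto intro!: holomorphic_intros)

lemma integral_circ_powi: "(\<integral>u. u powi m \<partial>circ) = (if m = 0 then 1 else 0)"
proof (cases "m = 0")
  case True
  then show ?thesis using circ.prob_space by simp
next
  case False
  have cont: "continuous_on (sphere 0 1) (\<lambda>u::complex. u powi m)"
    by (intro holomorphic_on_imp_continuous_on holomorphic_on_powi holomorphic_intros) auto
  have annulus: "integral {0..2*pi} (\<lambda>\<theta>. (cis \<theta> * 1) powi m) = integral {0..2*pi} (\<lambda>\<theta>. (cis \<theta> * 2) powi m)"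
    by (rule annulus_mean_eq[of "\<lambda>u. u powi m" "- {0}"])
       (auto intro!: holomorphic_on_powi holomorphic_intros)
  have "integral {0..2*pi} (\<lambda>\<theta>. (cis \<theta> * 2) powi m) = 2 powi m * integral {0..2*pi} (\<lambda>\<theta>. cis \<theta> powi m)"
    by (simp add: power_int_mult_distrib mult.commute)
  with annulus have "(2 powi m - 1) * integral {0..2*pi} (\<lambda>\<theta>. cis \<theta> powi m) = 0"
    by (simp add: algebra_simps)
  moreover have "2 powi m \<noteq> (1::complex)"
  proof
    assume "2 powi m = (1::complex)"
    then have "norm (2 powi m :: complex) = 1" by simp
    then have "2 powi m = (1::real)" by (simp add: norm_power_int)
    then have "2 powr real_of_int m = (1::real)" by (simp add: powr_real_of_int')
    then show False using False by simp
  qed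
  ultimately have "integral {0..2*pi} (\<lambda>\<theta>. cis \<theta> powi m) = 0" by simp
  then show ?thesis using False integral_circ[OF _ cont] by simp
qed

text \<open>The mean of \<open>f(uw) u\<^sup>-\<^sup>m\<close> over the circle is \<open>w\<^sup>m\<close> times a constant, written without division. The
region \<open>A\<close> may be an annulus or a disc; if it contains zero, the identity also covers \<open>w = 0\<close>, because
\<open>0 powi m = 0\<close> for every \<open>m \<noteq> 0\<close>.\<close>

lemma circ_coeff_scale:
  assumes hol: "f holomorphic_on A" and "open A" and [measurable]: "f \<in> borel_measurable borel"
    and conv: "\<And>w1 w2 w. w1 \<in> A \<Longrightarrow> w2 \<in> A \<Longrightarrow> norm w1 \<le> norm w \<Longrightarrow> norm w \<le> norm w2 \<Longrightarrow> w \<in> A"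
    and w: "w1 \<in> A" "w2 \<in> A"
  shows "(\<integral>u. f (u * w1) * u powi (- m) \<partial>circ) * w2 powi m = (\<integral>u. f (u * w2) * u powi (- m) \<partial>circ) * w1 powi m"
proof -
  have cont: "continuous_on (sphere 0 1) (\<lambda>u. f (u * w) * u powi (- m))" if "w \<in> A" for w
  proof -
    have "u * w \<in> A" if "norm u = 1" for u
      using conv[OF \<open>w \<in> A\<close> \<open>w \<in> A\<close>, of "u * w"] that by (simp add: norm_mult)
    then show ?thesis
      by (intro holomorphic_on_imp_continuous_on holomorphic_on_mult holomorphic_on_powi
          holomorphic_on_compose_gen[OF _ hol, unfolded o_def]) (auto intro!: holomorphic_intros)
  qed
  define c where "c w = (\<integral>u. f (u * w) * u powi (- m) \<partial>circ)" for w
  have c: "c w = integral {0..2*pi} (\<lambda>\<theta>. f (cis \<theta> * w) * cis \<theta> powi (- m)) / (2 * of_real pi)" if "w \<in> A" for w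
    unfolding c_def by (rule integral_circ[OF _ cont[OF that]]) measurable
  have zero: "c w * 0 powi m = c 0 * w powi m" if wA: "w \<in> A" "0 \<in> A" for w
  proof (cases "m = 0")
    case True
    have "cball 0 (norm w) \<subseteq> A"
      using conv[OF wA(2,1)] by auto
    then have "f holomorphic_on cball 0 (norm w)" using hol holomorphic_on_subset by blast
    from disc_mean_eq[OF this] show ?thesis
      using True c[OF wA(1)] c[OF wA(2)] by (simp add: scaleR_conv_of_real)
  next
    case False
    have "c 0 = f 0 * (\<integral>u. u powi (- m) \<partial>circ)" by (simp add: c_def)
    then have "c 0 = 0" using False by (simp add: integral_circ_powi)
    then show ?thesis using False by simp
  qed
  have "c w1 * w2 powi m = c w2 * w1 powi m"
  proof (cases "w1 = 0 \<or> w2 = 0")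
    case True
    then show ?thesis using zero[OF w(1)] zero[OF w(2)] w by metis
  next
    case False
    define g where "g u = f u * u powi (- m)" for u
    have "integral {0..2*pi} (\<lambda>\<theta>. g (cis \<theta> * w1)) = integral {0..2*pi} (\<lambda>\<theta>. g (cis \<theta> * w2))"
    proof (rule annulus_mean_eq[of g "A - {0}"])
      show "g holomorphic_on A - {0}"
        unfolding g_def
        by (intro holomorphic_on_mult holomorphic_on_powi holomorphic_on_ident holomorphic_on_subset[OF hol]) auto
      show "open (A - {0})" using \<open>open A\<close> by (intro open_Diff) auto
      fix v1 v2 v :: complex
      assume v: "v1 \<in> A - {0}" "v2 \<in> A - {0}" "norm v1 \<le> norm v" "norm v \<le> norm v2"
      then have "v \<noteq> 0" by auto
      then show "v \<in> A - {0}" using conv[of v1 v2 v] v by simp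
    qed (use False w in simp_all)
    moreover have "integral {0..2*pi} (\<lambda>\<theta>. g (cis \<theta> * w)) = w powi (- m) * (2 * of_real pi) * c w" if "w \<in> A" for w
    proof -
      have "integral {0..2*pi} (\<lambda>\<theta>. g (cis \<theta> * w)) = integral {0..2*pi} (\<lambda>\<theta>. w powi (- m) * (f (cis \<theta> * w) * cis \<theta> powi (- m)))"
        by (intro integral_cong) (simp add: g_def power_int_mult_distrib mult_ac)
      also have "\<dots> = w powi (- m) * integral {0..2*pi} (\<lambda>\<theta>. (f (cis \<theta> * w) * cis \<theta> powi (- m)))"
        by simp
      finally show ?thesis using c[OF that] by simp
    qed
    ultimately have "w1 powi (- m) * c w1 = w2 powi (- m) * c w2" using w by simp
    then show ?thesis using False by (simp add: power_int_minus field_simps)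
  qed
  then show ?thesis by (simp add: c_def)
qed

section \<open>Monomials and the torus\<close>

lemma monomial_mult: "monomial (u * z) \<alpha> = monomial u \<alpha> * monomial z \<alpha>"
  by (simp add: monomial_def power_int_mult_distrib prod.distrib)

text \<open>At a zero coordinate the law of exponents needs both exponents to be non-negative: \<open>0 powi m\<close> is zero
also for negative \<open>m\<close>.\<close>

lemma monomial_add:
  assumes "\<And>j. z $ j \<noteq> 0 \<or> (\<alpha> $ j \<ge> 0 \<and> \<beta> $ j \<ge> 0)"
  shows "monomial z (\<alpha> + \<beta>) = monomial z \<alpha> * monomial z \<beta>"
  unfolding monomial_def prod.distrib[symmetric]
proof (rule prod.cong)
  fix j
  show "(z $ j) powi ((\<alpha> + \<beta>) $ j) = (z $ j) powi (\<alpha> $ j) * (z $ j) powi (\<beta> $ j)"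
    using assms[of j] by (cases "z $ j = 0") (auto simp: power_int_add power_int_0_left_if)
qed simp

lemma monomial_0 [simp]: "monomial z 0 = 1"
  by (simp add: monomial_def)

lemma monomial_axis: "monomial z (axis j m) = (z $ j) powi m"
proof -
  have "monomial z (axis j m) = (\<Prod>i\<in>UNIV. if i = j then (z $ j) powi m else 1)"
    unfolding monomial_def by (rule prod.cong) (auto simp: axis_def)
  then show ?thesis by simp
qed

lemma monomial_eq_0_iff: "monomial z \<alpha> = 0 \<longleftrightarrow> (\<exists>j. z $ j = 0 \<and> \<alpha> $ j \<noteq> 0)"
  by (auto simp: monomial_def power_int_eq_0_iff)

lemma norm_monomial: "norm (monomial z \<alpha>) = (\<Prod>j\<in>UNIV. norm (z $ j) powi (\<alpha> $ j))"
  by (simp add: monomial_def norm_power_int flip: prod_norm)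

lemma norm_monomial_unimodular:
  assumes "\<And>j. norm (u $ j) = 1"
  shows "norm (monomial u \<alpha>) = 1"
  by (simp add: norm_monomial assms)

lemma monomial_minus: "monomial z (- \<alpha>) = inverse (monomial z \<alpha>)"
  using prod_inversef[of "\<lambda>j. (z $ j) powi (\<alpha> $ j)" UNIV]
  by (simp add: monomial_def power_int_minus o_def)

lemma cnj_monomial: "cnj (monomial z \<alpha>) = monomial (\<chi> j. cnj (z $ j)) \<alpha>"
  by (simp add: monomial_def)

lemma inverse_eq_cnj: "norm (z::complex) = 1 \<Longrightarrow> inverse z = cnj z"
  using divide_conv_cnj[of z 1] by (simp add: field_simps)

lemma cnj_monomial_unimodular:
  assumes "\<And>j. norm (u $ j) = 1"
  shows "cnj (monomial u \<alpha>) = monomial u (- \<alpha>)"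
  using norm_monomial_unimodular[OF assms] 
  by (simp add: monomial_minus inverse_eq_cnj)

lemma measurable_vec_nth_complex [measurable]: "(\<lambda>z::complex^'n. z $ j) \<in> borel_measurable borel"
  by (intro borel_measurable_continuous_onI continuous_intros)

lemma measurable_monomial [measurable]: "(\<lambda>z. monomial z \<alpha>) \<in> borel_measurable borel"
  unfolding monomial_def by measurable

text \<open>The distinguished boundary of the unit polydisc, and its normalized Haar measure. The measure lives on the
whole vector space; it is the image of a product of circle measures.\<close>

definition Torus :: "(complex ^ 'n) set" where
  "Torus = {u. \<forall>j. norm (u $ j) = 1}"

definition torus :: "(complex ^ 'n::finite) measure" where
  "torus = distr (PiM UNIV (\<lambda>_. circ)) borel (\<lambda>x. \<chi> j. x j)"

lemma Torus_nonzero: "u \<in> Torus \<Longrightarrow> u $ j \<noteq> 0"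
  unfolding Torus_def using norm_zero zero_neq_one by (metis (mono_tags, lifting) mem_Collect_eq)

lemma norm_monomial_Torus: "u \<in> Torus \<Longrightarrow> norm (monomial u \<alpha>) = 1"
  by (rule norm_monomial_unimodular) (simp add: Torus_def)

lemma one_in_Torus [simp]: "1 \<in> Torus"
  by (simp add: Torus_def)

lemma norm_vec_le_sum: "norm (x :: 'a::real_normed_vector ^ 'n) \<le> (\<Sum>j\<in>UNIV. norm (x $ j))"
  unfolding norm_vec_def by (rule L2_set_le_sum) simp

lemma compact_Torus: "compact (Torus :: (complex ^ 'n) set)"
proof -
  have T: "Torus = (\<Inter>j. (\<lambda>u::complex^'n. norm (u $ j)) -` {1})" by (auto simp: Torus_def)
  have "closed (Torus :: (complex ^ 'n) set)"
    unfolding T by (intro closed_INT ballI closed_vimage continuous_intros closed_singleton)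
  moreover have "bounded (Torus :: (complex ^ 'n) set)"
  proof (rule boundedI)
    fix u :: "complex ^ 'n" assume "u \<in> Torus"
    then show "norm u \<le> (\<Sum>j\<in>(UNIV::'n set). 1)"
      using norm_vec_le_sum[of u] by (simp add: Torus_def)
  qed
  ultimately show ?thesis by (simp add: compact_eq_bounded_closed)
qed

lemma continuous_on_monomial_Torus: "continuous_on Torus (\<lambda>u. monomial u \<alpha>)"
  unfolding monomial_def
  by (intro continuous_intros continuous_on_power_int) (simp add: Torus_nonzero)

lemma sets_torus [simp, measurable_cong]: "sets torus = sets borel"
  and space_torus [simp]: "space torus = UNIV"
  by (simp_all add: torus_def)

lemma measurable_vec_lambda_circ [measurable]:
  "(\<lambda>x. \<chi> j. x j) \<in> measurable (PiM UNIV (\<lambda>_::'n::finite. circ)) borel"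
  using measurable_vec_lambda_PiM[where 'a=complex and 'n='n]
  by (simp cong: measurable_cong_sets sets_PiM_cong)

interpretation circ_prod: product_prob_space "\<lambda>_::'i. circ" UNIV
  by standard

lemma prob_space_torus: "prob_space (torus :: (complex ^ 'n::finite) measure)"
  unfolding torus_def by (rule circ_prod.prob_space_distr) measurable

interpretation torus: prob_space "torus :: (complex ^ 'n::finite) measure"
  by (rule prob_space_torus)

lemma AE_PiM_circ:
  assumes "finite I"
  shows "AE x in PiM I (\<lambda>_::'i. circ). \<forall>i\<in>I. norm (x i) = 1"
proof -
  interpret product_prob_space "\<lambda>_::'i. circ" I by standard
  show ?thesis
    using assms by (intro eventually_ball_finite ballI AE_PiM_component AE_circ_norm prob_space_circ) auto
qed

lemma AE_torus: "AE u in torus. u \<in> (Torus :: (complex ^ 'n::finite) set)"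
proof -
  have [measurable]: "(Torus :: (complex ^ 'n) set) \<in> sets borel"
    using compact_Torus by (intro borel_closed compact_imp_closed)
  show ?thesis
    unfolding torus_def using AE_PiM_circ[of "UNIV :: 'n set"]
    by (subst AE_distr_iff) (auto simp: Torus_def)
qed

lemma integrable_torus:
  fixes F :: "complex ^ 'n::finite \<Rightarrow> complex"
  assumes m: "F \<in> borel_measurable borel" and cont: "continuous_on Torus F"
  shows "integrable torus F"
proof -
  have "bounded (F ` Torus)" using cont compact_Torus by (intro compact_imp_bounded compact_continuous_image)
  then obtain B where B: "\<And>u. u \<in> Torus \<Longrightarrow> norm (F u) \<le> B" by (auto simp: bounded_iff)
  show ?thesis
    by (rule torus.integrable_const_bound[of _ B]) (use AE_torus m B in \<open>auto elim!: eventually_mono\<close>)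
qed

text \<open>Fubini's theorem, with the coordinate \<open>j\<close> integrated first.\<close>

lemma integral_torus_insert:
  fixes F :: "complex ^ 'n::finite \<Rightarrow> complex"
  assumes F: "integrable torus F"
  shows "(\<integral>u. F u \<partial>torus) = (\<integral>x. (\<integral>v. F (\<chi> i. (x(j := v)) i) \<partial>circ) \<partial>(PiM (UNIV - {j}) (\<lambda>_. circ)))"
proof -
  have m: "F \<in> borel_measurable borel" using F by (simp add: integrable_iff_bounded cong: measurable_cong_sets)
  have U: "insert j (UNIV - {j}) = (UNIV :: 'n set)" by auto
  have "integrable (PiM UNIV (\<lambda>_. circ)) (\<lambda>x. F (\<chi> i. x i))"
    using F m unfolding torus_def by (subst (asm) integrable_distr_eq) auto
  then have i: "integrable (PiM (insert j (UNIV - {j})) (\<lambda>_. circ)) (\<lambda>x. F (\<chi> i. x i))"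
    by (simp add: U)
  have "(\<integral>u. F u \<partial>torus) = (\<integral>x. F (\<chi> i. x i) \<partial>(PiM UNIV (\<lambda>_. circ)))"
    unfolding torus_def using m by (subst integral_distr) auto
  also have "\<dots> = (\<integral>x. F (\<chi> i. x i) \<partial>(PiM (insert j (UNIV - {j})) (\<lambda>_. circ)))"
    by (simp add: U)
  also have "\<dots> = (\<integral>x. (\<integral>v. F (\<chi> i. (x(j := v)) i) \<partial>circ) \<partial>(PiM (UNIV - {j}) (\<lambda>_. circ)))"
    using circ_prod.product_integral_insert[OF _ _ i] by simp
  finally show ?thesis .
qed

lemma integral_torus_monomial: "(\<integral>u. monomial u \<alpha> \<partial>torus) = (if \<alpha> = 0 then 1 else 0)"
proof -
  have "(\<integral>u. monomial u \<alpha> \<partial>torus) = (\<integral>x. (\<Prod>j\<in>UNIV. (x j) powi (\<alpha> $ j)) \<partial>(PiM UNIV (\<lambda>_. circ)))"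
    unfolding torus_def by (subst integral_distr) (simp_all add: monomial_def)
  also have "\<dots> = (\<Prod>j\<in>UNIV. (\<integral>v. v powi (\<alpha> $ j) \<partial>circ))"
  proof (rule circ_prod.product_integral_prod)
    fix j
    show "integrable circ (\<lambda>v. v powi (\<alpha> $ j))"
      by (rule circ.integrable_const_bound[of _ 1])
         (use AE_circ_norm in \<open>auto elim!: eventually_mono simp: norm_power_int\<close>)
  qed simp
  also have "\<dots> = (if \<alpha> = 0 then 1 else 0)"
    by (auto simp: integral_circ_powi vec_eq_iff)
  finally show ?thesis .
qed

lemma borel_polyball_one: "{u::complex^'n::finite. \<forall>j. u $ j \<in> ball 1 \<delta>} \<in> sets borel"
proof -
  have *: "{u::complex^'n. \<forall>j. u $ j \<in> ball 1 \<delta>} = (\<Inter>j. (\<lambda>u. u $ j) -` ball 1 \<delta>)" by auto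
  show ?thesis
    unfolding * by (intro borel_open open_INT ballI open_vimage continuous_intros) auto
qed

lemma emeasure_torus_pos:
  assumes "\<delta> > 0"
  shows "emeasure torus {u::complex^'n::finite. \<forall>j. u $ j \<in> ball 1 \<delta>} > 0"
proof -
  have m: "{u::complex^'n. \<forall>j. u $ j \<in> ball 1 \<delta>} \<in> sets borel"
    by (rule borel_polyball_one)
  have v: "(\<lambda>x::'n \<Rightarrow> complex. \<chi> j. x j) -` {u::complex^'n. \<forall>j. u $ j \<in> ball 1 \<delta>} = (\<Pi>\<^sub>E j\<in>UNIV. ball 1 \<delta>)"
    by (auto simp: PiE_def)
  have "emeasure torus {u::complex^'n. \<forall>j. u $ j \<in> ball 1 \<delta>} = emeasure (PiM UNIV (\<lambda>_::'n. circ)) (\<Pi>\<^sub>E j\<in>UNIV. ball 1 \<delta>)"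
    unfolding torus_def using m by (subst emeasure_distr) (simp_all only: v[symmetric], simp_all add: space_PiM)
  also have "\<dots> = (\<Prod>j\<in>(UNIV::'n set). emeasure circ (ball 1 \<delta>))"
    by (rule circ_prod.emeasure_PiM) auto
  also have "\<dots> > 0"
    using emeasure_circ_ball_pos[OF assms] by (simp add: zero_less_iff_neq_zero)
  finally show ?thesis .
qed

section \<open>Uniqueness of Fourier series on the torus\<close>

text \<open>The functions with vanishing Fourier coefficients are stable under multiplication by real polynomials in
the real coordinates: on the torus \<open>Re u\<^sub>j\<close> and \<open>Im u\<^sub>j\<close> are linear combinations of \<open>u\<^sub>j\<close> and its inverse.\<close>

lemma torus_fourier_polynomial:
  fixes h :: "complex ^ 'n::finite \<Rightarrow> complex"
  assumes "real_polynomial_function p" 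
    and "h \<in> borel_measurable borel" "continuous_on Torus h"
    and "\<And>\<alpha>. (\<integral>u. h u * monomial u \<alpha> \<partial>torus) = 0"
  shows "(\<integral>u. of_real (p u) * h u * monomial u \<alpha> \<partial>torus) = 0"
  using assms
proof (induction arbitrary: h \<alpha>)
  case (linear p)
  note [measurable] = linear.prems(1)
  note [continuous_intros] = linear.prems(2) continuous_on_monomial_Torus
  define A where "A j = p (axis j 1)" for j
  define B where "B j = p (axis j \<i>)" for j
  have p: "p u = (\<Sum>j\<in>UNIV. Re (u $ j) * A j + Im (u $ j) * B j)" for u
  proof -
    interpret bounded_linear p by fact
    have "u = (\<Sum>j\<in>UNIV. axis j (u $ j))" by (simp add: vec_eq_iff axis_def)
    then have "p u = (\<Sum>j\<in>UNIV. p (axis j (u $ j)))" by (metis sum)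
    also have "\<dots> = (\<Sum>j\<in>UNIV. Re (u $ j) * A j + Im (u $ j) * B j)"
    proof (rule sum.cong)
      fix j
      have "axis j (u $ j) = Re (u $ j) *\<^sub>R axis j 1 + Im (u $ j) *\<^sub>R axis j \<i>"
        by (auto simp: vec_eq_iff axis_def complex_eq_iff)
      then show "p (axis j (u $ j)) = Re (u $ j) * A j + Im (u $ j) * B j"
        by (simp add: add scaleR A_def B_def)
    qed simp
    finally show ?thesis .
  qed
  \<comment> \<open>Coefficients of \<open>u\<^sub>j\<close> and of its inverse in \<open>A\<^sub>j Re u\<^sub>j + B\<^sub>j Im u\<^sub>j\<close>.\<close>
  define c where "c j = (of_real (A j) - \<i> * of_real (B j)) / 2" for j
  define d where "d j = (of_real (A j) + \<i> * of_real (B j)) / 2" for j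
  have int: "integrable torus (\<lambda>u. h u * monomial u \<gamma>)" for \<gamma>
    by (rule integrable_torus) (measurable, intro continuous_intros)
  have eq: "of_real (p u) * h u * monomial u \<alpha> = 
     (\<Sum>j\<in>UNIV. c j * (h u * monomial u (\<alpha> + axis j 1)) + d j * (h u * monomial u (\<alpha> + axis j (-1))))"
    if u: "u \<in> Torus" for u
  proof -
    have u0: "u $ j \<noteq> 0" for j using u by (rule Torus_nonzero)
    have ma: "monomial u (\<alpha> + axis j m) = monomial u \<alpha> * (u $ j) powi m" for j m
      using u0 by (subst monomial_add) (auto simp: monomial_axis)
    have "of_real (Re (u $ j) * A j + Im (u $ j) * B j) = c j * (u $ j) + d j * (u $ j) powi (-1)" for j
    proof -
      have "(u $ j) powi (-1) = cnj (u $ j)"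
        using u by (simp add: Torus_def power_int_minus inverse_eq_cnj)
      moreover have "of_real (Re (u $ j)) = (u $ j + cnj (u $ j)) / 2"
          "of_real (Im (u $ j)) = - \<i> * (u $ j - cnj (u $ j)) / 2"
        by (auto simp: complex_eq_iff)
      ultimately show ?thesis
        by (simp only: of_real_add of_real_mult c_def d_def) (simp add: field_simps)
    qed
    then have "of_real (p u) = (\<Sum>j\<in>UNIV. c j * (u $ j) + d j * (u $ j) powi (-1))"
      by (simp add: p)
    then show ?thesis
      by (simp add: ma sum_distrib_right sum_distrib_left algebra_simps)
  qed
  have "(\<integral>u. of_real (p u) * h u * monomial u \<alpha> \<partial>torus) = 
     (\<integral>u. (\<Sum>j\<in>UNIV. c j * (h u * monomial u (\<alpha> + axis j 1)) + d j * (h u * monomial u (\<alpha> + axis j (-1)))) \<partial>torus)"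
  proof (rule integral_cong_AE)
    have [measurable]: "p \<in> borel_measurable borel"
      using linear.hyps by (intro borel_measurable_continuous_onI linear_continuous_on)
    show "(\<lambda>u. of_real (p u) * h u * monomial u \<alpha>) \<in> borel_measurable torus" by measurable
    show "AE u in torus. of_real (p u) * h u * monomial u \<alpha> = 
     (\<Sum>j\<in>UNIV. c j * (h u * monomial u (\<alpha> + axis j 1)) + d j * (h u * monomial u (\<alpha> + axis j (-1))))"
      using AE_torus by eventually_elim (rule eq)
  qed measurable
  also have "\<dots> = (\<Sum>j\<in>UNIV. c j * (\<integral>u. h u * monomial u (\<alpha> + axis j 1) \<partial>torus) 
       + d j * (\<integral>u. h u * monomial u (\<alpha> + axis j (-1)) \<partial>torus))"
    using int by (subst Bochner_Integration.integral_sum) auto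
  also have "\<dots> = 0" by (simp add: linear.prems(3))
  finally show ?case .
next
  case (const c)
  have "(\<integral>u. of_real c * (h u * monomial u \<alpha>) \<partial>torus) = of_real c * (\<integral>u. h u * monomial u \<alpha> \<partial>torus)"
    by (rule integral_mult_right_zero)
  then show ?case using const.prems(3) by (simp add: mult.assoc)
next
  case (add p q)
  note [measurable] = add.prems(1)
  have int: "integrable torus (\<lambda>u. of_real (r u) * h u * monomial u \<alpha>)" if r: "real_polynomial_function r" for r
  proof -
    have cr: "continuous_on S r" for S
      using r by (intro continuous_on_polymonial_function) (simp add: real_polynomial_function_eq)
    then have [measurable]: "r \<in> borel_measurable borel" by (intro borel_measurable_continuous_onI)
    show ?thesis
      by (rule integrable_torus) (measurable, intro continuous_intros cr add.prems continuous_on_monomial_Torus)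
  qed
  have "(\<integral>u. of_real (p u + q u) * h u * monomial u \<alpha> \<partial>torus) =
    (\<integral>u. of_real (p u) * h u * monomial u \<alpha> + of_real (q u) * h u * monomial u \<alpha> \<partial>torus)"
    by (simp add: algebra_simps)
  also have "\<dots> = 0"
    using int add.hyps add.IH(1)[OF add.prems] add.IH(2)[OF add.prems] by simp
  finally show ?case .
next
  case (mult p q)
  note [measurable] = mult.prems(1)
  have cq: "continuous_on S q" for S
    using mult.hyps by (intro continuous_on_polymonial_function) (simp add: real_polynomial_function_eq)
  then have [measurable]: "q \<in> borel_measurable borel" by (intro borel_measurable_continuous_onI)
  have "(\<integral>u. of_real (p u) * (of_real (q u) * h u) * monomial u \<alpha> \<partial>torus) = 0"
    by (rule mult.IH(1)) (auto intro!: continuous_intros cq mult.prems mult.IH(2))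
  then show ?case by (simp add: mult_ac)
qed

text \<open>By the Stone--Weierstrass theorem and the preceding lemma, \<open>h\<close> is orthogonal to all continuous
functions, in particular to itself. The value at \<open>1\<close> is all that is needed below.\<close>

lemma torus_fourier_unique:
  fixes h :: "complex ^ 'n::finite \<Rightarrow> complex"
  assumes m[measurable]: "h \<in> borel_measurable borel" and cont: "continuous_on Torus h"
    and zero: "\<And>\<alpha>. (\<integral>u. h u * monomial u \<alpha> \<partial>torus) = 0"
  shows "h 1 = 0"
proof -
  have real_part: "(\<integral>u. of_real (R u) * h u \<partial>torus) = 0"
    if [measurable]: "R \<in> borel_measurable borel" and R: "continuous_on Torus R" for R :: "complex ^ 'n \<Rightarrow> real"
  proof -
    define I where "I = (\<integral>u. norm (h u) \<partial>torus)"
    have inth: "integrable torus h" by (rule integrable_torus[OF m cont])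
    have "I \<ge> 0" by (simp add: I_def)
    have "norm (\<integral>u. of_real (R u) * h u \<partial>torus) \<le> e * (I + 1)" if "e > 0" for e
    proof -
      obtain g where g: "real_polynomial_function g" "\<And>x. x \<in> Torus \<Longrightarrow> \<bar>R x - g x\<bar> < e"
        using Stone_Weierstrass_real_polynomial_function[OF compact_Torus R \<open>e > 0\<close>] by blast
      have cg: "continuous_on S g" for S
        using g by (intro continuous_on_polymonial_function) (simp add: real_polynomial_function_eq)
      then have [measurable]: "g \<in> borel_measurable borel" by (intro borel_measurable_continuous_onI)
      have "(\<integral>u. of_real (g u) * h u \<partial>torus) = 0"
        using torus_fourier_polynomial[OF g(1) m cont zero, of 0] by simp
      moreover have "integrable torus (\<lambda>u. of_real (g u) * h u)" "integrable torus (\<lambda>u. of_real (R u) * h u)"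
        by (rule integrable_torus; measurable; intro continuous_intros cg R cont)+
      ultimately have "(\<integral>u. of_real (R u) * h u \<partial>torus) = (\<integral>u. of_real (R u) * h u - of_real (g u) * h u \<partial>torus)"
        by simp
      also have "norm \<dots> \<le> (\<integral>u. norm (of_real (R u) * h u - of_real (g u) * h u) \<partial>torus)"
        by (rule integral_norm_bound)
      also have "\<dots> \<le> (\<integral>u. e * norm (h u) \<partial>torus)"
      proof (rule integral_mono_AE)
        show "integrable torus (\<lambda>u. norm (of_real (R u) * h u - of_real (g u) * h u))"
          by (intro integrable_norm integrable_torus; measurable; intro continuous_intros cg R cont)
        show "integrable torus (\<lambda>u. e * norm (h u))" using inth by simp
      next
        show "AE u in torus. norm (of_real (R u) * h u - of_real (g u) * h u) \<le> e * norm (h u)"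
          using AE_torus
        proof eventually_elim
          case (elim u)
          have "norm (of_real (R u) * h u - of_real (g u) * h u) = \<bar>R u - g u\<bar> * norm (h u)"
            by (simp flip: left_diff_distrib of_real_diff add: norm_mult)
          then show ?case using g(2)[OF elim] by (simp add: mult_right_mono)
        qed
      qed
      also have "\<dots> \<le> e * (I + 1)" using \<open>e > 0\<close> by (simp add: I_def)
      finally show ?thesis .
    qed
    then have "norm (\<integral>u. of_real (R u) * h u \<partial>torus) \<le> 0 + e" if "e > 0" for e
    proof -
      have "e / (I + 1) > 0" using \<open>I \<ge> 0\<close> that by simp
      from this \<open>e > 0\<close> show ?thesis using \<open>\<And>e. e > 0 \<Longrightarrow> norm (\<integral>u. of_real (R u) * h u \<partial>torus) \<le> e * (I + 1)\<close>[of "e / (I + 1)"] \<open>I \<ge> 0\<close> by simp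
    qed
    then have "norm (\<integral>u. of_real (R u) * h u \<partial>torus) \<le> 0" by (rule field_le_epsilon)
    then show ?thesis by simp
  qed
  have cRe: "continuous_on Torus (\<lambda>u. Re (h u))" "continuous_on Torus (\<lambda>u. Im (h u))"
    by (intro continuous_intros cont)+
  have "(\<integral>u. of_real ((norm (h u))\<^sup>2) \<partial>torus) = (\<integral>u. of_real (Re (h u)) * h u - \<i> * (of_real (Im (h u)) * h u) \<partial>torus)"
    by (intro Bochner_Integration.integral_cong)
       (auto simp: complex_eq_iff cmod_power2[unfolded power2_eq_square] power2_eq_square)
  also have "\<dots> = (\<integral>u. of_real (Re (h u)) * h u \<partial>torus) - \<i> * (\<integral>u. of_real (Im (h u)) * h u \<partial>torus)"
    by (subst Bochner_Integration.integral_diff)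
       (auto intro!: integrable_torus integrable_mult_right continuous_intros cont)
  also have "\<dots> = 0" using real_part[OF _ cRe(1)] real_part[OF _ cRe(2)] by simp
  finally have "(\<integral>u. (norm (h u))\<^sup>2 \<partial>torus) = 0"
    by (simp only: integral_complex_of_real of_real_eq_0_iff)
  moreover have "integrable torus (\<lambda>u. (norm (h u))\<^sup>2)"
  proof -
    have "integrable torus (\<lambda>u. complex_of_real ((norm (h u))\<^sup>2))"
      by (rule integrable_torus) (measurable, intro continuous_intros cont)
    then show ?thesis by (simp only: complex_of_real_integrable_eq)
  qed
  ultimately have AE0: "AE u in torus. (norm (h u))\<^sup>2 = 0"
    by (subst (asm) integral_nonneg_eq_0_iff_AE) auto
  show ?thesis
  proof (rule ccontr)
    assume "h 1 \<noteq> 0"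
    obtain e where e: "e > 0" "\<And>u. u \<in> Torus \<Longrightarrow> dist u 1 < e \<Longrightarrow> dist (h u) (h 1) < norm (h 1)"
      using cont[unfolded continuous_on_iff, rule_format, of 1 "norm (h 1)"] \<open>h 1 \<noteq> 0\<close> by auto
    define \<delta> where "\<delta> = e / real CARD('n)"
    have "\<delta> > 0" using e by (simp add: \<delta>_def)
    have nonzero: "h u \<noteq> 0" if "u \<in> Torus" "\<forall>j. u $ j \<in> ball 1 \<delta>" for u
    proof -
      have "dist u 1 \<le> (\<Sum>j\<in>UNIV. norm ((u - 1) $ j))" unfolding dist_norm by (rule norm_vec_le_sum)
      also have "\<dots> < (\<Sum>j\<in>(UNIV::'n set). \<delta>)"
        using that by (intro sum_strict_mono) (auto simp: dist_norm norm_minus_commute)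
      also have "\<dots> = e" by (simp add: \<delta>_def)
      finally have "dist (h u) (h 1) < norm (h 1)" using e that by blast
      then show ?thesis by auto
    qed
    have "AE u in torus. u \<notin> {u::complex^'n. \<forall>j. u $ j \<in> ball 1 \<delta>}"
      using AE0 AE_torus by eventually_elim (use nonzero in auto)
    moreover have "{u::complex^'n. \<forall>j. u $ j \<in> ball 1 \<delta>} \<in> sets torus"
      by (simp add: borel_polyball_one)
    ultimately have "emeasure torus {u::complex^'n. \<forall>j. u $ j \<in> ball 1 \<delta>} = 0"
      by (subst (asm) AE_iff_measurable[where N="{u::complex^'n. \<forall>j. u $ j \<in> ball 1 \<delta>}"]) auto
    then show False using emeasure_torus_pos[OF \<open>\<delta> > 0\<close>, where 'n='n] by simp
  qed
qed

section \<open>Slices of holomorphic functions and rotations\<close>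

text \<open>The vector \<open>z\<close> with its coordinate \<open>j\<close> replaced by \<open>w\<close>.\<close>

definition vec_upd :: "complex ^ 'n \<Rightarrow> 'n \<Rightarrow> complex \<Rightarrow> complex ^ 'n" where
  "vec_upd z j w = (\<chi> i. if i = j then w else z $ i)"

lemma vec_upd_nth [simp]: "vec_upd z j w $ i = (if i = j then w else z $ i)"
  by (simp add: vec_upd_def)

lemma vec_upd_self [simp]: "vec_upd z j (z $ j) = z"
  by (simp add: vec_eq_iff)

lemma has_derivative_vec_upd:
  fixes z :: "complex ^ 'n::finite"
  shows "(vec_upd z j has_derivative axis j) (at w)"
proof -
  have "bounded_linear (axis j :: complex \<Rightarrow> complex ^ 'n)"
    by (rule linear_conv_bounded_linear[THEN iffD1], rule linearI) (auto simp: vec_eq_iff axis_def)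
  from has_derivative_add[OF has_derivative_const bounded_linear.has_derivative[OF this has_derivative_ident]]
  have "((\<lambda>w. vec_upd z j 0 + axis j w) has_derivative axis j) (at w)"
    by simp
  moreover have "(\<lambda>w. vec_upd z j 0 + axis j w) = vec_upd z j"
    by (auto simp: vec_eq_iff axis_def)
  ultimately show ?thesis by simp
qed

lemma continuous_on_vec_upd: "continuous_on S (vec_upd z j)"
  by (rule has_derivative_continuous_on, rule has_derivative_at_withinI, rule has_derivative_vec_upd)

lemma holomorphic_on_vec_slice:
  assumes "holomorphic_on_vec f \<Omega>"
  shows "(\<lambda>w. f (vec_upd z j w)) holomorphic_on (vec_upd z j -` \<Omega>)"
  unfolding holomorphic_on_def
proof
  fix w assume "w \<in> vec_upd z j -` \<Omega>"
  then obtain D where D: "(f has_derivative D) (at (vec_upd z j w))" "\<And>c v. D (c *s v) = c * D v"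
    using assms unfolding holomorphic_on_vec_def by force
  have "((\<lambda>w. f (vec_upd z j w)) has_derivative (\<lambda>h. D (axis j h))) (at w)"
    by (rule has_derivative_compose[OF has_derivative_vec_upd D(1)])
  moreover have "D (axis j h) = D (axis j 1) * h" for h
  proof -
    have "h *s axis j 1 = axis j h" by (auto simp: vec_eq_iff axis_def)
    then show ?thesis using D(2)[of h "axis j 1"] by (metis mult.commute)
  qed
  then have "(\<lambda>h. D (axis j h)) = (*) (D (axis j 1))" by (rule ext)
  ultimately have "((\<lambda>w. f (vec_upd z j w)) has_field_derivative D (axis j 1)) (at w)"
    by (simp only: has_field_derivative_def)
  then show "(\<lambda>w. f (vec_upd z j w)) field_differentiable at w within vec_upd z j -` \<Omega>"
    by (metis field_differentiable_at_within field_differentiable_def)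
qed

lemma holomorphic_on_vec_imp_continuous_on:
  assumes "holomorphic_on_vec f \<Omega>"
  shows "continuous_on \<Omega> f"
proof (rule continuous_at_imp_continuous_on, rule ballI)
  fix z assume "z \<in> \<Omega>"
  then show "isCont f z"
    using assms unfolding holomorphic_on_vec_def by (meson has_derivative_continuous)
qed

lemma continuous_on_vec_times [continuous_intros]:
  fixes f g :: "'a::topological_space \<Rightarrow> complex ^ 'n"
  assumes "continuous_on S f" "continuous_on S g"
  shows "continuous_on S (\<lambda>x. f x * g x)"
  unfolding times_vec_def by (intro continuous_intros assms)

lemma measurable_vec_times [measurable]:
  fixes f g :: "'a \<Rightarrow> complex ^ 'n::finite"
  assumes [measurable]: "f \<in> borel_measurable M" "g \<in> borel_measurable M"
  shows "(\<lambda>x. f x * g x) \<in> borel_measurable M"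
  by (rule borel_measurable_continuous_Pair[OF assms]) (intro continuous_intros)

lemma norm_Torus_mult: "u \<in> Torus \<Longrightarrow> norm ((u * z) $ j) = norm (z $ j)"
  by (simp add: Torus_def norm_mult)

lemma distr_lborel_Torus:
  assumes "u \<in> Torus"
  shows "distr lborel borel (\<lambda>z. u * z) = (lborel :: (complex ^ 'n::finite) measure)"
proof (rule distr_lborel_linear_isometry)
  show "linear (\<lambda>z. u * z)" by (rule linearI) (auto simp: vec_eq_iff algebra_simps)
  show "norm (u * z) = norm z" for z :: "complex ^ 'n"
    unfolding norm_vec_def norm_Torus_mult[OF assms] ..
qed

lemma nn_integral_Torus_rotate:
  fixes g :: "complex ^ 'n::finite \<Rightarrow> ennreal"
  assumes "u \<in> Torus" and [measurable]: "g \<in> borel_measurable borel"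
  shows "(\<integral>\<^sup>+z. g (u * z) \<partial>lborel) = (\<integral>\<^sup>+z. g z \<partial>lborel)"
proof -
  have "(\<integral>\<^sup>+z. g z \<partial>lborel) = (\<integral>\<^sup>+z. g z \<partial>distr lborel borel (\<lambda>z. u * z))"
    by (simp add: distr_lborel_Torus[OF assms(1)])
  then show ?thesis by (subst (asm) nn_integral_distr) auto
qed

lemma integral_Torus_rotate:
  fixes g :: "complex ^ 'n::finite \<Rightarrow> 'b::{banach, second_countable_topology}"
  assumes "u \<in> Torus" and [measurable]: "g \<in> borel_measurable borel"
  shows "(\<integral>z. g (u * z) \<partial>lborel) = (\<integral>z. g z \<partial>lborel)"
    and "integrable lborel (\<lambda>z. g (u * z)) \<longleftrightarrow> integrable lborel g"
proof -
  have "(\<integral>z. g z \<partial>lborel) = (\<integral>z. g z \<partial>distr lborel borel (\<lambda>z. u * z))"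
    by (simp add: distr_lborel_Torus[OF assms(1)])
  then show "(\<integral>z. g (u * z) \<partial>lborel) = (\<integral>z. g z \<partial>lborel)" by (subst (asm) integral_distr) auto
  have "integrable lborel g \<longleftrightarrow> integrable (distr lborel borel (\<lambda>z. u * z)) g"
    by (simp add: distr_lborel_Torus[OF assms(1)])
  then show "integrable lborel (\<lambda>z. g (u * z)) \<longleftrightarrow> integrable lborel g"
    by (subst (asm) integrable_distr_eq) auto
qed

section \<open>Laurent expansion on Reinhardt domains\<close>

text \<open>An open set that depends only on the moduli of the coordinates. The assumption \<open>interval\<close> says this, and
also that the moduli of one coordinate that are possible for given moduli of the others form an interval.
Connectedness is needed in the form \<open>chain\<close>: every point is reached from the base point \<open>p\<close> by
changing one coordinate at a time, each time starting from a point all of whose coordinates are nonzero. It is phrased as an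
induction principle for a predicate \<open>Q\<close>.\<close>

locale reinhardt =
  fixes \<Omega> :: "(complex ^ 'n::finite) set" and p :: "complex ^ 'n"
  assumes open_domain: "open \<Omega>"
    and interval: "\<And>z1 z2 w j. z1 \<in> \<Omega> \<Longrightarrow> z2 \<in> \<Omega> \<Longrightarrow>
        (\<And>i. i \<noteq> j \<Longrightarrow> norm (z1 $ i) = norm (w $ i)) \<Longrightarrow> (\<And>i. i \<noteq> j \<Longrightarrow> norm (z2 $ i) = norm (w $ i)) \<Longrightarrow>
        norm (z1 $ j) \<le> norm (w $ j) \<Longrightarrow> norm (w $ j) \<le> norm (z2 $ j) \<Longrightarrow> w \<in> \<Omega>"
    and p_in: "p \<in> \<Omega>" and p_nonzero: "\<And>j. p $ j \<noteq> 0"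
    and chain: "\<And>Q z. z \<in> \<Omega> \<Longrightarrow> Q p \<Longrightarrow>
        (\<And>z j w. z \<in> \<Omega> \<Longrightarrow> vec_upd z j w \<in> \<Omega> \<Longrightarrow> (\<And>i. z $ i \<noteq> 0) \<Longrightarrow> Q z \<Longrightarrow> Q (vec_upd z j w)) \<Longrightarrow> Q z"
begin

lemma rotation_invariant: "z \<in> \<Omega> \<Longrightarrow> (\<And>j. norm (w $ j) = norm (z $ j)) \<Longrightarrow> w \<in> \<Omega>"
  by (rule interval[of z z undefined w]) auto

lemma Torus_mult_in: "u \<in> Torus \<Longrightarrow> u * z \<in> \<Omega> \<longleftrightarrow> z \<in> \<Omega>"
  by (auto intro: rotation_invariant[of z "u * z"] rotation_invariant[of "u * z" z] simp del: vector_mult_component simp: norm_Torus_mult)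

lemma borel_domain [measurable]: "\<Omega> \<in> sets borel"
  using open_domain by simp

end

locale reinhardt_holomorphic = reinhardt +
  fixes f :: "complex ^ 'n::finite \<Rightarrow> complex"
  assumes hol: "holomorphic_on_vec f \<Omega>"
begin

text \<open>The extension of \<open>f\<close> by zero, which is measurable on the whole space.\<close>

definition F :: "complex ^ 'n \<Rightarrow> complex" where
  "F z = (if z \<in> \<Omega> then f z else 0)"

lemma measurable_F [measurable]: "F \<in> borel_measurable borel"
proof -
  have "(\<lambda>z. indicator \<Omega> z *\<^sub>R f z) \<in> borel_measurable borel"
    using hol by (intro borel_measurable_continuous_on_indicator holomorphic_on_vec_imp_continuous_on) auto
  also have "(\<lambda>z. indicator \<Omega> z *\<^sub>R f z) = F" by (auto simp: F_def indicator_def)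
  finally show ?thesis .
qed

lemma continuous_on_F: "continuous_on \<Omega> F"
  using holomorphic_on_vec_imp_continuous_on[OF hol] by (simp add: F_def cong: continuous_on_cong)

lemma continuous_on_F_Torus:
  assumes "z \<in> \<Omega>"
  shows "continuous_on Torus (\<lambda>u. F (u * z))"
  by (rule continuous_on_compose2[OF continuous_on_F]) (use assms Torus_mult_in in \<open>auto intro!: continuous_intros\<close>)

text \<open>The Fourier coefficient with index \<open>\<alpha>\<close> of \<open>f\<close> on the torus through \<open>z\<close>.\<close>

definition torus_coeff :: "int ^ 'n \<Rightarrow> complex ^ 'n \<Rightarrow> complex" where
  "torus_coeff \<alpha> z = (\<integral>u. F (u * z) * monomial u (- \<alpha>) \<partial>torus)"

lemma integrable_torus_coeff:
  assumes "z \<in> \<Omega>"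
  shows "integrable torus (\<lambda>u. F (u * z) * monomial u \<alpha>)"
  by (rule integrable_torus)
     (measurable, intro continuous_intros continuous_on_F_Torus continuous_on_monomial_Torus assms)

text \<open>The one-variable statement \<open>circ_coeff_scale\<close>, applied to the coordinate \<open>j\<close> for almost all values of
the other coordinates of the torus.\<close>

lemma torus_coeff_upd:
  assumes z: "z \<in> \<Omega>" and zw: "vec_upd z j w \<in> \<Omega>"
  shows "torus_coeff \<alpha> z * w powi (\<alpha> $ j) = torus_coeff \<alpha> (vec_upd z j w) * (z $ j) powi (\<alpha> $ j)"
proof -
  define M where "M = PiM (UNIV - {j}) (\<lambda>_::'n. circ)"
  \<comment> \<open>A torus point consists of \<open>x\<close> for the coordinates other than \<open>j\<close>, and \<open>u\<close> for the coordinate \<open>j\<close>.\<close>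
  define X where "X x = (\<chi> i. x i * z $ i)" for x :: "'n \<Rightarrow> complex"
  define R where "R x = (\<Prod>i\<in>UNIV - {j}. x i powi (- (\<alpha> $ i)))" for x :: "'n \<Rightarrow> complex"
  define I where "I v x = (\<integral>u. F (vec_upd (X x) j (u * v)) * u powi (- (\<alpha> $ j)) \<partial>circ)" for v x
  have fold: "torus_coeff \<alpha> (vec_upd z j v) = (\<integral>x. R x * I v x \<partial>M)"
    and meas: "(\<lambda>x. R x * I v x) \<in> borel_measurable M" if v: "vec_upd z j v \<in> \<Omega>" for v
  proof -
    let ?y = "\<lambda>x u. (\<chi> i. (x(j := u)) i)"
    have eq: "F (?y x u * vec_upd z j v) * monomial (?y x u) (- \<alpha>)
        = R x * (F (vec_upd (X x) j (u * v)) * u powi (- (\<alpha> $ j)))" for x u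
    proof -
      have "?y x u * vec_upd z j v = vec_upd (X x) j (u * v)"
        by (auto simp: vec_eq_iff X_def)
      moreover have "monomial (?y x u) (- \<alpha>) = u powi (- (\<alpha> $ j)) * R x"
        unfolding monomial_def R_def by (subst prod.remove[of _ j]) (auto intro!: prod.cong)
      ultimately show ?thesis by (simp add: mult_ac)
    qed
    have "torus_coeff \<alpha> (vec_upd z j v) = (\<integral>x. (\<integral>u. F (?y x u * vec_upd z j v) * monomial (?y x u) (- \<alpha>) \<partial>circ) \<partial>M)"
      unfolding torus_coeff_def M_def by (rule integral_torus_insert[OF integrable_torus_coeff[OF v]])
    also have "\<dots> = (\<integral>x. R x * I v x \<partial>M)"
      unfolding eq I_def by simp
    finally show "torus_coeff \<alpha> (vec_upd z j v) = (\<integral>x. R x * I v x \<partial>M)" .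
    have "(\<lambda>(x, u). x(j := u)) \<in> measurable (M \<Otimes>\<^sub>M circ) (PiM (insert j (UNIV - {j})) (\<lambda>_::'n. circ))"
      unfolding M_def by (rule measurable_add_dim)
    moreover have "insert j (UNIV - {j}) = (UNIV :: 'n set)" by auto
    ultimately have [measurable]: "(\<lambda>(x, u). x(j := u)) \<in> measurable (M \<Otimes>\<^sub>M circ) (PiM UNIV (\<lambda>_::'n. circ))" by simp
    have [measurable]: "(\<lambda>(x, u). ?y x u) \<in> borel_measurable (M \<Otimes>\<^sub>M circ)"
      using measurable_compose[OF \<open>(\<lambda>(x, u). x(j := u)) \<in> measurable (M \<Otimes>\<^sub>M circ) (PiM UNIV (\<lambda>_::'n. circ))\<close> measurable_vec_lambda_circ]
      by (simp add: case_prod_unfold)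
    have "(\<lambda>x. \<integral>u. F (?y x u * vec_upd z j v) * monomial (?y x u) (- \<alpha>) \<partial>circ) \<in> borel_measurable M"
      by (rule circ.borel_measurable_lebesgue_integral) measurable
    then show "(\<lambda>x. R x * I v x) \<in> borel_measurable M"
      unfolding eq I_def by simp
  qed
  have AE: "AE x in M. R x * I (z $ j) x * w powi (\<alpha> $ j) = R x * I w x * (z $ j) powi (\<alpha> $ j)"
    using AE_PiM_circ[OF finite, of "UNIV - {j}"] unfolding M_def
  proof eventually_elim
    case (elim x)
    have norm_X: "norm (X x $ i) = norm (z $ i)" if "i \<noteq> j" for i
      using elim that by (simp add: X_def norm_mult)
    define A where "A = vec_upd (X x) j -` \<Omega>"
    have "I (z $ j) x * w powi (\<alpha> $ j) = I w x * (z $ j) powi (\<alpha> $ j)"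
      unfolding I_def
    proof (rule circ_coeff_scale[of "\<lambda>v. F (vec_upd (X x) j v)" A])
      show "(\<lambda>v. F (vec_upd (X x) j v)) holomorphic_on A"
        using holomorphic_on_vec_slice[OF hol, of "X x" j]
        unfolding A_def by (rule holomorphic_transform) (auto simp: F_def)
      show "open A" unfolding A_def using open_domain by (intro open_vimage continuous_on_vec_upd)
      have [measurable]: "vec_upd (X x) j \<in> borel_measurable borel"
        by (intro borel_measurable_continuous_onI continuous_on_vec_upd)
      show "(\<lambda>v. F (vec_upd (X x) j v)) \<in> borel_measurable borel" by measurable
      show "z $ j \<in> A" "w \<in> A"
        using rotation_invariant[OF z, of "vec_upd (X x) j (z $ j)"] rotation_invariant[OF zw, of "vec_upd (X x) j w"] norm_X
        by (auto simp: A_def)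
      fix v1 v2 v :: complex assume "v1 \<in> A" "v2 \<in> A" "norm v1 \<le> norm v" "norm v \<le> norm v2"
      then show "v \<in> A"
        unfolding A_def vimage_eq using interval[of "vec_upd (X x) j v1" "vec_upd (X x) j v2" j "vec_upd (X x) j v"] by simp
    qed
    then show ?case by (simp add: mult.assoc)
  qed
  have "torus_coeff \<alpha> z * w powi (\<alpha> $ j) = (\<integral>x. R x * I (z $ j) x * w powi (\<alpha> $ j) \<partial>M)"
    using fold[of "z $ j"] z by simp
  also have "\<dots> = (\<integral>x. R x * I w x * (z $ j) powi (\<alpha> $ j) \<partial>M)"
    using meas[of "z $ j"] meas[of w] z zw AE by (intro integral_cong_AE) auto
  also have "\<dots> = torus_coeff \<alpha> (vec_upd z j w) * (z $ j) powi (\<alpha> $ j)"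
    using fold[OF zw] by simp
  finally show ?thesis .
qed

text \<open>The coefficients of the Laurent expansion of \<open>f\<close>.\<close>

definition laurent_coeff :: "int ^ 'n \<Rightarrow> complex" where
  "laurent_coeff \<alpha> = torus_coeff \<alpha> p / monomial p \<alpha>"

text \<open>At points with zero coordinates this holds with the convention that zero to a nonzero power is zero.\<close>

lemma torus_coeff_eq:
  assumes "z \<in> \<Omega>"
  shows "torus_coeff \<alpha> z = laurent_coeff \<alpha> * monomial z \<alpha>"
  using assms
proof (rule chain)
  show "torus_coeff \<alpha> p = laurent_coeff \<alpha> * monomial p \<alpha>"
    using p_nonzero by (simp add: laurent_coeff_def monomial_eq_0_iff)
next
  fix z j w assume z: "z \<in> \<Omega>" "vec_upd z j w \<in> \<Omega>" "\<And>i. z $ i \<noteq> 0" and IH: "torus_coeff \<alpha> z = laurent_coeff \<alpha> * monomial z \<alpha>"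
  have 1: "monomial (vec_upd z j w) \<alpha> = w powi (\<alpha> $ j) * (\<Prod>i\<in>UNIV - {j}. (z $ i) powi (\<alpha> $ i))"
    unfolding monomial_def by (subst prod.remove[of _ j]) (auto intro!: prod.cong)
  have 2: "monomial z \<alpha> = (z $ j) powi (\<alpha> $ j) * (\<Prod>i\<in>UNIV - {j}. (z $ i) powi (\<alpha> $ i))"
    unfolding monomial_def by (subst prod.remove[of _ j]) auto
  have "torus_coeff \<alpha> (vec_upd z j w) * (z $ j) powi (\<alpha> $ j) = laurent_coeff \<alpha> * monomial z \<alpha> * w powi (\<alpha> $ j)"
    using torus_coeff_upd[OF z(1,2), of \<alpha>] IH by simp
  also have "\<dots> = laurent_coeff \<alpha> * monomial (vec_upd z j w) \<alpha> * (z $ j) powi (\<alpha> $ j)"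
    by (simp add: 1 2)
  finally show "torus_coeff \<alpha> (vec_upd z j w) = laurent_coeff \<alpha> * monomial (vec_upd z j w) \<alpha>"
    using z(3) by simp
qed

text \<open>Absolute convergence of the Laurent series is an assumption here. For square integrable \<open>f\<close> on the
domains considered below it is a by-product of termwise integration against the kernel series.\<close>

lemma laurent_series:
  assumes z: "z \<in> \<Omega>" and sm: "(\<lambda>\<alpha>. norm (laurent_coeff \<alpha> * monomial z \<alpha>)) summable_on UNIV"
  shows "((\<lambda>\<alpha>. laurent_coeff \<alpha> * monomial z \<alpha>) has_sum f z) UNIV"
proof -
  define t where "t \<alpha> u = laurent_coeff \<alpha> * monomial z \<alpha> * monomial u \<alpha>" for \<alpha> and u :: "complex ^ 'n"
  define G where "G u = infsum (\<lambda>\<alpha>. t \<alpha> u) UNIV" for u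
  have norm_t: "norm (t \<alpha> u) = norm (laurent_coeff \<alpha> * monomial z \<alpha>)" if "u \<in> Torus" for u \<alpha>
    unfolding t_def norm_mult norm_monomial_Torus[OF that] by simp
  have G: "((\<lambda>\<alpha>. t \<alpha> u) has_sum G u) UNIV" if "u \<in> Torus" for u
  proof -
    have "(\<lambda>\<alpha>. norm (t \<alpha> u)) summable_on UNIV" unfolding norm_t[OF that] by (rule sm)
    from abs_summable_summable[OF this] show ?thesis unfolding G_def by (rule has_sum_infsum)
  qed
  have cont_G: "continuous_on Torus G"
  proof (rule continuous_on_has_sum[OF G sm])
    show "norm (t \<alpha> u) \<le> norm (laurent_coeff \<alpha> * monomial z \<alpha>)" if "u \<in> Torus" for \<alpha> u
      using norm_t[OF that] by (rule eq_refl)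
    show "continuous_on Torus (t \<alpha>)" for \<alpha>
      unfolding t_def by (intro continuous_intros continuous_on_monomial_Torus)
  qed
  define H where "H u = indicator Torus u *\<^sub>R G u" for u
  have Torus_borel [measurable]: "(Torus :: (complex ^ 'n) set) \<in> sets borel"
    using compact_Torus by (intro borel_closed compact_imp_closed)
  have [measurable]: "H \<in> borel_measurable borel"
    unfolding H_def by (intro borel_measurable_continuous_on_indicator cont_G Torus_borel)
  have H: "H u = G u" if "u \<in> Torus" for u using that by (simp add: H_def)
  have cont_H: "continuous_on Torus H" using cont_G H by (simp cong: continuous_on_cong)
  have coeff_H: "(\<integral>u. H u * monomial u \<beta> \<partial>torus) = laurent_coeff (- \<beta>) * monomial z (- \<beta>)" for \<beta>
  proof -
    \<comment> \<open>Outside the torus the series need not converge, so it is cut off there.\<close>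
    define s where "s \<alpha> u = indicator Torus u *\<^sub>R (t \<alpha> u * monomial u \<beta>)" for \<alpha> u
    have [measurable]: "s \<alpha> \<in> borel_measurable borel" for \<alpha>
      unfolding s_def t_def by measurable
    have int_s: "integrable torus (s \<alpha>)" for \<alpha>
      by (rule torus.integrable_const_bound[of _ "norm (laurent_coeff \<alpha> * monomial z \<alpha>)"])
         (auto simp: s_def t_def norm_mult norm_monomial_Torus intro!: AE_I2 split: split_indicator)
    have "((\<lambda>\<alpha>. \<integral>u. s \<alpha> u \<partial>torus) has_sum (\<integral>u. H u * monomial u \<beta> \<partial>torus)) UNIV"
    proof (rule has_sum_integral[OF int_s])
      show "(\<lambda>\<alpha>. \<integral>u. norm (s \<alpha> u) \<partial>torus) summable_on UNIV"
      proof (rule summable_on_comparison_test[OF sm])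
        fix \<alpha>
        have "norm (s \<alpha> u) \<le> norm (laurent_coeff \<alpha> * monomial z \<alpha>)" for u
          by (simp add: s_def t_def norm_mult norm_monomial_Torus split: split_indicator)
        then have "(\<integral>u. norm (s \<alpha> u) \<partial>torus) \<le> (\<integral>u. norm (laurent_coeff \<alpha> * monomial z \<alpha>) \<partial>(torus :: (complex^'n) measure))"
          by (intro integral_mono integrable_norm[OF int_s]) simp_all
        then show "(\<integral>u. norm (s \<alpha> u) \<partial>torus) \<le> norm (laurent_coeff \<alpha> * monomial z \<alpha>)"
          by (simp add: prob_space.prob_space[OF prob_space_torus, simplified])
      qed auto
      fix u :: "complex ^ 'n"
      show "((\<lambda>\<alpha>. s \<alpha> u) has_sum H u * monomial u \<beta>) UNIV"
        by (cases "u \<in> Torus") (auto simp: s_def H_def intro!: has_sum_cmult_left G)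
    qed
    moreover have "(\<integral>u. s \<alpha> u \<partial>torus) = (if \<alpha> = - \<beta> then laurent_coeff \<alpha> * monomial z \<alpha> else 0)" for \<alpha>
    proof -
      have "(\<integral>u. s \<alpha> u \<partial>torus) = (\<integral>u. (laurent_coeff \<alpha> * monomial z \<alpha>) * monomial u (\<alpha> + \<beta>) \<partial>torus)"
      proof (rule integral_cong_AE)
        show "AE u in torus. s \<alpha> u = (laurent_coeff \<alpha> * monomial z \<alpha>) * monomial u (\<alpha> + \<beta>)"
          using AE_torus
          by eventually_elim (simp add: s_def t_def monomial_add Torus_nonzero)
      qed (use int_s in auto)
      then show ?thesis by (simp add: integral_torus_monomial eq_neg_iff_add_eq_0)
    qed
    moreover have "((\<lambda>\<alpha>. if \<alpha> = - \<beta> then laurent_coeff \<alpha> * monomial z \<alpha> else 0) has_sum laurent_coeff (- \<beta>) * monomial z (- \<beta>)) UNIV"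
      by (rule has_sum_finite_neutralI[of "{- \<beta>}"]) auto
    ultimately show ?thesis using has_sum_unique by fastforce
  qed
  define h where "h u = F (u * z) - H u" for u
  have "h 1 = 0"
  proof (rule torus_fourier_unique)
    show "h \<in> borel_measurable borel" unfolding h_def by measurable
    show "continuous_on Torus h" unfolding h_def by (intro continuous_intros cont_H continuous_on_F_Torus z)
    fix \<beta>
    have "(\<integral>u. h u * monomial u \<beta> \<partial>torus) = (\<integral>u. F (u * z) * monomial u \<beta> - H u * monomial u \<beta> \<partial>torus)"
      by (simp add: h_def left_diff_distrib)
    also have "\<dots> = (\<integral>u. F (u * z) * monomial u \<beta> \<partial>torus) - (\<integral>u. H u * monomial u \<beta> \<partial>torus)"
      by (intro Bochner_Integration.integral_diff integrable_torus_coeff z integrable_torus continuous_intros cont_H continuous_on_monomial_Torus)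
         measurable
    also have "\<dots> = 0"
      using torus_coeff_eq[OF z, of "- \<beta>"] by (simp add: coeff_H torus_coeff_def)
    finally show "(\<integral>u. h u * monomial u \<beta> \<partial>torus) = 0" .
  qed
  then have "G 1 = f z" using z H[of 1] by (simp add: h_def F_def)
  moreover have "t \<alpha> 1 = laurent_coeff \<alpha> * monomial z \<alpha>" for \<alpha> by (simp add: t_def monomial_def)
  ultimately show ?thesis using G[of 1] by simp
qed

end

section \<open>Square integrable functions on Reinhardt domains\<close>

locale reinhardt_bergman = reinhardt_holomorphic \<Omega> p f
  for \<Omega> :: "(complex ^ 'n::finite) set" and p :: "complex ^ 'n" and f :: "complex ^ 'n \<Rightarrow> complex" +
  assumes f_L2: "set_integrable lborel \<Omega> (\<lambda>z. (norm (f z))\<^sup>2)"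
begin

lemma F_L2: "integrable lborel (\<lambda>z. (norm (F z))\<^sup>2)"
proof -
  have "(\<lambda>z. indicator \<Omega> z *\<^sub>R (norm (f z))\<^sup>2) = (\<lambda>z. (norm (F z))\<^sup>2)"
    by (auto simp: F_def indicator_def)
  then show ?thesis using f_L2 unfolding set_integrable_def by simp
qed

text \<open>By Jensen's inequality the square integral of \<open>a\<^sub>\<alpha> z\<^sup>\<alpha>\<close> is at most that of \<open>f\<close>.\<close>

lemma coeff_L2:
  assumes "laurent_coeff \<alpha> \<noteq> 0"
  shows "set_integrable lborel \<Omega> (\<lambda>z. (norm (monomial z \<alpha>))\<^sup>2)"
proof -
  have le: "(norm (laurent_coeff \<alpha> * monomial z \<alpha>))\<^sup>2 \<le> (\<integral>u. (norm (F (u * z)))\<^sup>2 \<partial>torus)" if z: "z \<in> \<Omega>" for z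
  proof -
    define X where "X u = norm (F (u * z))" for u
    have [measurable]: "X \<in> borel_measurable borel" unfolding X_def by measurable
    have X_int: "integrable torus X" "integrable torus (\<lambda>u. (X u)\<^sup>2)"
    proof -
      have "integrable torus (\<lambda>u. complex_of_real (X u))" "integrable torus (\<lambda>u. complex_of_real ((X u)\<^sup>2))"
        by (rule integrable_torus; measurable; simp only: X_def; intro continuous_intros continuous_on_F_Torus z)+
      then show "integrable torus X" "integrable torus (\<lambda>u. (X u)\<^sup>2)"
        unfolding complex_of_real_integrable_eq .
    qed
    have "norm (laurent_coeff \<alpha> * monomial z \<alpha>) = norm (torus_coeff \<alpha> z)" using torus_coeff_eq[OF z] by simp
    also have "\<dots> \<le> (\<integral>u. norm (F (u * z) * monomial u (- \<alpha>)) \<partial>torus)"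
      unfolding torus_coeff_def by (rule integral_norm_bound)
    also have "\<dots> = (\<integral>u. X u \<partial>torus)"
    proof (rule integral_cong_AE)
      show "AE u in torus. norm (F (u * z) * monomial u (- \<alpha>)) = X u"
        using AE_torus by eventually_elim (simp add: X_def norm_mult norm_monomial_Torus)
    qed measurable
    finally have "(norm (laurent_coeff \<alpha> * monomial z \<alpha>))\<^sup>2 \<le> (\<integral>u. X u \<partial>torus)\<^sup>2" by (intro power_mono) auto
    also have "\<dots> \<le> (\<integral>u. (X u)\<^sup>2 \<partial>torus)"
      using torus.variance_eq[OF X_int] torus.variance_positive[of X] by simp
    finally show ?thesis by (simp add: X_def)
  qed
  interpret P: pair_sigma_finite "torus :: (complex ^ 'n) measure" "lborel :: (complex ^ 'n) measure" ..
  have "(\<integral>\<^sup>+z. ennreal (indicator \<Omega> z * (norm (laurent_coeff \<alpha> * monomial z \<alpha>))\<^sup>2) \<partial>lborel)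
      \<le> (\<integral>\<^sup>+z. (\<integral>\<^sup>+u. ennreal ((norm (F (u * z)))\<^sup>2) \<partial>torus) \<partial>lborel)"
  proof (rule nn_integral_mono)
    fix z :: "complex ^ 'n"
    show "ennreal (indicator \<Omega> z * (norm (laurent_coeff \<alpha> * monomial z \<alpha>))\<^sup>2) \<le> (\<integral>\<^sup>+u. ennreal ((norm (F (u * z)))\<^sup>2) \<partial>torus)"
    proof (cases "z \<in> \<Omega>")
      case True
      have "integrable torus (\<lambda>u. complex_of_real ((norm (F (u * z)))\<^sup>2))"
        by (rule integrable_torus; measurable; intro continuous_intros continuous_on_F_Torus True)
      then have "integrable torus (\<lambda>u. (norm (F (u * z)))\<^sup>2)"
        unfolding complex_of_real_integrable_eq .
      then show ?thesis using le[OF True] True by (simp add: nn_integral_eq_integral ennreal_leI)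
    qed simp
  qed
  also have "\<dots> = (\<integral>\<^sup>+u. (\<integral>\<^sup>+z. ennreal ((norm (F (u * z)))\<^sup>2) \<partial>lborel) \<partial>torus)"
    by (rule P.Fubini') measurable
  also have "\<dots> = (\<integral>\<^sup>+u. (\<integral>\<^sup>+z. ennreal ((norm (F z))\<^sup>2) \<partial>lborel) \<partial>(torus :: (complex ^ 'n) measure))"
  proof (rule nn_integral_cong_AE)
    show "AE u in torus. (\<integral>\<^sup>+z. ennreal ((norm (F (u * z)))\<^sup>2) \<partial>lborel) = (\<integral>\<^sup>+z. ennreal ((norm (F z))\<^sup>2) \<partial>lborel)"
      using AE_torus
    proof eventually_elim
      case (elim u)
      show ?case by (rule nn_integral_Torus_rotate[OF elim, of "\<lambda>z. ennreal ((norm (F z))\<^sup>2)"]) measurable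
    qed
  qed
  also have "\<dots> < \<infinity>"
    using F_L2 by (simp add: nn_integral_eq_integral prob_space.emeasure_space_1[OF prob_space_torus, simplified])
  finally have "integrable lborel (\<lambda>z. indicator \<Omega> z * (norm (laurent_coeff \<alpha> * monomial z \<alpha>))\<^sup>2)"
    by (intro integrableI_bounded) (auto simp: abs_mult)
  then have "integrable lborel (\<lambda>z. (1 / (norm (laurent_coeff \<alpha>))\<^sup>2) * (indicator \<Omega> z * (norm (laurent_coeff \<alpha> * monomial z \<alpha>))\<^sup>2))"
    by (rule integrable_mult_right)
  moreover have "(1 / (norm (laurent_coeff \<alpha>))\<^sup>2) * (indicator \<Omega> z * (norm (laurent_coeff \<alpha> * monomial z \<alpha>))\<^sup>2) = indicator \<Omega> z *\<^sub>R (norm (monomial z \<alpha>))\<^sup>2" for z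
    using assms by (simp add: norm_mult power_mult_distrib)
  ultimately show ?thesis unfolding set_integrable_def by simp
qed

text \<open>The inner product of \<open>f\<close> with a monomial. Replacing \<open>z\<close> by \<open>uz\<close> does not change the integral; averaging
over \<open>u\<close> turns \<open>f\<close> into \<open>a\<^sub>\<alpha> z\<^sup>\<alpha>\<close>.\<close>

lemma
  assumes "set_integrable lborel \<Omega> (\<lambda>z. (norm (monomial z \<alpha>))\<^sup>2)"
  shows integrable_F_monomial: "integrable lborel (\<lambda>z. F z * cnj (monomial z \<alpha>))"
    and integral_F_monomial_bound: "(\<integral>z. norm (F z * cnj (monomial z \<alpha>)) \<partial>lborel) \<le>
      (\<integral>z. (norm (F z))\<^sup>2 \<partial>lborel) + (LINT z:\<Omega>|lborel. (norm (monomial z \<alpha>))\<^sup>2)"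
    and integral_F_monomial: "(\<integral>z. F z * cnj (monomial z \<alpha>) \<partial>lborel) =
      laurent_coeff \<alpha> * of_real (LINT z:\<Omega>|lborel. (norm (monomial z \<alpha>))\<^sup>2)"
proof -
  define H where "H z = F z * cnj (monomial z \<alpha>)" for z
  define g where "g z = indicator \<Omega> z * (norm (monomial z \<alpha>))\<^sup>2" for z
  have meas_H [measurable]: "H \<in> borel_measurable borel"
  proof -
    have [measurable]: "cnj \<in> borel_measurable borel" 
      by (intro borel_measurable_continuous_onI continuous_intros)
    show ?thesis unfolding H_def by measurable
  qed
  have g_int: "integrable lborel g" using assms by (simp add: set_integrable_def g_def[abs_def])
  have bound: "norm (H z) \<le> (norm (F z))\<^sup>2 + g z" for z
  proof -
    have "norm (H z) \<le> (norm (F z))\<^sup>2 + (norm (monomial z \<alpha>))\<^sup>2"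
    proof -
      have "0 \<le> norm (F z) * norm (monomial z \<alpha>)" by simp
      with sum_squares_bound[of "norm (F z)" "norm (monomial z \<alpha>)"] show ?thesis
        unfolding H_def norm_mult complex_mod_cnj by linarith
    qed
    moreover have "H z = 0" if "z \<notin> \<Omega>" using that by (simp add: H_def F_def)
    ultimately show ?thesis by (cases "z \<in> \<Omega>") (auto simp: g_def)
  qed
  show H_int: "integrable lborel H"
  proof (rule Bochner_Integration.integrable_bound)
    show "integrable lborel (\<lambda>z. (norm (F z))\<^sup>2 + g z)" using F_L2 g_int by (rule Bochner_Integration.integrable_add)
    show "AE z in lborel. norm (H z) \<le> norm ((norm (F z))\<^sup>2 + g z)"
      using bound by (intro AE_I2) (smt (verit) real_norm_def)
  qed simp
  have "(\<integral>z. norm (H z) \<partial>lborel) \<le> (\<integral>z. (norm (F z))\<^sup>2 + g z \<partial>lborel)"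
    using F_L2 g_int H_int bound by (intro integral_mono) auto
  also have "\<dots> = (\<integral>z. (norm (F z))\<^sup>2 \<partial>lborel) + (\<integral>z. g z \<partial>lborel)"
    using F_L2 g_int by simp
  finally show "(\<integral>z. norm (H z) \<partial>lborel) \<le> (\<integral>z. (norm (F z))\<^sup>2 \<partial>lborel) + (LINT z:\<Omega>|lborel. (norm (monomial z \<alpha>))\<^sup>2)"
    by (simp add: set_lebesgue_integral_def g_def)
  interpret P: pair_sigma_finite "torus :: (complex ^ 'n) measure" "lborel :: (complex ^ 'n) measure" ..
  have rotate: "(\<integral>z. H (u * z) \<partial>lborel) = (\<integral>z. H z \<partial>lborel)" "integrable lborel (\<lambda>z. H (u * z))"
     "(\<integral>z. norm (H (u * z)) \<partial>lborel) = (\<integral>z. norm (H z) \<partial>lborel)" if "u \<in> Torus" for u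
    using integral_Torus_rotate[OF that meas_H] H_int integral_Torus_rotate(1)[OF that, of "\<lambda>z. norm (H z)"] by auto
  have pair: "integrable (torus \<Otimes>\<^sub>M lborel) (\<lambda>(u, z). H (u * z))"
  proof (rule P.Fubini_integrable)
    show m: "(\<lambda>(u, z). H (u * z)) \<in> borel_measurable (torus \<Otimes>\<^sub>M lborel)" by measurable
    show "AE u in torus. integrable lborel (\<lambda>z. case (u, z) of (u, z) \<Rightarrow> H (u * z))"
      using AE_torus by eventually_elim (simp add: rotate)
    have "(\<lambda>u. \<integral>z. norm (H (u * z)) \<partial>lborel) \<in> borel_measurable torus"
      by measurable
    then have "integrable torus (\<lambda>u. \<integral>z. norm (H (u * z)) \<partial>lborel)"
      by (rule torus.integrable_const_bound[of _ "\<integral>z. norm (H z) \<partial>lborel", rotated])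
         (use AE_torus in eventually_elim, simp add: rotate)
    then show "integrable torus (\<lambda>u. \<integral>z. norm (case (u, z) of (u, z) \<Rightarrow> H (u * z)) \<partial>lborel)" by simp
  qed
  have "(\<integral>z. H z \<partial>lborel) = (\<integral>u. (\<integral>z. H z \<partial>lborel) \<partial>(torus :: (complex ^ 'n) measure))"
    by (simp add: prob_space.prob_space[OF prob_space_torus, simplified])
  also have "\<dots> = (\<integral>u. (\<integral>z. H (u * z) \<partial>lborel) \<partial>torus)"
    by (rule integral_cong_AE, measurable) (use AE_torus in eventually_elim, simp add: rotate)
  also have "\<dots> = (\<integral>z. (\<integral>u. H (u * z) \<partial>torus) \<partial>lborel)"
    by (rule P.Fubini_integral[symmetric, OF pair])
  also have "\<dots> = (\<integral>z. laurent_coeff \<alpha> * of_real (g z) \<partial>lborel)"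
  proof (rule Bochner_Integration.integral_cong)
    fix z :: "complex ^ 'n"
    have "(\<integral>u. H (u * z) \<partial>torus) = (\<integral>u. cnj (monomial z \<alpha>) * (F (u * z) * monomial u (- \<alpha>)) \<partial>torus)"
    proof (rule integral_cong_AE)
      show "AE u in torus. H (u * z) = cnj (monomial z \<alpha>) * (F (u * z) * monomial u (- \<alpha>))"
        using AE_torus
      proof eventually_elim
        case (elim u)
        then have "cnj (monomial u \<alpha>) = monomial u (- \<alpha>)" by (intro cnj_monomial_unimodular) (simp add: Torus_def)
        then show ?case by (simp add: H_def monomial_mult mult_ac)
      qed
    qed measurable
    also have "\<dots> = cnj (monomial z \<alpha>) * torus_coeff \<alpha> z"
      unfolding torus_coeff_def by (rule integral_mult_right_zero)
    also have "\<dots> = laurent_coeff \<alpha> * of_real (g z)"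
    proof (cases "z \<in> \<Omega>")
      case True
      then show ?thesis
        by (simp add: torus_coeff_eq g_def complex_norm_square mult_ac del: of_real_power)
    next
      case False
      have "torus_coeff \<alpha> z = (\<integral>u. 0 \<partial>(torus :: (complex ^ 'n) measure))"
        unfolding torus_coeff_def
      proof (rule integral_cong_AE)
        show "AE u in torus. F (u * z) * monomial u (- \<alpha>) = 0"
          using AE_torus by eventually_elim (use False Torus_mult_in in \<open>auto simp: F_def\<close>)
      qed measurable
      then show ?thesis using False by (simp add: g_def)
    qed
    finally show "(\<integral>u. H (u * z) \<partial>torus) = laurent_coeff \<alpha> * of_real (g z)" .
  qed simp
  also have "\<dots> = laurent_coeff \<alpha> * of_real (\<integral>z. g z \<partial>lborel)"
    by simp
  finally show "(\<integral>z. H z \<partial>lborel) = laurent_coeff \<alpha> * of_real (LINT z:\<Omega>|lborel. (norm (monomial z \<alpha>))\<^sup>2)"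
    by (simp add: set_lebesgue_integral_def g_def)
qed

end

context reinhardt
begin

text \<open>The reproducing property of the kernel series. Here \<open>c\<^sub>\<alpha>\<close> is the inverse of the square norm of \<open>z\<^sup>\<alpha>\<close>, and zero
if \<open>z\<^sup>\<alpha>\<close> is not square integrable.\<close>

theorem reproducing_series:
  fixes c :: "int ^ 'n \<Rightarrow> real"
  assumes f: "f \<in> bergman_space \<Omega>" and z: "z \<in> \<Omega>"
    and nonneg: "\<And>\<alpha>. c \<alpha> \<ge> 0"
    and pos: "\<And>\<alpha>. c \<alpha> > 0 \<Longrightarrow> set_integrable lborel \<Omega> (\<lambda>z. (norm (monomial z \<alpha>))\<^sup>2)"
      "\<And>\<alpha>. c \<alpha> > 0 \<Longrightarrow> (LINT z:\<Omega>|lborel. (norm (monomial z \<alpha>))\<^sup>2) = 1 / c \<alpha>"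
    and zero: "\<And>\<alpha>. c \<alpha> = 0 \<Longrightarrow> \<not> set_integrable lborel \<Omega> (\<lambda>z. (norm (monomial z \<alpha>))\<^sup>2)"
    and sm: "(\<lambda>\<alpha>. c \<alpha> * norm (monomial z \<alpha>)) summable_on UNIV"
      "(\<lambda>\<alpha>. of_bool (c \<alpha> > 0) * norm (monomial z \<alpha>)) summable_on UNIV"
    and B: "\<And>w. w \<in> \<Omega> \<Longrightarrow> ((\<lambda>\<alpha>. of_real (c \<alpha>) * monomial z \<alpha> * cnj (monomial w \<alpha>)) has_sum B w) UNIV"
  shows "f z = (LINT w:\<Omega>|lborel. f w * B w)"
proof -
  interpret reinhardt_bergman \<Omega> p f
    using f by unfold_locales (auto simp: bergman_space_def)
  define N where "N = (\<integral>w. (norm (F w))\<^sup>2 \<partial>lborel)"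
  define h where "h \<alpha> w = of_real (c \<alpha>) * monomial z \<alpha> * (F w * cnj (monomial w \<alpha>))" for \<alpha> w
  have int: "integrable lborel (h \<alpha>)" for \<alpha>
  proof (cases "c \<alpha> > 0")
    case True
    show ?thesis
      unfolding h_def by (intro integrable_mult_right integrable_F_monomial pos True)
  next
    case False
    then have "c \<alpha> = 0" using nonneg[of \<alpha>] by simp
    then show ?thesis by (simp add: h_def[abs_def])
  qed
  have bound: "(\<integral>w. norm (h \<alpha> w) \<partial>lborel) \<le> N * (c \<alpha> * norm (monomial z \<alpha>)) + of_bool (c \<alpha> > 0) * norm (monomial z \<alpha>)" for \<alpha>
  proof (cases "c \<alpha> > 0")
    case True
    have "norm (h \<alpha> w) = (c \<alpha> * norm (monomial z \<alpha>)) * norm (F w * cnj (monomial w \<alpha>))" for w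
      using True by (simp add: h_def norm_mult)
    then have "(\<integral>w. norm (h \<alpha> w) \<partial>lborel) = (c \<alpha> * norm (monomial z \<alpha>)) * (\<integral>w. norm (F w * cnj (monomial w \<alpha>)) \<partial>lborel)"
      by (simp only: integral_mult_right_zero)
    also have "\<dots> \<le> (c \<alpha> * norm (monomial z \<alpha>)) * (N + 1 / c \<alpha>)"
      using integral_F_monomial_bound[OF pos(1)[OF True]] pos(2)[OF True] True
      by (intro mult_left_mono) (auto simp: N_def)
    also have "\<dots> = N * (c \<alpha> * norm (monomial z \<alpha>)) + norm (monomial z \<alpha>)"
      using True by (simp add: field_simps)
    finally show ?thesis using True by simp
  next
    case False
    then have "c \<alpha> = 0" using nonneg[of \<alpha>] by simp
    then show ?thesis by (simp add: h_def)
  qed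
  have sm_h: "(\<lambda>\<alpha>. \<integral>w. norm (h \<alpha> w) \<partial>lborel) summable_on UNIV"
  proof (rule summable_on_comparison_test)
    show "(\<lambda>\<alpha>. N * (c \<alpha> * norm (monomial z \<alpha>)) + of_bool (c \<alpha> > 0) * norm (monomial z \<alpha>)) summable_on UNIV"
      by (intro summable_on_add summable_on_cmult_right sm)
  qed (use bound in auto)
  have h_sum: "((\<lambda>\<alpha>. h \<alpha> w) has_sum (indicator \<Omega> w *\<^sub>R (f w * B w))) UNIV" for w
  proof (cases "w \<in> \<Omega>")
    case True
    have "h \<alpha> w = f w * (of_real (c \<alpha>) * monomial z \<alpha> * cnj (monomial w \<alpha>))" for \<alpha>
      using True by (simp add: h_def F_def mult_ac)
    then show ?thesis using has_sum_cmult_right[OF B[OF True], of "f w"] True by simp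
  qed (simp add: h_def F_def)
  have "((\<lambda>\<alpha>. \<integral>w. h \<alpha> w \<partial>lborel) has_sum (\<integral>w. indicator \<Omega> w *\<^sub>R (f w * B w) \<partial>lborel)) UNIV"
    by (rule has_sum_integral[OF int sm_h h_sum])
  moreover have "(\<integral>w. h \<alpha> w \<partial>lborel) = laurent_coeff \<alpha> * monomial z \<alpha>" for \<alpha>
  proof (cases "c \<alpha> > 0")
    case True
    have "(\<integral>w. h \<alpha> w \<partial>lborel) = of_real (c \<alpha>) * monomial z \<alpha> * (laurent_coeff \<alpha> * of_real (1 / c \<alpha>))"
      unfolding h_def integral_mult_right_zero integral_F_monomial[OF pos(1)[OF True]] pos(2)[OF True] ..
    then show ?thesis using True by simp
  next
    case False
    then have "c \<alpha> = 0" using nonneg[of \<alpha>] by simp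
    moreover from this have "laurent_coeff \<alpha> = 0" using zero coeff_L2 by blast
    ultimately show ?thesis by (simp add: h_def)
  qed
  ultimately have hs: "((\<lambda>\<alpha>. laurent_coeff \<alpha> * monomial z \<alpha>) has_sum (LINT w:\<Omega>|lborel. f w * B w)) UNIV"
    by (simp add: set_lebesgue_integral_def)
  then have "(\<lambda>\<alpha>. norm (laurent_coeff \<alpha> * monomial z \<alpha>)) summable_on UNIV"
    using summable_on_iff_abs_summable_on_complex[THEN iffD1, OF has_sum_imp_summable] by blast
  from laurent_series[OF z this] hs show ?thesis by (rule has_sum_unique)
qed

text \<open>With weights \<open>p\<^sub>\<alpha> = c\<^sub>\<alpha> |z\<^sup>\<alpha>|\<close>, the Cauchy--Schwarz inequality bounds \<open>|B(w)|\<^sup>2\<close> by the sum of the \<open>p\<^sub>\<alpha>\<close> times the sum \<open>Y(w)\<close>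
of the \<open>p\<^sub>\<alpha> |w\<^sup>\<alpha>|\<^sup>2\<close>; the integral of \<open>Y\<close> is the sum of \<open>|z\<^sup>\<alpha>|\<close> over the indices with \<open>c\<^sub>\<alpha> > 0\<close>.\<close>

theorem kernel_series_L2:
  fixes c :: "int ^ 'n \<Rightarrow> real"
  assumes nonneg: "\<And>\<alpha>. c \<alpha> \<ge> 0"
    and pos: "\<And>\<alpha>. c \<alpha> > 0 \<Longrightarrow> set_integrable lborel \<Omega> (\<lambda>z. (norm (monomial z \<alpha>))\<^sup>2)"
      "\<And>\<alpha>. c \<alpha> > 0 \<Longrightarrow> (LINT z:\<Omega>|lborel. (norm (monomial z \<alpha>))\<^sup>2) = 1 / c \<alpha>"
    and sm: "(\<lambda>\<alpha>. c \<alpha> * norm (monomial z \<alpha>)) summable_on UNIV"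
      "(\<lambda>\<alpha>. of_bool (c \<alpha> > 0) * norm (monomial z \<alpha>)) summable_on UNIV"
    and sm2: "\<And>w. w \<in> \<Omega> \<Longrightarrow> (\<lambda>\<alpha>. c \<alpha> * norm (monomial z \<alpha>) * (norm (monomial w \<alpha>))\<^sup>2) summable_on UNIV"
    and B: "\<And>w. w \<in> \<Omega> \<Longrightarrow> ((\<lambda>\<alpha>. of_real (c \<alpha>) * monomial z \<alpha> * cnj (monomial w \<alpha>)) has_sum B w) UNIV"
    and cont: "continuous_on \<Omega> B"
  shows "set_integrable lborel \<Omega> (\<lambda>w. (norm (B w))\<^sup>2)"
proof -
  define P where "P = infsum (\<lambda>\<alpha>. c \<alpha> * norm (monomial z \<alpha>)) UNIV"
  have P: "((\<lambda>\<alpha>. c \<alpha> * norm (monomial z \<alpha>)) has_sum P) UNIV"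
    using sm(1) by (simp add: P_def)
  define g where "g \<alpha> w = complex_of_real (c \<alpha> * norm (monomial z \<alpha>) * (indicator \<Omega> w * (norm (monomial w \<alpha>))\<^sup>2))" for \<alpha> w
  define Y where "Y w = infsum (\<lambda>\<alpha>. c \<alpha> * norm (monomial z \<alpha>) * (indicator \<Omega> w * (norm (monomial w \<alpha>))\<^sup>2)) UNIV" for w
  have Y: "((\<lambda>\<alpha>. c \<alpha> * norm (monomial z \<alpha>) * (indicator \<Omega> w * (norm (monomial w \<alpha>))\<^sup>2)) has_sum Y w) UNIV" for w
    unfolding Y_def by (cases "w \<in> \<Omega>") (auto intro!: has_sum_infsum sm2)
  have int: "integrable lborel (g \<alpha>)" "(\<integral>w. norm (g \<alpha> w) \<partial>lborel) = of_bool (c \<alpha> > 0) * norm (monomial z \<alpha>)" for \<alpha>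
  proof -
    have "integrable lborel (g \<alpha>) \<and> (\<integral>w. norm (g \<alpha> w) \<partial>lborel) = of_bool (c \<alpha> > 0) * norm (monomial z \<alpha>)"
    proof (cases "c \<alpha> > 0")
      case True
      have i: "integrable lborel (\<lambda>w. indicator \<Omega> w * (norm (monomial w \<alpha>))\<^sup>2)"
        using pos(1)[OF True] by (simp add: set_integrable_def)
      have "integrable lborel (g \<alpha>)"
        unfolding g_def[abs_def] by (intro integrable_of_real integrable_mult_right i)
      moreover have "norm (g \<alpha> w) = c \<alpha> * norm (monomial z \<alpha>) * (indicator \<Omega> w * (norm (monomial w \<alpha>))\<^sup>2)" for w
        unfolding g_def norm_of_real using True by (intro abs_of_nonneg mult_nonneg_nonneg) auto
      ultimately show ?thesis
        using True pos(2)[OF True] by (simp add: set_lebesgue_integral_def)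
    next
      case False
      then have "c \<alpha> = 0" using nonneg[of \<alpha>] by simp
      then show ?thesis by (simp add: g_def[abs_def])
    qed
    then show "integrable lborel (g \<alpha>)" "(\<integral>w. norm (g \<alpha> w) \<partial>lborel) = of_bool (c \<alpha> > 0) * norm (monomial z \<alpha>)" by auto
  qed
  have "integrable lborel (\<lambda>w. complex_of_real (Y w))"
  proof (rule integrable_has_sum[OF int(1)])
    show "(\<lambda>\<alpha>. \<integral>w. norm (g \<alpha> w) \<partial>lborel) summable_on UNIV"
      using sm(2) by (simp add: int(2))
    show "((\<lambda>\<alpha>. g \<alpha> w) has_sum complex_of_real (Y w)) UNIV" for w
      unfolding g_def by (rule has_sum_of_real[OF Y])
  qed
  then have Y_int: "integrable lborel (\<lambda>w. P * Y w)"
    unfolding complex_of_real_integrable_eq by (rule integrable_mult_right)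
  have le: "(norm (B w))\<^sup>2 \<le> P * Y w" if w: "w \<in> \<Omega>" for w
  proof -
    have abs: "(\<lambda>\<alpha>. norm (of_real (c \<alpha>) * monomial z \<alpha> * cnj (monomial w \<alpha>))) summable_on UNIV"
      by (rule summable_on_iff_abs_summable_on_complex[THEN iffD1, OF has_sum_imp_summable[OF B[OF w]]])
    define X where "X = infsum (\<lambda>\<alpha>. c \<alpha> * norm (monomial z \<alpha>) * norm (monomial w \<alpha>)) UNIV"
    have eq: "norm (of_real (c \<alpha>) * monomial z \<alpha> * cnj (monomial w \<alpha>)) = c \<alpha> * norm (monomial z \<alpha>) * norm (monomial w \<alpha>)" for \<alpha>
      using nonneg[of \<alpha>] by (simp add: norm_mult)
    have X: "((\<lambda>\<alpha>. c \<alpha> * norm (monomial z \<alpha>) * norm (monomial w \<alpha>)) has_sum X) UNIV"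
      using abs unfolding eq X_def by (rule has_sum_infsum)
    have "norm (B w) \<le> X"
      by (rule norm_infsum_le[OF B[OF w] X]) (simp add: eq)
    then have "(norm (B w))\<^sup>2 \<le> X\<^sup>2" by (intro power_mono) auto
    also have "X\<^sup>2 \<le> P * Y w"
      by (rule has_sum_weighted_square_le[OF _ P X]) (use Y[of w] w nonneg in auto)
    finally show ?thesis .
  qed
  have m: "(\<lambda>w. indicator \<Omega> w *\<^sub>R (norm (B w))\<^sup>2) \<in> borel_measurable borel"
    by (intro borel_measurable_continuous_on_indicator continuous_intros cont) simp
  show ?thesis
    unfolding set_integrable_def
  proof (rule Bochner_Integration.integrable_bound[OF Y_int])
    show "(\<lambda>w. indicator \<Omega> w *\<^sub>R (norm (B w))\<^sup>2) \<in> borel_measurable lborel" using m by simp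
    have "P \<ge> 0" "Y w \<ge> 0" for w
      using has_sum_nonneg[OF P] has_sum_nonneg[OF Y] nonneg by auto
    then show "AE w in lborel. norm (indicator \<Omega> w *\<^sub>R (norm (B w))\<^sup>2) \<le> norm (P * Y w)"
      using le by (intro AE_I2) (auto split: split_indicator)
  qed
qed

end

section \<open>The generating function\<close>

lemma finite_vec_box:
  "finite {\<beta>::int^'n::finite. \<forall>a. lo a \<le> \<beta> $ a \<and> \<beta> $ a \<le> hi a}"
proof (rule finite_subset)
  show "{\<beta>::int^'n. \<forall>a. lo a \<le> \<beta> $ a \<and> \<beta> $ a \<le> hi a} \<subseteq> (\<lambda>f. \<chi> a. f a) ` (PiE UNIV (\<lambda>a. {lo a..hi a}))"
  proof
    fix \<beta> :: "int ^ 'n" assume "\<beta> \<in> {\<beta>. \<forall>a. lo a \<le> \<beta> $ a \<and> \<beta> $ a \<le> hi a}"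
    then show "\<beta> \<in> (\<lambda>f. \<chi> a. f a) ` (PiE UNIV (\<lambda>a. {lo a..hi a}))"
      by (intro image_eqI[of _ _ "\<lambda>a. \<beta> $ a"]) auto
  qed
qed (auto intro!: finite_imageI finite_PiE)

lemma Dcoeff_second_difference:
  assumes "l > 0"
  shows "Dcoeff l (m - 1) = max 0 m - 2 * max 0 (m - l) + max 0 (m - 2 * l)"
  using assms by (auto simp: Dcoeff_def max_def)

lemma Dcoeff_reflect: "Dcoeff l (2 * l - m - 1) = Dcoeff l (m - 1)"
  by (auto simp: Dcoeff_def)

text \<open>Inversion of the second difference: \<open>max(0, m)\<close> is recovered from \<open>D\<^sub>l\<close>, as \<open>1/(1 - y)\<^sup>2\<close> has the
coefficients \<open>j + 1\<close>. Only finitely many terms are nonzero, and their sum telescopes.\<close>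

lemma has_sum_Dcoeff:
  assumes "l > 0"
  shows "((\<lambda>j::nat. of_nat (Suc j) * of_int (Dcoeff l (m - l * int j - 1)) :: complex) has_sum of_int (max 0 m)) UNIV"
proof -
  define p where "p j = max 0 (m - l * int j)" for j
  have D: "Dcoeff l (m - l * int j - 1) = p j - 2 * p (Suc j) + p (Suc (Suc j))" for j
    using Dcoeff_second_difference[OF assms, of "m - l * int j"] by (simp add: p_def algebra_simps)
  have part: "(\<Sum>j<J. int (Suc j) * Dcoeff l (m - l * int j - 1)) = p 0 - int (Suc J) * p J + int J * p (Suc J)" for J
    unfolding D by (induction J) (auto simp: algebra_simps)
  define J where "J = nat m"
  have J: "m \<le> l * int j" if "j \<ge> J" for j
  proof -
    have "m \<le> int j" using that by (simp add: J_def)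
    also have "int j \<le> l * int j" using assms by (simp add: mult_le_cancel_right1)
    finally show ?thesis .
  qed
  show ?thesis
  proof (rule has_sum_finite_neutralI[of "{..<J}"])
    fix j assume "j \<in> UNIV - {..<J}"
    then show "of_nat (Suc j) * of_int (Dcoeff l (m - l * int j - 1)) = (0::complex)"
      using J[of j] by (simp add: Dcoeff_def)
  next
    have "(\<Sum>j<J. int (Suc j) * Dcoeff l (m - l * int j - 1)) = max 0 m"
      using J[of J] J[of "Suc J"] unfolding part by (simp add: p_def)
    then have "complex_of_int (max 0 m) = of_int (\<Sum>j<J. int (Suc j) * Dcoeff l (m - l * int j - 1))"
      by simp
    then show "complex_of_int (max 0 m) = (\<Sum>j<J. of_nat (Suc j) * of_int (Dcoeff l (m - l * int j - 1)))"
      by (simp only: of_int_sum of_int_mult of_int_of_nat_eq)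
  qed auto
qed

text \<open>Division of a Laurent series by \<open>(1 - y)\<^sup>2\<close>, where \<open>T \<alpha>\<close> plays the role of the monomial with exponent \<open>\<alpha>\<close> and \<open>y\<close> that of the one with
exponent \<open>s\<close>.\<close>

lemma geometric_shift_sum:
  fixes e T :: "int ^ 'n::finite \<Rightarrow> complex" and s :: "int ^ 'n"
  assumes E: "((\<lambda>\<alpha>. e \<alpha> * T \<alpha>) has_sum E) UNIV" and y: "norm y < 1"
    and T: "\<And>\<alpha> j. e \<alpha> \<noteq> 0 \<Longrightarrow> T \<alpha> * y ^ j = T (\<alpha> + of_nat j * s)"
    and c: "\<And>\<alpha>. ((\<lambda>j. of_nat (Suc j) * e (\<alpha> - of_nat j * s)) has_sum c \<alpha>) UNIV"
  shows "((\<lambda>\<alpha>. c \<alpha> * T \<alpha>) has_sum (E / (1 - y)\<^sup>2)) UNIV"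
proof -
  define g where "g = (\<lambda>(\<alpha>, j). (e \<alpha> * T \<alpha>) * (of_nat (Suc j) * y ^ j))"
  have geo: "((\<lambda>j. of_nat (Suc j) * z ^ j) has_sum 1 / (1 - z)\<^sup>2) UNIV"
    if "norm z < 1" for z :: "'b::{real_normed_field, banach}"
  proof (rule norm_summable_imp_has_sum)
    show "(\<lambda>n. of_nat (Suc n) * z ^ n) sums (1 / (1 - z)\<^sup>2)" by (rule geometric_deriv_sums[OF that])
    have "(\<lambda>n. of_nat (Suc n) * norm z ^ n) sums (1 / (1 - norm z)\<^sup>2)"
      using that by (intro geometric_deriv_sums) simp
    then show "summable (\<lambda>n. norm (of_nat (Suc n) * z ^ n))"
      by (simp add: sums_iff norm_mult norm_power del: of_nat_Suc)
  qed
  have gn: "(\<lambda>x. norm (g x)) summable_on UNIV \<times> UNIV"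
  proof (rule summable_on_SigmaI)
    fix \<alpha>
    have "((\<lambda>j. norm (e \<alpha> * T \<alpha>) * (of_nat (Suc j) * norm y ^ j)) has_sum (norm (e \<alpha> * T \<alpha>) * (1 / (1 - norm y)\<^sup>2))) UNIV"
      using y by (intro has_sum_cmult_right geo) simp
    then show "((\<lambda>j. norm (g (\<alpha>, j))) has_sum (norm (e \<alpha> * T \<alpha>) * (1 / (1 - norm y)\<^sup>2))) UNIV"
      by (simp add: g_def norm_mult norm_power del: of_nat_Suc)
  next
    have "(\<lambda>\<alpha>. norm (e \<alpha> * T \<alpha>)) summable_on UNIV"
      by (rule summable_on_iff_abs_summable_on_complex[THEN iffD1, OF has_sum_imp_summable[OF E]])
    then show "(\<lambda>\<alpha>. norm (e \<alpha> * T \<alpha>) * (1 / (1 - norm y)\<^sup>2)) summable_on UNIV"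
      by (rule summable_on_cmult_left)
  qed auto
  have "(g has_sum (E * (1 / (1 - y)\<^sup>2))) (UNIV \<times> UNIV)"
  proof (rule has_sum_SigmaI)
    show "((\<lambda>j. g (\<alpha>, j)) has_sum (e \<alpha> * T \<alpha> * (1 / (1 - y)\<^sup>2))) UNIV" for \<alpha>
      unfolding g_def case_prod_conv by (intro has_sum_cmult_right geo y)
    show "((\<lambda>\<alpha>. e \<alpha> * T \<alpha> * (1 / (1 - y)\<^sup>2)) has_sum (E * (1 / (1 - y)\<^sup>2))) UNIV"
      by (rule has_sum_cmult_left[OF E])
    show "g summable_on UNIV \<times> UNIV" using gn by (rule abs_summable_summable)
  qed
  moreover have "(g has_sum (E * (1 / (1 - y)\<^sup>2))) (UNIV \<times> UNIV) \<longleftrightarrow>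
     ((\<lambda>(\<alpha>, j). of_nat (Suc j) * e (\<alpha> - of_nat j * s) * T \<alpha>) has_sum (E / (1 - y)\<^sup>2)) (UNIV \<times> UNIV)"
  proof (rule has_sum_reindex_bij_witness[where i="\<lambda>(\<alpha>, j). (\<alpha> - of_nat j * s, j)" and j="\<lambda>(\<alpha>, j). (\<alpha> + of_nat j * s, j)"])
    fix x :: "(int ^ 'n) \<times> nat"
    obtain \<alpha> j where x: "x = (\<alpha>, j)" by (cases x)
    show "(case (case x of (\<alpha>, j) \<Rightarrow> (\<alpha> + of_nat j * s, j)) of (\<alpha>, j) \<Rightarrow> of_nat (Suc j) * e (\<alpha> - of_nat j * s) * T \<alpha>) = g x"
      using T[of \<alpha> j] by (cases "e \<alpha> = 0") (auto simp: x g_def)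
  qed auto
  ultimately have "((\<lambda>(\<alpha>, j). of_nat (Suc j) * e (\<alpha> - of_nat j * s) * T \<alpha>) has_sum (E / (1 - y)\<^sup>2)) (UNIV \<times> UNIV)"
    by blast
  then show ?thesis
    by (rule has_sum_SigmaD) (unfold case_prod_conv, rule has_sum_cmult_left[OF c])
qed

text \<open>Absolute values \<open>k\<^sub>a\<close> of the exponents, of which the one with index \<open>i1\<close> counts as positive and the others as
negative. Any common multiple \<open>K\<close> of them will do; \<open>l a\<close> is \<open>K / k\<^sub>a\<close>.\<close>

locale hartogs =
  fixes i1 :: "'n::finite" and k :: "int ^ 'n" and K :: int and l :: "'n \<Rightarrow> int"
  assumes k_pos: "\<And>a. k $ a > 0" and K_pos: "K > 0" and lk: "\<And>a. l a * k $ a = K"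
begin

lemma l_pos: "l a > 0"
proof -
  have "l a * k $ a > 0" using lk[of a] K_pos by simp
  then show ?thesis using k_pos[of a] by (simp add: zero_less_mult_iff)
qed

text \<open>The integers \<open>m\<^sub>a(\<alpha>)\<close>: up to positive constants, they are the exponents that occur in the integration of \<open>|z\<^sup>\<alpha>|\<^sup>2\<close>.\<close>

definition m :: "'n \<Rightarrow> int ^ 'n \<Rightarrow> int" where
  "m a \<alpha> = (if a = i1 then 0 else l a * (\<alpha> $ a + 1)) + l i1 * (\<alpha> $ i1 + 1)"

text \<open>The exponent vectors \<open>s\<^sub>a\<close>, and the amount \<open>lam a\<close> by which translation by \<open>s\<^sub>a\<close> changes \<open>m\<^sub>a\<close>.\<close>

definition lam :: "'n \<Rightarrow> int" where
  "lam a = (if a = i1 then K else l a)"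

definition s :: "'n \<Rightarrow> int ^ 'n" where
  "s a = (if a = i1 then (\<chi> b. if b = i1 then k $ b else - k $ b) else axis a 1)"

lemma lam_pos: "lam a > 0"
  using K_pos l_pos by (simp add: lam_def)

lemma of_nat_vec_nth [simp]: "(of_nat j :: int ^ 'n) $ a = of_nat j"
  by (induction j) auto

lemma m_shift: "m a (\<alpha> - of_nat j * s b) = m a \<alpha> - (if a = b then lam b * int j else 0)"
proof -
  have "l a * (int j * k $ a) = l i1 * (int j * k $ i1)"
    using lk[of a] lk[of i1] by (metis mult.left_commute)
  moreover have "l i1 * (int j * k $ i1) = K * int j" using lk[of i1] by (metis mult.left_commute mult.commute)
  ultimately show ?thesis
    by (auto simp: m_def s_def lam_def axis_def algebra_simps)
qed

text \<open>The coefficients after division by \<open>(1 - y\<^sub>a)\<^sup>2\<close> for the \<open>a\<close> in \<open>S\<close>, where \<open>y\<^sub>a\<close> is the monomial with exponent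
\<open>s\<^sub>a\<close>. For empty \<open>S\<close> they have finite support, and for \<open>S = UNIV\<close> they are those of the kernel series.\<close>

definition coef :: "'n set \<Rightarrow> int ^ 'n \<Rightarrow> int" where
  "coef S \<alpha> = (\<Prod>a\<in>UNIV. if a \<in> S then max 0 (m a \<alpha>) else Dcoeff (lam a) (m a \<alpha> - 1))"

lemma coef_nonzero_imp:
  assumes "coef S \<alpha> \<noteq> 0"
  shows "m a \<alpha> > 0"
proof -
  have "(if a \<in> S then max 0 (m a \<alpha>) else Dcoeff (lam a) (m a \<alpha> - 1)) \<noteq> 0"
    using assms unfolding coef_def by (subst (asm) prod_zero_iff) auto
  then show ?thesis by (auto simp: Dcoeff_def split: if_splits)
qed

lemma coef_nonzero_imp_nonneg:
  assumes "coef S \<alpha> \<noteq> 0"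
  shows "\<alpha> $ i1 \<ge> 0"
  using coef_nonzero_imp[OF assms, of i1] l_pos[of i1] by (simp add: m_def zero_less_mult_iff)

text \<open>The domain: the monomials \<open>y\<^sub>a\<close> with exponents \<open>s\<^sub>a\<close> are defined and have modulus less than one.\<close>

definition hartogs_dom :: "(complex ^ 'n) set" where
  "hartogs_dom = {t. (\<forall>a. a \<noteq> i1 \<longrightarrow> t $ a \<noteq> 0) \<and> (\<forall>a. norm (monomial t (s a)) < 1)}"

lemma monomial_shift:
  assumes t: "\<And>a. a \<noteq> i1 \<Longrightarrow> t $ a \<noteq> 0" and "\<alpha> $ i1 \<ge> 0"
  shows "monomial t \<alpha> * monomial t (s b) ^ j = monomial t (\<alpha> + of_nat j * s b)"
proof (induction j)
  case (Suc j)
  have s1: "s b $ i1 \<ge> 0" using k_pos[of i1] by (simp add: s_def axis_def)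
  have "monomial t (\<alpha> + of_nat (Suc j) * s b) = monomial t ((\<alpha> + of_nat j * s b) + s b)"
    by (simp add: algebra_simps)
  also have "\<dots> = monomial t (\<alpha> + of_nat j * s b) * monomial t (s b)"
  proof (rule monomial_add)
    fix a
    show "t $ a \<noteq> 0 \<or> 0 \<le> (\<alpha> + of_nat j * s b) $ a \<and> 0 \<le> s b $ a"
      using t[of a] assms(2) s1 by (cases "a = i1") auto
  qed
  finally show ?case using Suc.IH by (simp add: mult_ac)
qed simp

lemma generating_function:
  assumes t: "t \<in> hartogs_dom" and fin: "finite A0" and A0: "\<And>\<alpha>. coef {} \<alpha> \<noteq> 0 \<Longrightarrow> \<alpha> \<in> A0"
  shows "((\<lambda>\<alpha>. of_int (coef S \<alpha>) * monomial t \<alpha>) has_sum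
     (\<Sum>\<alpha>\<in>A0. of_int (coef {} \<alpha>) * monomial t \<alpha>) / (\<Prod>a\<in>S. (1 - monomial t (s a))\<^sup>2)) UNIV"
  using finite[of S]
proof (induction S rule: finite_induct)
  case empty
  show ?case
    by (rule has_sum_finite_neutralI[OF fin]) (use A0 in auto)
next
  case (insert b S)
  let ?E = "(\<Sum>\<alpha>\<in>A0. of_int (coef {} \<alpha>) * monomial t \<alpha>) / (\<Prod>a\<in>S. (1 - monomial t (s a))\<^sup>2)"
  have "((\<lambda>\<alpha>. of_int (coef (insert b S) \<alpha>) * monomial t \<alpha>) has_sum (?E / (1 - monomial t (s b))\<^sup>2)) UNIV"
  proof (rule geometric_shift_sum[OF insert.IH, where s = "s b"])
    show "norm (monomial t (s b)) < 1" using t by (simp add: hartogs_dom_def)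
    show "monomial t \<alpha> * monomial t (s b) ^ j = monomial t (\<alpha> + of_nat j * s b)"
      if "complex_of_int (coef S \<alpha>) \<noteq> 0" for \<alpha> j
      using that t by (intro monomial_shift) (auto simp: hartogs_dom_def coef_nonzero_imp_nonneg)
    fix \<alpha>
    define r where "r = (\<Prod>a\<in>UNIV - {b}. if a \<in> S then max 0 (m a \<alpha>) else Dcoeff (lam a) (m a \<alpha> - 1))"
    have 1: "coef (insert b S) \<alpha> = max 0 (m b \<alpha>) * r"
      unfolding coef_def r_def by (subst prod.remove[of _ b]) (auto intro!: prod.cong)
    have 2: "coef S (\<alpha> - of_nat j * s b) = Dcoeff (lam b) (m b \<alpha> - lam b * int j - 1) * r" for j
    proof -
      have mb: "m b (\<alpha> - of_nat j * s b) = m b \<alpha> - lam b * int j"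
        and ma: "a \<noteq> b \<Longrightarrow> m a (\<alpha> - of_nat j * s b) = m a \<alpha>" for a
        by (simp_all only: m_shift if_True if_False diff_zero simp_thms)
      have "coef S (\<alpha> - of_nat j * s b) = Dcoeff (lam b) (m b \<alpha> - lam b * int j - 1) *
          (\<Prod>a\<in>UNIV - {b}. if a \<in> S then max 0 (m a (\<alpha> - of_nat j * s b)) else Dcoeff (lam a) (m a (\<alpha> - of_nat j * s b) - 1))"
        unfolding coef_def using insert.hyps by (subst prod.remove[of _ b]) (simp_all add: mb)
      also have "(\<Prod>a\<in>UNIV - {b}. if a \<in> S then max 0 (m a (\<alpha> - of_nat j * s b)) else Dcoeff (lam a) (m a (\<alpha> - of_nat j * s b) - 1)) = r"
        unfolding r_def by (rule prod.cong) (simp_all add: ma)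
      finally show ?thesis .
    qed
    have "((\<lambda>j. of_nat (Suc j) * of_int (Dcoeff (lam b) (m b \<alpha> - lam b * int j - 1)) * of_int r) has_sum
        (of_int (max 0 (m b \<alpha>)) * complex_of_int r)) UNIV"
      by (intro has_sum_cmult_left has_sum_Dcoeff lam_pos)
    then show "((\<lambda>j. of_nat (Suc j) * complex_of_int (coef S (\<alpha> - of_nat j * s b))) has_sum of_int (coef (insert b S) \<alpha>)) UNIV"
      unfolding 1 2 by (simp add: mult.assoc)
  qed
  then show ?case using insert.hyps by (simp add: mult.commute)
qed

text \<open>The index set and the coefficients of the numerator. Translation by \<open>\<kappa>\<close> corresponds to clearing the
square of the product of the \<open>t\<^sub>b\<close> to the power \<open>k\<^sub>b\<close> from the denominators.\<close>

definition G :: "(int ^ 'n) set" where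
  "G = {\<beta>. 0 \<le> \<beta> $ i1 \<and> \<beta> $ i1 \<le> 2 * k $ i1 - 2 \<and> (\<forall>b. b \<noteq> i1 \<longrightarrow> 0 \<le> \<beta> $ b \<and> \<beta> $ b \<le> 2 * k $ b)}"

definition C :: "int ^ 'n \<Rightarrow> int" where
  "C \<beta> = Dcoeff K (2 * K - l i1 * (\<beta> $ i1 + 1) - 1) *
           (\<Prod>b\<in>UNIV - {i1}. Dcoeff (l b) (l b * (\<beta> $ b + 1) + l i1 * (\<beta> $ i1 + 1) - 2 * K - 1))"

definition \<kappa> :: "int ^ 'n" where
  "\<kappa> = (\<chi> b. if b = i1 then 0 else 2 * k $ b)"

lemma finite_G: "finite G"
  by (rule finite_subset[OF _ finite_vec_box[of "\<lambda>_. 0" "\<lambda>a. if a = i1 then 2 * k $ i1 - 2 else 2 * k $ a"]])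
     (auto simp: G_def)

lemma coef_C: "coef {} (\<beta> - \<kappa>) = C \<beta>"
proof -
  have "coef {} (\<beta> - \<kappa>) = Dcoeff K (l i1 * (\<beta> $ i1 + 1) - 1) *
     (\<Prod>b\<in>UNIV - {i1}. Dcoeff (l b) (l b * (\<beta> $ b + 1) + l i1 * (\<beta> $ i1 + 1) - 2 * K - 1))"
    unfolding coef_def
  proof (subst prod.remove[of _ i1], goal_cases)
    case 3
    have "Dcoeff (lam b) (m b (\<beta> - \<kappa>) - 1) = Dcoeff (l b) (l b * (\<beta> $ b + 1) + l i1 * (\<beta> $ i1 + 1) - 2 * K - 1)" if "b \<noteq> i1" for b
    proof -
      have "m b (\<beta> - \<kappa>) = l b * (\<beta> $ b + 1) + l i1 * (\<beta> $ i1 + 1) - 2 * (l b * k $ b)"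
        using that by (simp add: m_def \<kappa>_def algebra_simps)
      then show ?thesis using that by (simp add: lk lam_def)
    qed
    then show ?case by (auto simp: m_def \<kappa>_def lam_def intro!: prod.cong)
  qed auto
  then show ?thesis by (simp add: C_def Dcoeff_reflect)
qed

text \<open>The index set \<open>G\<close> contains the support of \<open>C\<close>, so that summing over \<open>G\<close> loses nothing.\<close>

lemma C_nonzero_imp:
  assumes "C \<beta> \<noteq> 0"
  shows "\<beta> \<in> G"
proof -
  define N where "N = l i1 * (\<beta> $ i1 + 1)"
  have "Dcoeff K (2 * K - N - 1) \<noteq> 0" using assms by (simp add: C_def N_def)
  then have N: "1 \<le> N" "N \<le> 2 * K - 1" by (auto simp: Dcoeff_def split: if_splits)
  have "\<beta> $ i1 + 1 > 0" using N l_pos[of i1] by (auto simp: N_def zero_less_mult_iff int_one_le_iff_zero_less)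
  moreover have "\<beta> $ i1 + 1 < 2 * k $ i1"
  proof -
    have "l i1 * (\<beta> $ i1 + 1) < l i1 * (2 * k $ i1)"
      using N lk[of i1] by (simp add: N_def algebra_simps)
    then show ?thesis using l_pos[of i1] by (simp add: mult_less_cancel_left_pos)
  qed
  moreover have "0 \<le> \<beta> $ b \<and> \<beta> $ b \<le> 2 * k $ b" if "b \<noteq> i1" for b
  proof -
    have "Dcoeff (l b) (l b * (\<beta> $ b + 1) + N - 2 * K - 1) \<noteq> 0"
      using assms that by (auto simp: C_def N_def)
    then have *: "1 \<le> l b * (\<beta> $ b + 1) + N - 2 * K" "l b * (\<beta> $ b + 1) + N - 2 * K \<le> 2 * l b - 1"
      by (auto simp: Dcoeff_def split: if_splits)
    have "l b * (\<beta> $ b + 1) > 0" using * N by linarith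
    then have "\<beta> $ b + 1 > 0" using l_pos[of b] by (simp add: zero_less_mult_iff)
    moreover have "l b * (\<beta> $ b + 1) < l b * (2 * k $ b + 2)"
      using * N lk[of b] by (simp add: algebra_simps)
    then have "\<beta> $ b + 1 < 2 * k $ b + 2" using l_pos[of b] by (simp add: mult_less_cancel_left_pos)
    ultimately show ?thesis by simp
  qed
  ultimately show ?thesis by (simp add: G_def)
qed

text \<open>The Bergman kernel in terms of \<open>t = z cnj(w)\<close>, up to the constant factor.\<close>

definition ker :: "complex ^ 'n \<Rightarrow> complex" where
  "ker t = (\<Sum>\<beta>\<in>G. of_int (C \<beta>) * monomial t \<beta>) /
     (((\<Prod>b\<in>UNIV - {i1}. (t $ b) powi (k $ b)) - (t $ i1) powi (k $ i1))\<^sup>2 *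
      (\<Prod>b\<in>UNIV - {i1}. (1 - t $ b)\<^sup>2))"

lemma ker_series:
  assumes t: "t \<in> hartogs_dom"
  shows "((\<lambda>\<alpha>. of_int (coef UNIV \<alpha>) * monomial t \<alpha>) has_sum ker t) UNIV"
proof -
  have t0: "t $ b \<noteq> 0" if "b \<noteq> i1" for b using t that by (simp add: hartogs_dom_def)
  define P where "P = (\<Prod>b\<in>UNIV - {i1}. (t $ b) powi (k $ b))"
  define Q where "Q = (t $ i1) powi (k $ i1)"
  have P0: "P \<noteq> 0" unfolding P_def using t0 by (auto simp: power_int_eq_0_iff)
  let ?A = "(\<lambda>\<beta>. \<beta> - \<kappa>) ` G"
  have supp: "\<alpha> \<in> ?A" if "coef {} \<alpha> \<noteq> 0" for \<alpha>
    using C_nonzero_imp[of "\<alpha> + \<kappa>"] coef_C[of "\<alpha> + \<kappa>"] that by (intro image_eqI[of _ _ "\<alpha> + \<kappa>"]) auto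
  have num: "(\<Sum>\<alpha>\<in>?A. of_int (coef {} \<alpha>) * monomial t \<alpha>) = (\<Sum>\<beta>\<in>G. of_int (C \<beta>) * monomial t \<beta>) / P\<^sup>2"
  proof -
    have mk: "monomial t (\<beta> - \<kappa>) = monomial t \<beta> / P\<^sup>2" if "\<beta> \<in> G" for \<beta>
    proof -
      have "monomial t ((\<beta> - \<kappa>) + \<kappa>) = monomial t (\<beta> - \<kappa>) * monomial t \<kappa>"
      proof (rule monomial_add)
        show "t $ a \<noteq> 0 \<or> 0 \<le> (\<beta> - \<kappa>) $ a \<and> 0 \<le> \<kappa> $ a" for a
          using t0[of a] that by (cases "a = i1") (auto simp: G_def \<kappa>_def)
      qed
      moreover have "monomial t \<kappa> = P\<^sup>2"
      proof -
        have "monomial t \<kappa> = (\<Prod>b\<in>UNIV - {i1}. (t $ b) powi (2 * k $ b))"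
          unfolding monomial_def by (subst prod.remove[of _ i1]) (auto simp: \<kappa>_def intro!: prod.cong)
        also have "\<dots> = P\<^sup>2"
          unfolding P_def prod_power_distrib
          by (rule prod.cong) (auto simp: power_int_mult mult.commute power_int_numeral)
        finally show ?thesis .
      qed
      ultimately show ?thesis using P0 by (simp add: field_simps)
    qed
    have "(\<Sum>\<alpha>\<in>?A. of_int (coef {} \<alpha>) * monomial t \<alpha>) = (\<Sum>\<beta>\<in>G. of_int (C \<beta>) * monomial t (\<beta> - \<kappa>))"
      by (subst sum.reindex) (auto simp: inj_on_def coef_C)
    also have "\<dots> = (\<Sum>\<beta>\<in>G. of_int (C \<beta>) * monomial t \<beta> / P\<^sup>2)"
      by (rule sum.cong) (auto simp: mk)
    finally show ?thesis by (simp add: sum_divide_distrib)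
  qed
  have den: "(\<Prod>a\<in>UNIV. (1 - monomial t (s a))\<^sup>2) = (1 - Q / P)\<^sup>2 * (\<Prod>b\<in>UNIV - {i1}. (1 - t $ b)\<^sup>2)"
  proof -
    have "monomial t (s i1) = Q / P"
    proof -
      have "monomial t (s i1) = Q * (\<Prod>b\<in>UNIV - {i1}. (t $ b) powi (- (k $ b)))"
        unfolding monomial_def Q_def by (subst prod.remove[of _ i1]) (auto simp: s_def intro!: prod.cong)
      also have "(\<Prod>b\<in>UNIV - {i1}. (t $ b) powi (- (k $ b))) = 1 / P"
        unfolding P_def power_int_minus using prod_inversef[of "\<lambda>b. (t $ b) powi (k $ b)" "UNIV - {i1}"]
        by (simp add: o_def divide_inverse)
      finally show ?thesis by simp
    qed
    moreover have "monomial t (s b) = t $ b" if "b \<noteq> i1" for b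
      using that by (simp add: s_def monomial_axis)
    ultimately show ?thesis
      by (subst prod.remove[of _ i1]) (auto intro!: prod.cong)
  qed
  have "((1 - Q / P)\<^sup>2) * P\<^sup>2 = (P - Q)\<^sup>2"
    using P0 by (simp add: power_mult_distrib[symmetric] left_diff_distrib)
  then have "ker t = (\<Sum>\<alpha>\<in>?A. of_int (coef {} \<alpha>) * monomial t \<alpha>) / (\<Prod>a\<in>UNIV. (1 - monomial t (s a))\<^sup>2)"
    unfolding num den ker_def P_def[symmetric] Q_def[symmetric]
    using P0 by (simp add: mult_ac flip: \<open>((1 - Q / P)\<^sup>2) * P\<^sup>2 = (P - Q)\<^sup>2\<close>)
  then show ?thesis
    using generating_function[OF t, of ?A UNIV] supp finite_G by simp
qed

end

section \<open>Rational functions of several variables\<close>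

text \<open>Complex differentiability at a point.\<close>

definition holomorphic_at_vec :: "(complex ^ 'n \<Rightarrow> complex) \<Rightarrow> complex ^ 'n \<Rightarrow> bool" where
  "holomorphic_at_vec f z \<longleftrightarrow> (\<exists>D. (f has_derivative D) (at z) \<and> (\<forall>c v. D (c *s v) = c * D v))"

lemma holomorphic_on_vec_iff: "holomorphic_on_vec f \<Omega> \<longleftrightarrow> (\<forall>z\<in>\<Omega>. holomorphic_at_vec f z)"
  by (simp add: holomorphic_on_vec_def holomorphic_at_vec_def)

lemma holomorphic_at_vec_const: "holomorphic_at_vec (\<lambda>z. c) z"
  unfolding holomorphic_at_vec_def by (intro exI[of _ "\<lambda>_. 0"]) auto

lemma holomorphic_at_vec_nth: "holomorphic_at_vec (\<lambda>z::complex ^ 'n::finite. z $ j) z"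
  unfolding holomorphic_at_vec_def
  by (rule exI[of _ "\<lambda>v. v $ j"])
     (simp add: bounded_linear_imp_has_derivative[OF bounded_linear_vec_nth])

lemma holomorphic_at_vec_add:
  assumes "holomorphic_at_vec f z" "holomorphic_at_vec g z"
  shows "holomorphic_at_vec (\<lambda>z. f z + g z) z"
proof -
  obtain D E where D: "(f has_derivative D) (at z)" "\<And>c v. D (c *s v) = c * D v"
      and E: "(g has_derivative E) (at z)" "\<And>c v. E (c *s v) = c * E v"
    using assms unfolding holomorphic_at_vec_def by blast
  have "D (c *s v) + E (c *s v) = c * (D v + E v)" for c v
    unfolding D(2) E(2) by (simp only: distrib_left mult.assoc mult.left_commute)
  then show ?thesis
    unfolding holomorphic_at_vec_def
    by (intro exI conjI allI) (rule has_derivative_add[OF D(1) E(1)])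
qed

lemma holomorphic_at_vec_mult:
  assumes "holomorphic_at_vec f z" "holomorphic_at_vec g z"
  shows "holomorphic_at_vec (\<lambda>z. f z * g z) z"
proof -
  obtain D E where D: "(f has_derivative D) (at z)" "\<And>c v. D (c *s v) = c * D v"
      and E: "(g has_derivative E) (at z)" "\<And>c v. E (c *s v) = c * E v"
    using assms unfolding holomorphic_at_vec_def by blast
  have "f z * E (c *s v) + D (c *s v) * g z = c * (f z * E v + D v * g z)" for c v
    unfolding D(2) E(2) by (simp only: distrib_left mult.assoc mult.left_commute)
  then show ?thesis
    unfolding holomorphic_at_vec_def
    by (intro exI conjI allI) (rule has_derivative_mult[OF D(1) E(1)])
qed

lemma holomorphic_at_vec_compose:
  assumes "holomorphic_at_vec f z" "(g has_field_derivative g') (at (f z))"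
  shows "holomorphic_at_vec (\<lambda>z. g (f z)) z"
proof -
  obtain D where D: "(f has_derivative D) (at z)" "\<And>c v. D (c *s v) = c * D v"
    using assms unfolding holomorphic_at_vec_def by blast
  have "((\<lambda>z. g (f z)) has_derivative (\<lambda>v. g' * D v)) (at z)"
    by (rule has_derivative_compose[OF D(1) assms(2)[unfolded has_field_derivative_def]])
  moreover have "g' * D (c *s v) = c * (g' * D v)" for c v
    unfolding D(2) by (rule mult.left_commute)
  ultimately show ?thesis
    unfolding holomorphic_at_vec_def by (intro exI conjI allI)
qed

lemma holomorphic_at_vec_powi:
  assumes "holomorphic_at_vec f z" "n \<ge> 0"
  shows "holomorphic_at_vec (\<lambda>z. f z powi n) z"
proof -
  from holomorphic_at_vec_compose[OF assms(1) DERIV_power[OF DERIV_ident, where n = "nat n"]] show ?thesis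
    using assms(2) by (simp add: power_int_def)
qed

lemma holomorphic_at_vec_power:
  assumes "holomorphic_at_vec f z"
  shows "holomorphic_at_vec (\<lambda>z. f z ^ n) z"
  by (rule holomorphic_at_vec_compose[OF assms DERIV_power[OF DERIV_ident]])

lemma holomorphic_at_vec_divide:
  assumes "holomorphic_at_vec f z" "holomorphic_at_vec g z" "g z \<noteq> 0"
  shows "holomorphic_at_vec (\<lambda>z. f z / g z) z"
  unfolding divide_inverse
  by (intro holomorphic_at_vec_mult assms holomorphic_at_vec_compose[OF assms(2) DERIV_inverse] assms)

lemma holomorphic_at_vec_sum:
  assumes "\<And>i. i \<in> I \<Longrightarrow> holomorphic_at_vec (f i) z"
  shows "holomorphic_at_vec (\<lambda>z. \<Sum>i\<in>I. f i z) z"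
  using assms
  by (induction I rule: infinite_finite_induct) (auto intro: holomorphic_at_vec_add holomorphic_at_vec_const)

lemma holomorphic_at_vec_prod:
  assumes "\<And>i. i \<in> I \<Longrightarrow> holomorphic_at_vec (f i) z"
  shows "holomorphic_at_vec (\<lambda>z. \<Prod>i\<in>I. f i z) z"
  using assms
  by (induction I rule: infinite_finite_induct) (auto intro: holomorphic_at_vec_mult holomorphic_at_vec_const)

lemma holomorphic_at_vec_diff:
  assumes "holomorphic_at_vec f z" "holomorphic_at_vec g z"
  shows "holomorphic_at_vec (\<lambda>z. f z - g z) z"
  using holomorphic_at_vec_add[OF assms(1) holomorphic_at_vec_mult[OF holomorphic_at_vec_const assms(2), of "-1"]] by simp

section \<open>Geometry of the domain\<close>

context hartogs
begin

lemma monomial_s_i1: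
  "monomial t (s i1) = (t $ i1) powi (k $ i1) / (\<Prod>b\<in>UNIV - {i1}. (t $ b) powi (k $ b))"
proof -
  have "monomial t (s i1) = (t $ i1) powi (k $ i1) * (\<Prod>b\<in>UNIV - {i1}. (t $ b) powi (- (k $ b)))"
    unfolding monomial_def by (subst prod.remove[of _ i1]) (auto simp: s_def intro!: prod.cong)
  then show ?thesis
    using prod_inversef[of "\<lambda>b. (t $ b) powi (k $ b)" "UNIV - {i1}"]
    by (simp add: o_def divide_inverse power_int_minus)
qed

lemma monomial_s_other: "b \<noteq> i1 \<Longrightarrow> monomial t (s b) = t $ b"
  by (simp add: s_def monomial_axis)

lemma powi_k: "x powi (k $ a) = x ^ nat (k $ a)"
  using k_pos[of a] by (simp add: power_int_def)

lemma nat_k_pos: "nat (k $ a) > 0"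
  using k_pos[of a] by simp

text \<open>The inequalities without division, from which openness and monotonicity in the moduli can be read off.\<close>

lemma hartogs_dom_iff:
  "t \<in> hartogs_dom \<longleftrightarrow> (\<forall>b. b \<noteq> i1 \<longrightarrow> t $ b \<noteq> 0 \<and> norm (t $ b) < 1) \<and>
     norm (t $ i1) ^ nat (k $ i1) < (\<Prod>b\<in>UNIV - {i1}. norm (t $ b) ^ nat (k $ b))"
proof (cases "\<forall>b. b \<noteq> i1 \<longrightarrow> t $ b \<noteq> 0")
  case True
  define P where "P = (\<Prod>b\<in>UNIV - {i1}. norm (t $ b) ^ nat (k $ b))"
  have "P > 0" unfolding P_def using True by (intro prod_pos) auto
  have "norm (monomial t (s i1)) = norm (t $ i1) ^ nat (k $ i1) / P"
    unfolding monomial_s_i1 norm_divide P_def powi_k prod_norm[symmetric] norm_power ..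
  then have "norm (monomial t (s i1)) < 1 \<longleftrightarrow> norm (t $ i1) ^ nat (k $ i1) < P"
    using \<open>P > 0\<close> by simp
  moreover have "(\<forall>a. norm (monomial t (s a)) < 1) \<longleftrightarrow>
      norm (monomial t (s i1)) < 1 \<and> (\<forall>b. b \<noteq> i1 \<longrightarrow> norm (monomial t (s b)) < 1)" by auto
  ultimately show ?thesis using True unfolding hartogs_dom_def P_def by (auto simp: monomial_s_other)
qed (auto simp: hartogs_dom_def)

lemma hartogs_dom_eq_elementary_reinhardt:
  "elementary_reinhardt (\<chi> a. if a = i1 then k $ a else - (k $ a)) = hartogs_dom"
proof -
  have s: "(\<chi> a. if a = i1 then k $ a else - (k $ a)) = s i1" by (simp add: s_def)
  have neg: "s i1 $ j < 0 \<longleftrightarrow> j \<noteq> i1" for j using k_pos[of j] by (cases "j = i1") (simp_all add: s_def)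
  have "norm (t $ i1) < 1" if "t \<in> hartogs_dom" for t
  proof -
    have "norm (t $ i1) ^ nat (k $ i1) < (\<Prod>b\<in>UNIV - {i1}. norm (t $ b) ^ nat (k $ b))"
      using that by (simp add: hartogs_dom_iff)
    also have "\<dots> \<le> 1"
      using that by (intro prod_le_1 conjI zero_le_power power_le_one norm_ge_zero) (auto simp: hartogs_dom_iff less_imp_le)
    finally show ?thesis
      by (meson linorder_not_less one_le_power)
  qed
  note i1_less = this
  have "t \<in> hartogs_dom \<longleftrightarrow> (\<forall>j. norm (t $ j) < 1) \<and> (\<forall>j. j \<noteq> i1 \<longrightarrow> t $ j \<noteq> 0) \<and> norm (monomial t (s i1)) < 1" (is "_ \<longleftrightarrow> ?R") for t
  proof
    assume t: "t \<in> hartogs_dom"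
    have "norm (t $ j) < 1" for j
      using i1_less[OF t] t by (cases "j = i1") (auto simp: hartogs_dom_iff)
    then show ?R using t by (simp add: hartogs_dom_def)
  next
    assume R: ?R
    have "norm (monomial t (s a)) < 1" for a
      using R monomial_s_other[of a t] by (cases "a = i1") auto
    then show "t \<in> hartogs_dom" using R by (simp add: hartogs_dom_def)
  qed
  then show ?thesis
    unfolding s elementary_reinhardt_def polydisc_def monomial_defined_def neg by blast
qed

lemma hartogs_dom_mult: "z \<in> hartogs_dom \<Longrightarrow> w \<in> hartogs_dom \<Longrightarrow> z * w \<in> hartogs_dom"
  unfolding hartogs_dom_def
proof safe
  fix a assume "\<forall>a. norm (monomial z (s a)) < 1" "\<forall>a. norm (monomial w (s a)) < 1"
  then have "norm (monomial z (s a)) * norm (monomial w (s a)) < 1 * 1"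
    by (intro mult_strict_mono') auto
  then show "norm (monomial (z * w) (s a)) < 1" by (simp add: monomial_mult norm_mult)
qed auto

lemma hartogs_dom_cnj: "z \<in> hartogs_dom \<Longrightarrow> (\<chi> a. cnj (z $ a)) \<in> hartogs_dom"
  by (simp add: hartogs_dom_iff)

lemma open_hartogs_dom: "open hartogs_dom"
proof -
  have "hartogs_dom = (\<Inter>b\<in>UNIV - {i1}. {t. t $ b \<noteq> 0} \<inter> {t. norm (t $ b) < 1}) \<inter>
     {t. norm (t $ i1) ^ nat (k $ i1) < (\<Prod>b\<in>UNIV - {i1}. norm (t $ b) ^ nat (k $ b))}"
    by (auto simp: hartogs_dom_iff)
  then show ?thesis
    by (simp only:) (intro open_Int open_INT ballI open_Collect_less open_Collect_neq continuous_intros finite)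
qed

text \<open>A base point with nonzero coordinates.\<close>

definition base :: "complex ^ 'n" where
  "base = (\<chi> a. if a = i1 then of_real ((\<Prod>b\<in>UNIV - {i1}. (1/2) ^ nat (k $ b)) / 2) else 1/2)"

text \<open>Any two points of the domain are connected by coordinate moves: shrink the coordinate \<open>i1\<close> so far that
the defining inequality holds along the whole way, change the other coordinates one by one, and finally adjust the coordinate \<open>i1\<close>.\<close>

lemma hartogs_dom_reinhardt: "reinhardt hartogs_dom base"
proof
  show "open hartogs_dom" by (rule open_hartogs_dom)
next
  fix z1 z2 w :: "complex ^ 'n" and j
  assume z: "z1 \<in> hartogs_dom" "z2 \<in> hartogs_dom"
    and eq1: "\<And>i. i \<noteq> j \<Longrightarrow> norm (z1 $ i) = norm (w $ i)" and eq2: "\<And>i. i \<noteq> j \<Longrightarrow> norm (z2 $ i) = norm (w $ i)"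
    and le: "norm (z1 $ j) \<le> norm (w $ j)" "norm (w $ j) \<le> norm (z2 $ j)"
  have le1: "norm (z1 $ i) \<le> norm (w $ i)" for i using eq1[of i] le by (cases "i = j") auto
  have le2: "norm (w $ i) \<le> norm (z2 $ i)" for i using eq2[of i] le by (cases "i = j") auto
  have "w $ b \<noteq> 0 \<and> norm (w $ b) < 1" if "b \<noteq> i1" for b
    using z le1[of b] le2[of b] that by (auto simp: hartogs_dom_iff)
  moreover have "norm (w $ i1) ^ nat (k $ i1) < (\<Prod>b\<in>UNIV - {i1}. norm (w $ b) ^ nat (k $ b))"
  proof (cases "j = i1")
    case True
    have "norm (w $ i1) ^ nat (k $ i1) \<le> norm (z2 $ i1) ^ nat (k $ i1)" by (intro power_mono le2) auto
    also have "\<dots> < (\<Prod>b\<in>UNIV - {i1}. norm (z2 $ b) ^ nat (k $ b))" using z by (simp add: hartogs_dom_iff)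
    also have "\<dots> = (\<Prod>b\<in>UNIV - {i1}. norm (w $ b) ^ nat (k $ b))"
      using eq2 True by (intro prod.cong) auto
    finally show ?thesis .
  next
    case False
    then have "norm (w $ i1) ^ nat (k $ i1) = norm (z1 $ i1) ^ nat (k $ i1)" using eq1[of i1] by simp
    also have "\<dots> < (\<Prod>b\<in>UNIV - {i1}. norm (z1 $ b) ^ nat (k $ b))" using z by (simp add: hartogs_dom_iff)
    also have "\<dots> \<le> (\<Prod>b\<in>UNIV - {i1}. norm (w $ b) ^ nat (k $ b))"
      by (intro prod_mono conjI power_mono le1) auto
    finally show ?thesis .
  qed
  ultimately show "w \<in> hartogs_dom" by (simp add: hartogs_dom_iff)
next
  have small: "x ^ nat (k $ i1) < P" if "0 < P" "x = P / 2" "P \<le> 1" for x P :: real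
  proof -
    have "x ^ nat (k $ i1) \<le> x ^ 1"
      using that nat_k_pos[of i1] by (intro power_decreasing) auto
    also have "\<dots> < P" using that by simp
    finally show ?thesis .
  qed
  show base_dom: "base \<in> hartogs_dom"
  proof -
    define P :: real where "P = (\<Prod>b\<in>UNIV - {i1}. (1/2) ^ nat (k $ b))"
    have P: "P > 0" "P \<le> 1" unfolding P_def by (auto intro!: prod_pos prod_le_1 power_le_one)
    have "norm (base $ i1) = P / 2"
      using P by (simp add: base_def P_def[symmetric] norm_divide del: of_real_divide of_real_prod)
    then show ?thesis
      using small[OF P(1) _ P(2)] by (auto simp: hartogs_dom_iff base_def P_def)
  qed
  show base0: "base $ j \<noteq> 0" for j
    by (auto simp: base_def)
  fix Q :: "complex ^ 'n \<Rightarrow> bool" and z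
  assume z: "z \<in> hartogs_dom" and Q0: "Q base"
    and step: "\<And>z j w. z \<in> hartogs_dom \<Longrightarrow> vec_upd z j w \<in> hartogs_dom \<Longrightarrow> (\<And>i. z $ i \<noteq> 0) \<Longrightarrow> Q z \<Longrightarrow> Q (vec_upd z j w)"
  define P where "P = (\<Prod>b\<in>UNIV - {i1}. (norm (base $ b) * norm (z $ b)) ^ nat (k $ b))"
  have less1: "norm (base $ b) < 1" "norm (z $ b) < 1" "z $ b \<noteq> 0" if "b \<noteq> i1" for b
    using base_dom z that by (auto simp: hartogs_dom_iff)
  have el: "0 < norm (base $ b) * norm (z $ b)" "norm (base $ b) * norm (z $ b) \<le> 1" if "b \<noteq> i1" for b
    using less1[OF that] base0[of b] by (auto intro!: mult_le_one)
  have P: "P > 0"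
    unfolding P_def by (intro prod_pos zero_less_power el) auto
  have P1: "P \<le> 1"
    unfolding P_def by (intro prod_le_1 conjI power_le_one zero_le_power mult_nonneg_nonneg norm_ge_zero el) auto
  \<comment> \<open>The intermediate points: the coordinates in \<open>S\<close> have already been moved from \<open>base\<close> to \<open>z\<close>.\<close>
  define q where "q S = (\<chi> a. if a = i1 then of_real (P / 2) else if a \<in> S then z $ a else base $ a)" for S
  have q0: "q S $ a \<noteq> 0" for S a
    using P base0 less1(3) by (auto simp: q_def)
  have q_dom: "q S \<in> hartogs_dom" for S
  proof -
    have "P \<le> (\<Prod>b\<in>UNIV - {i1}. norm (q S $ b) ^ nat (k $ b))"
      unfolding P_def
    proof (intro prod_mono conjI power_mono)
      fix b assume "b \<in> UNIV - {i1}"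
      then show "norm (base $ b) * norm (z $ b) \<le> norm (q S $ b)"
        using less1[of b] by (auto simp: q_def mult_left_le mult_left_le_one_le)
    qed auto
    moreover have "norm (q S $ i1) = P / 2" using P by (simp add: q_def norm_divide)
    ultimately have "norm (q S $ i1) ^ nat (k $ i1) < (\<Prod>b\<in>UNIV - {i1}. norm (q S $ b) ^ nat (k $ b))"
      using small[OF P _ P1, of "norm (q S $ i1)"] by simp
    moreover have "norm (q S $ b) < 1" if "b \<noteq> i1" for b using less1[OF that] that by (simp add: q_def)
    ultimately show ?thesis using q0 by (simp add: hartogs_dom_iff)
  qed
  have "Q (q S)" if "S \<subseteq> UNIV - {i1}" for S
    using finite[of S] that
  proof (induction S rule: finite_induct)
    case empty
    have "q {} = vec_upd base i1 (of_real (P / 2))" by (auto simp: q_def vec_eq_iff)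
    then show ?case
      using step[OF base_dom _ base0 Q0] q_dom[of "{}"] by metis
  next
    case (insert b S)
    have "q (insert b S) = vec_upd (q S) b (z $ b)"
      using insert.prems insert.hyps by (auto simp: q_def vec_eq_iff)
    moreover have "Q (q S)" using insert by blast
    ultimately show ?case using step[OF q_dom _ q0] q_dom[of "insert b S"] by metis
  qed
  then have "Q (q (UNIV - {i1}))" by simp
  moreover have last: "vec_upd (q (UNIV - {i1})) i1 (z $ i1) = z"
    by (auto simp: q_def vec_eq_iff)
  ultimately have "Q (vec_upd (q (UNIV - {i1})) i1 (z $ i1))"
    using z by (intro step[OF q_dom _ q0]) (simp_all only: last)
  then show "Q z" by (simp only: last)
qed

lemma ker_cnj: "cnj (ker t) = ker (\<chi> a. cnj (t $ a))"
  by (simp add: ker_def cnj_monomial)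

lemma G_nonneg: "\<beta> \<in> G \<Longrightarrow> 0 \<le> \<beta> $ j"
  by (cases "j = i1") (auto simp: G_def)

lemma ker_holomorphic:
  assumes "w \<in> hartogs_dom"
  shows "holomorphic_on_vec (\<lambda>z. ker (z * w)) hartogs_dom"
  unfolding holomorphic_on_vec_iff
proof
  fix z assume "z \<in> hartogs_dom"
  then have t: "z * w \<in> hartogs_dom" using assms by (rule hartogs_dom_mult)
  have nth: "holomorphic_at_vec (\<lambda>z. (z * w) $ j) z" for j
    unfolding vector_mult_component
    by (intro holomorphic_at_vec_mult holomorphic_at_vec_nth holomorphic_at_vec_const)
  have "(\<Prod>b\<in>UNIV - {i1}. ((z * w) $ b) powi (k $ b)) - ((z * w) $ i1) powi (k $ i1) \<noteq> 0"
  proof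
    assume "(\<Prod>b\<in>UNIV - {i1}. ((z * w) $ b) powi (k $ b)) - ((z * w) $ i1) powi (k $ i1) = 0"
    then have "norm (\<Prod>b\<in>UNIV - {i1}. ((z * w) $ b) powi (k $ b)) = norm (((z * w) $ i1) powi (k $ i1))" by simp
    then show False using t unfolding hartogs_dom_iff by (simp add: powi_k norm_power flip: prod_norm)
  qed
  moreover have "(\<Prod>b\<in>UNIV - {i1}. (1 - (z * w) $ b)\<^sup>2) \<noteq> 0"
    using t by (auto simp: hartogs_dom_iff)
  ultimately show "holomorphic_at_vec (\<lambda>z. ker (z * w)) z"
    unfolding ker_def monomial_def
    by (intro holomorphic_at_vec_divide holomorphic_at_vec_sum holomorphic_at_vec_mult holomorphic_at_vec_const
        holomorphic_at_vec_prod holomorphic_at_vec_powi holomorphic_at_vec_power holomorphic_at_vec_diff nth)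
       (simp_all add: G_nonneg k_pos less_imp_le)
qed

section \<open>Norms of the monomials\<close>

text \<open>The integral of \<open>|z\<^sup>\<alpha>|\<^sup>2\<close> over the coordinate \<open>a\<close> reduces to that of \<open>|z\<^sub>a| powr (2 * rate a \<alpha> - 2)\<close> over a disc:
directly for \<open>i1\<close>, and for the other coordinates after the integration over \<open>i1\<close>.\<close>

definition rate :: "'n \<Rightarrow> int ^ 'n \<Rightarrow> real" where
  "rate a \<alpha> = real_of_int (m a \<alpha>) / real_of_int (l a)"

lemma rate_pos_iff: "rate a \<alpha> > 0 \<longleftrightarrow> m a \<alpha> > 0"
  unfolding rate_def using l_pos[of a] by (metis of_int_0_less_iff zero_less_divide_iff order.asym)

lemma rate_i1: "rate i1 \<alpha> = real_of_int (\<alpha> $ i1) + 1"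
  using l_pos[of i1] by (simp add: rate_def m_def)

lemma rate_other:
  assumes "b \<noteq> i1"
  shows "rate b \<alpha> = real_of_int (\<alpha> $ b) + 1 + real_of_int (k $ b) / real_of_int (k $ i1) * rate i1 \<alpha>"
proof -
  have "real_of_int (l b * k $ b) = real_of_int (l i1 * k $ i1)" using lk[of b] lk[of i1] by simp
  then have "real_of_int (l i1) / real_of_int (l b) = real_of_int (k $ b) / real_of_int (k $ i1)"
    using l_pos[of b] k_pos[of i1] by (simp add: field_simps)
  then show ?thesis
    using l_pos[of b] assms unfolding rate_i1 by (simp add: rate_def m_def add_divide_distrib times_divide_eq_left[symmetric] del: times_divide_eq_left)
qed

lemma powi_square_eq_powr: "x > 0 \<Longrightarrow> (x powi n)\<^sup>2 = x powr (2 * real_of_int n)" for x :: real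
  by (simp add: powr_real_of_int'[symmetric] powr_powr powr_numeral[symmetric] mult.commute del: powr_numeral)

text \<open>Integration over the distinguished coordinate \<open>v\<close>, which ranges over a disc whose radius depends on the other
coordinates \<open>x\<close>. Both sides vanish if \<open>x\<close> violates the conditions \<open>0 < |x\<^sub>b| < 1\<close>.\<close>

lemma inner_integral:
  fixes x :: "'n \<Rightarrow> complex" and \<alpha> :: "int ^ 'n"
  defines "F \<equiv> (if rate i1 \<alpha> > 0 then ennreal (pi / rate i1 \<alpha>) else \<infinity>)"
  defines "y v \<equiv> (\<chi> i. (x(i1 := v)) i)"
  shows "(\<integral>\<^sup>+v. indicator hartogs_dom (y v) * ennreal ((norm (monomial (y v) \<alpha>))\<^sup>2) \<partial>lborel)
     = F * (\<Prod>b\<in>UNIV - {i1}. ennreal (norm (x b) powr (2 * rate b \<alpha> - 2)) * indicator (ball 0 1) (x b))"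
proof (cases "\<forall>b\<in>UNIV - {i1}. x b \<noteq> 0 \<and> norm (x b) < 1")
  case False
  then obtain b where b: "b \<noteq> i1" "x b = 0 \<or> \<not> norm (x b) < 1" by auto
  then have "(\<Prod>b\<in>UNIV - {i1}. ennreal (norm (x b) powr (2 * rate b \<alpha> - 2)) * indicator (ball 0 1) (x b)) = 0"
    by (intro prod_zero) (auto intro!: bexI[of _ b])
  moreover have "y v \<notin> hartogs_dom" for v
    using b by (auto simp: hartogs_dom_iff y_def)
  ultimately show ?thesis by simp
next
  case True
  define J where "J = UNIV - {i1}"
  define n where "n = nat (k $ i1)"
  have n: "n > 0" "real n = real_of_int (k $ i1)" using nat_k_pos[of i1] by (auto simp: n_def)
  have x: "norm (x b) > 0" "norm (x b) < 1" if "b \<in> J" for b using True that by (auto simp: J_def)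
  define \<rho> where "\<rho> = (\<Prod>b\<in>J. norm (x b) powr (real_of_int (k $ b) / real_of_int (k $ i1)))"
  have \<rho>: "\<rho> > 0" unfolding \<rho>_def by (intro prod_pos) (use x in auto)
  have \<rho>_power: "\<rho> ^ n = (\<Prod>b\<in>J. norm (x b) ^ nat (k $ b))"
    unfolding \<rho>_def prod_power_distrib
  proof (rule prod.cong)
    fix b assume b: "b \<in> J"
    have "(norm (x b) powr (real_of_int (k $ b) / real_of_int (k $ i1))) ^ n = norm (x b) powr (real_of_int (k $ b) / real_of_int (k $ i1) * real n)"
      by (metis powr_powr powr_realpow' powr_ge_zero n(1) neq0_conv)
    also have "\<dots> = norm (x b) powr (real (nat (k $ b)))" using k_pos[of i1] k_pos[of b] n(2) by simp
    also have "\<dots> = norm (x b) ^ nat (k $ b)" using x[OF b] by (intro powr_realpow)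
    finally show "(norm (x b) powr (real_of_int (k $ b) / real_of_int (k $ i1))) ^ n = norm (x b) ^ nat (k $ b)" .
  qed simp
  have hartogs_dom: "y v \<in> hartogs_dom \<longleftrightarrow> v \<in> ball 0 \<rho>" for v
  proof -
    have "(\<Prod>b\<in>UNIV - {i1}. norm (y v $ b) ^ nat (k $ b)) = \<rho> ^ n"
      unfolding \<rho>_power J_def by (rule prod.cong) (auto simp: y_def)
    then have "y v \<in> hartogs_dom \<longleftrightarrow> norm v ^ n < \<rho> ^ n"
      using True unfolding hartogs_dom_iff by (auto simp: y_def n_def)
    also have "\<dots> \<longleftrightarrow> norm v < \<rho>"
      using \<rho> n by (metis norm_ge_zero power_less_imp_less_base power_strict_mono less_imp_le)
    finally show ?thesis by simp
  qed
  define W where "W = (\<Prod>b\<in>J. norm (x b) powr (2 * real_of_int (\<alpha> $ b)))"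
  have W: "W \<ge> 0" unfolding W_def by (intro prod_nonneg) auto
  have mon: "(norm (monomial (y v) \<alpha>))\<^sup>2 = W * norm v powr (2 * rate i1 \<alpha> - 2)" if "v \<noteq> 0" for v
  proof -
    have "norm (monomial (y v) \<alpha>) = norm v powi (\<alpha> $ i1) * (\<Prod>b\<in>J. norm (x b) powi (\<alpha> $ b))"
      unfolding norm_monomial J_def by (subst prod.remove[of _ i1]) (auto simp: y_def intro!: prod.cong)
    then have "(norm (monomial (y v) \<alpha>))\<^sup>2 = (norm v powi (\<alpha> $ i1))\<^sup>2 * (\<Prod>b\<in>J. (norm (x b) powi (\<alpha> $ b))\<^sup>2)"
      by (simp add: power_mult_distrib prod_power_distrib)
    also have "(\<Prod>b\<in>J. (norm (x b) powi (\<alpha> $ b))\<^sup>2) = W"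
      unfolding W_def using x by (intro prod.cong powi_square_eq_powr) auto
    also have "(norm v powi (\<alpha> $ i1))\<^sup>2 = norm v powr (2 * rate i1 \<alpha> - 2)"
      using that by (subst powi_square_eq_powr) (auto simp: rate_i1)
    finally show ?thesis by simp
  qed
  have "(\<integral>\<^sup>+v. indicator hartogs_dom (y v) * ennreal ((norm (monomial (y v) \<alpha>))\<^sup>2) \<partial>lborel)
      = (\<integral>\<^sup>+v. ennreal W * (ennreal (norm v powr (2 * rate i1 \<alpha> - 2)) * indicator (ball 0 \<rho>) v) \<partial>(lborel :: complex measure))"
  proof (rule nn_integral_cong_AE)
    have "AE v in lborel. v \<noteq> (0::complex)" by (rule AE_lborel_singleton)
    then show "AE v in lborel. indicator hartogs_dom (y v) * ennreal ((norm (monomial (y v) \<alpha>))\<^sup>2)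
        = ennreal W * (ennreal (norm v powr (2 * rate i1 \<alpha> - 2)) * indicator (ball 0 \<rho>) v)"
    proof eventually_elim
      case (elim v)
      have "indicator hartogs_dom (y v) = (indicator (ball 0 \<rho>) v :: ennreal)" using hartogs_dom[of v] by (simp add: indicator_def)
      then show ?case using mon[OF elim] W by (simp add: ennreal_mult mult_ac)
    qed
  qed
  also have "\<dots> = ennreal W * (\<integral>\<^sup>+v. ennreal (norm v powr (2 * rate i1 \<alpha> - 2)) * indicator (ball 0 \<rho>) v \<partial>(lborel :: complex measure))"
    by (rule nn_integral_cmult) (intro borel_measurable_times_ennreal borel_measurable_indicator, measurable)
  also have "(\<integral>\<^sup>+v. ennreal (norm v powr (2 * rate i1 \<alpha> - 2)) * indicator (ball 0 \<rho>) v \<partial>(lborel :: complex measure)) = F * ennreal (\<rho> powr (2 * rate i1 \<alpha>))"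
    unfolding F_def by (rule nn_integral_norm_powr_disc[OF \<rho>])
  also have "ennreal W * (F * ennreal (\<rho> powr (2 * rate i1 \<alpha>))) = F * ennreal (W * \<rho> powr (2 * rate i1 \<alpha>))"
    using W by (simp add: ennreal_mult mult_ac)
  also have "W * \<rho> powr (2 * rate i1 \<alpha>) = (\<Prod>b\<in>J. norm (x b) powr (2 * rate b \<alpha> - 2))"
  proof -
    have "\<rho> powr (2 * rate i1 \<alpha>) = (\<Prod>b\<in>J. (norm (x b) powr (real_of_int (k $ b) / real_of_int (k $ i1))) powr (2 * rate i1 \<alpha>))"
      unfolding \<rho>_def by (subst prod_powr_distrib) auto
    then have "W * \<rho> powr (2 * rate i1 \<alpha>) = (\<Prod>b\<in>J. norm (x b) powr (2 * real_of_int (\<alpha> $ b)) * norm (x b) powr (real_of_int (k $ b) / real_of_int (k $ i1) * (2 * rate i1 \<alpha>)))"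
      by (simp add: W_def prod.distrib powr_powr)
    also have "\<dots> = (\<Prod>b\<in>J. norm (x b) powr (2 * rate b \<alpha> - 2))"
    proof (rule prod.cong)
      fix b assume b: "b \<in> J"
      then have "2 * real_of_int (\<alpha> $ b) + real_of_int (k $ b) / real_of_int (k $ i1) * (2 * rate i1 \<alpha>) = 2 * rate b \<alpha> - 2"
        by (subst rate_other[of b]) (auto simp: J_def)
      then show "norm (x b) powr (2 * real_of_int (\<alpha> $ b)) * norm (x b) powr (real_of_int (k $ b) / real_of_int (k $ i1) * (2 * rate i1 \<alpha>)) = norm (x b) powr (2 * rate b \<alpha> - 2)"
        by (simp only: powr_add[symmetric])
    qed simp
    finally show ?thesis .
  qed
  also have "ennreal (\<Prod>b\<in>J. norm (x b) powr (2 * rate b \<alpha> - 2)) = (\<Prod>b\<in>J. ennreal (norm (x b) powr (2 * rate b \<alpha> - 2)) * indicator (ball 0 1) (x b))"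
    using x by (subst prod_ennreal[symmetric]) (auto intro!: prod.cong)
  finally show ?thesis by (simp add: J_def)
qed

text \<open>The square norm of a monomial; it is infinite unless all \<open>m\<^sub>a(\<alpha>)\<close> are positive.\<close>

lemma nn_integral_monomial:
  "(\<integral>\<^sup>+z. indicator hartogs_dom z * ennreal ((norm (monomial z \<alpha>))\<^sup>2) \<partial>lborel)
    = (\<Prod>a\<in>UNIV. if m a \<alpha> > 0 then ennreal (pi * real_of_int (l a) / real_of_int (m a \<alpha>)) else \<infinity>)"
proof -
  define F where "F a = (if rate a \<alpha> > 0 then ennreal (pi / rate a \<alpha>) else \<infinity>)" for a
  define g where "g z = indicator hartogs_dom z * ennreal ((norm (monomial z \<alpha>))\<^sup>2)" for z
  define h where "h b v = ennreal (norm v powr (2 * rate b \<alpha> - 2)) * indicator (ball 0 1) v" for b and v :: complex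
  have [measurable]: "hartogs_dom \<in> sets borel" using open_hartogs_dom by simp
  have g_meas [measurable]: "g \<in> borel_measurable borel" unfolding g_def by measurable
  have [measurable]: "ball (0::complex) 1 \<in> sets borel" by simp
  have h_meas [measurable]: "h b \<in> borel_measurable borel" for b unfolding h_def by measurable
  interpret product_sigma_finite "\<lambda>_::'n. lborel :: complex measure" by standard
  have U: "insert i1 (UNIV - {i1}) = (UNIV :: 'n set)" by auto
  have "(\<integral>\<^sup>+z. g z \<partial>lborel) = (\<integral>\<^sup>+x. g (\<chi> i. x i) \<partial>(PiM (insert i1 (UNIV - {i1})) (\<lambda>_. lborel)))"
    unfolding U by (rule nn_integral_lborel_vec(1)[OF g_meas])
  also have "\<dots> = (\<integral>\<^sup>+x. (\<integral>\<^sup>+v. g (\<chi> i. (x(i1 := v)) i) \<partial>lborel) \<partial>(PiM (UNIV - {i1}) (\<lambda>_. lborel)))"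
    using nn_integral_lborel_vec(2)[OF g_meas] by (intro product_nn_integral_insert) (auto simp: U)
  also have "\<dots> = (\<integral>\<^sup>+x. F i1 * (\<Prod>b\<in>UNIV - {i1}. h b (x b)) \<partial>(PiM (UNIV - {i1}) (\<lambda>_. lborel)))"
    unfolding g_def F_def h_def by (simp only: inner_integral)
  also have "\<dots> = F i1 * (\<integral>\<^sup>+x. (\<Prod>b\<in>UNIV - {i1}. h b (x b)) \<partial>(PiM (UNIV - {i1}) (\<lambda>_. lborel)))"
    by (rule nn_integral_cmult) measurable
  also have "(\<integral>\<^sup>+x. (\<Prod>b\<in>UNIV - {i1}. h b (x b)) \<partial>(PiM (UNIV - {i1}) (\<lambda>_. lborel))) = (\<Prod>b\<in>UNIV - {i1}. \<integral>\<^sup>+v. h b v \<partial>lborel)"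
    by (rule product_nn_integral_prod) auto
  also have "\<dots> = (\<Prod>b\<in>UNIV - {i1}. F b)"
  proof (rule prod.cong)
    fix b
    show "(\<integral>\<^sup>+v. h b v \<partial>lborel) = F b"
      using nn_integral_norm_powr_disc[of 1 "rate b \<alpha>"] by (simp add: h_def F_def)
  qed simp
  also have "F i1 * (\<Prod>b\<in>UNIV - {i1}. F b) = (\<Prod>a\<in>UNIV. F a)"
    by (rule prod.remove[symmetric]) auto
  also have "\<dots> = (\<Prod>a\<in>UNIV. if m a \<alpha> > 0 then ennreal (pi * real_of_int (l a) / real_of_int (m a \<alpha>)) else \<infinity>)"
    by (intro prod.cong refl) (simp add: F_def rate_pos_iff, simp add: rate_def)
  finally show ?thesis by (simp add: g_def)
qed

definition L :: int where
  "L = (\<Prod>a\<in>UNIV. l a)"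

lemma L_pos: "L > 0"
  unfolding L_def by (intro prod_pos) (simp add: l_pos)

text \<open>The coefficients of the kernel series: the inverse of the square norm of \<open>z\<^sup>\<alpha>\<close>, zero if that norm is infinite.\<close>

definition c :: "int ^ 'n \<Rightarrow> real" where
  "c \<alpha> = real_of_int (coef UNIV \<alpha>) / (pi ^ CARD('n) * real_of_int L)"

lemma coef_UNIV: "coef UNIV \<alpha> = (\<Prod>a\<in>UNIV. max 0 (m a \<alpha>))"
  by (simp add: coef_def)

lemma coef_nonneg: "coef UNIV \<alpha> \<ge> 0"
  unfolding coef_UNIV by (intro prod_nonneg) simp

lemma c_nonneg: "c \<alpha> \<ge> 0"
  using coef_nonneg[of \<alpha>] L_pos by (simp add: c_def)

lemma c_pos_iff: "c \<alpha> > 0 \<longleftrightarrow> coef UNIV \<alpha> > 0"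
proof -
  have "0 < pi ^ CARD('n) * real_of_int L" using L_pos by simp
  then show ?thesis
    unfolding c_def by (metis of_int_0_less_iff zero_less_divide_iff order.asym)
qed

lemma
  assumes "c \<alpha> > 0"
  shows monomial_L2: "set_integrable lborel hartogs_dom (\<lambda>z. (norm (monomial z \<alpha>))\<^sup>2)"
    and monomial_norm: "(LINT z:hartogs_dom|lborel. (norm (monomial z \<alpha>))\<^sup>2) = 1 / c \<alpha>"
proof -
  have m: "m a \<alpha> > 0" for a
    using assms coef_nonzero_imp[of UNIV \<alpha> a] by (simp add: c_pos_iff)
  have [measurable]: "hartogs_dom \<in> sets borel" using open_hartogs_dom by simp
  have "(\<integral>\<^sup>+z. ennreal (indicator hartogs_dom z * (norm (monomial z \<alpha>))\<^sup>2) \<partial>lborel)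
      = (\<integral>\<^sup>+z. indicator hartogs_dom z * ennreal ((norm (monomial z \<alpha>))\<^sup>2) \<partial>lborel)"
    by (intro nn_integral_cong) (auto split: split_indicator)
  also have "\<dots> = (\<Prod>a\<in>UNIV. ennreal (pi * real_of_int (l a) / real_of_int (m a \<alpha>)))"
    unfolding nn_integral_monomial using m by simp
  also have "\<dots> = ennreal (\<Prod>a\<in>UNIV. pi * real_of_int (l a) / real_of_int (m a \<alpha>))"
    using m l_pos by (intro prod_ennreal) (simp add: less_imp_le)
  also have "(\<Prod>a\<in>UNIV. pi * real_of_int (l a) / real_of_int (m a \<alpha>)) = 1 / c \<alpha>"
  proof -
    have "real_of_int (coef UNIV \<alpha>) = (\<Prod>a\<in>UNIV. real_of_int (m a \<alpha>))"
      unfolding coef_UNIV using m by (simp add: max_def less_imp_le)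
    then show ?thesis
      unfolding c_def L_def by (simp add: prod_dividef prod.distrib)
  qed
  finally have "(\<integral>\<^sup>+z. ennreal (indicator hartogs_dom z * (norm (monomial z \<alpha>))\<^sup>2) \<partial>lborel) = ennreal (1 / c \<alpha>)" .
  then have "integrable lborel (\<lambda>z. indicator hartogs_dom z * (norm (monomial z \<alpha>))\<^sup>2) \<and> (\<integral>z. indicator hartogs_dom z * (norm (monomial z \<alpha>))\<^sup>2 \<partial>lborel) = 1 / c \<alpha>"
    using assms by (subst (asm) nn_integral_eq_integrable) auto
  then show "set_integrable lborel hartogs_dom (\<lambda>z. (norm (monomial z \<alpha>))\<^sup>2)" "(LINT z:hartogs_dom|lborel. (norm (monomial z \<alpha>))\<^sup>2) = 1 / c \<alpha>"
    by (simp_all add: set_integrable_def set_lebesgue_integral_def)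
qed

lemma monomial_not_L2:
  assumes "c \<alpha> = 0"
  shows "\<not> set_integrable lborel hartogs_dom (\<lambda>z. (norm (monomial z \<alpha>))\<^sup>2)"
proof
  assume i: "set_integrable lborel hartogs_dom (\<lambda>z. (norm (monomial z \<alpha>))\<^sup>2)"
  have "coef UNIV \<alpha> = 0" using assms L_pos by (simp add: c_def)
  then obtain a where "max 0 (m a \<alpha>) = 0" unfolding coef_UNIV by auto
  then have a: "m a \<alpha> \<le> 0" by linarith
  have "pi * real_of_int (l i) / real_of_int (m i \<alpha>) > 0" if "m i \<alpha> > 0" for i
    using that l_pos[of i] by (intro divide_pos_pos mult_pos_pos) auto
  then have "ennreal (pi * real_of_int (l i) / real_of_int (m i \<alpha>)) \<noteq> 0" if "m i \<alpha> > 0" for i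
    using that by (metis ennreal_eq_0_iff not_le)
  then have "(\<integral>\<^sup>+z. indicator hartogs_dom z * ennreal ((norm (monomial z \<alpha>))\<^sup>2) \<partial>lborel) = \<infinity>"
    unfolding nn_integral_monomial infinity_ennreal_def ennreal_prod_eq_top
    using a by (auto intro!: exI[of _ a])
  moreover have "(\<integral>\<^sup>+z. indicator hartogs_dom z * ennreal ((norm (monomial z \<alpha>))\<^sup>2) \<partial>lborel)
      = (\<integral>\<^sup>+z. ennreal (norm (indicator hartogs_dom z *\<^sub>R (norm (monomial z \<alpha>))\<^sup>2)) \<partial>lborel)"
    by (intro nn_integral_cong) (auto split: split_indicator)
  moreover have "(\<integral>\<^sup>+z. ennreal (norm (indicator hartogs_dom z *\<^sub>R (norm (monomial z \<alpha>))\<^sup>2)) \<partial>lborel) < \<infinity>"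
    using i unfolding set_integrable_def integrable_iff_bounded by blast
  ultimately show False by simp
qed

section \<open>The Bergman kernel\<close>

lemma
  assumes "z \<in> hartogs_dom"
  shows c_summable: "(\<lambda>\<alpha>. c \<alpha> * norm (monomial z \<alpha>)) summable_on UNIV"
    and indicator_summable: "(\<lambda>\<alpha>. of_bool (c \<alpha> > 0) * norm (monomial z \<alpha>)) summable_on UNIV"
proof -
  have "(\<lambda>\<alpha>. norm (of_int (coef UNIV \<alpha>) * monomial z \<alpha>)) summable_on UNIV"
    by (rule summable_on_iff_abs_summable_on_complex[THEN iffD1, OF has_sum_imp_summable[OF ker_series[OF assms]]])
  then have *: "(\<lambda>\<alpha>. real_of_int (coef UNIV \<alpha>) * norm (monomial z \<alpha>)) summable_on UNIV"
    using coef_nonneg by (simp add: norm_mult)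
  from summable_on_cmult_right[OF this, of "1 / (pi ^ CARD('n) * real_of_int L)"]
  show "(\<lambda>\<alpha>. c \<alpha> * norm (monomial z \<alpha>)) summable_on UNIV"
    by (simp add: c_def)
  show "(\<lambda>\<alpha>. of_bool (c \<alpha> > 0) * norm (monomial z \<alpha>)) summable_on UNIV"
  proof (rule summable_on_comparison_test[OF *])
    fix \<alpha>
    have "of_bool (c \<alpha> > 0) \<le> real_of_int (coef UNIV \<alpha>)"
      using coef_nonneg[of \<alpha>] by (auto simp: c_pos_iff)
    then show "of_bool (c \<alpha> > 0) * norm (monomial z \<alpha>) \<le> real_of_int (coef UNIV \<alpha>) * norm (monomial z \<alpha>)"
      by (rule mult_right_mono) simp
  qed simp
qed

text \<open>The closed form of the Bergman kernel.\<close>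

definition B :: "complex ^ 'n \<Rightarrow> complex ^ 'n \<Rightarrow> complex" where
  "B z w = 1 / (of_real pi ^ CARD('n) * of_int L) * ker (\<chi> a. z $ a * cnj (w $ a))"

lemma B_eq: "B z w = 1 / (of_real pi ^ CARD('n) * of_int L) * ker (z * (\<chi> a. cnj (w $ a)))"
  by (simp add: B_def times_vec_def)

lemma B_series:
  assumes "z \<in> hartogs_dom" "w \<in> hartogs_dom"
  shows "((\<lambda>\<alpha>. of_real (c \<alpha>) * monomial z \<alpha> * cnj (monomial w \<alpha>)) has_sum B z w) UNIV"
proof -
  have "z * (\<chi> a. cnj (w $ a)) \<in> hartogs_dom" using assms by (intro hartogs_dom_mult hartogs_dom_cnj)
  from has_sum_cmult_right[OF ker_series[OF this], of "1 / (of_real pi ^ CARD('n) * of_int L)"]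
  show ?thesis by (simp add: B_eq c_def monomial_mult cnj_monomial mult_ac)
qed

lemma cnj_B: "cnj (B z w) = B w z"
  by (simp add: B_def ker_cnj mult.commute)

lemma B_holomorphic:
  assumes "w \<in> hartogs_dom"
  shows "holomorphic_on_vec (\<lambda>z. B z w) hartogs_dom"
  using ker_holomorphic[OF hartogs_dom_cnj[OF assms]] unfolding holomorphic_on_vec_iff B_eq
  by (intro ballI holomorphic_at_vec_mult holomorphic_at_vec_const) (rule bspec)

lemma is_bergman_kernel_B: "is_bergman_kernel hartogs_dom B"
proof -
  interpret reinhardt hartogs_dom base by (rule hartogs_dom_reinhardt)
  show ?thesis
    unfolding is_bergman_kernel_def
  proof (intro conjI ballI)
    show "holomorphic_on_vec (\<lambda>z. B z w) hartogs_dom" if "w \<in> hartogs_dom" for w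
      by (rule B_holomorphic[OF that])
    show "(\<lambda>w. cnj (B z w)) \<in> bergman_space hartogs_dom" if z: "z \<in> hartogs_dom" for z
    proof -
      have hol: "holomorphic_on_vec (\<lambda>w. cnj (B z w)) hartogs_dom"
        unfolding cnj_B by (rule B_holomorphic[OF z])
      have "continuous_on hartogs_dom (\<lambda>w. cnj (cnj (B z w)))"
        by (intro continuous_on_cnj holomorphic_on_vec_imp_continuous_on hol)
      then have cont: "continuous_on hartogs_dom (B z)" by simp
      have "set_integrable lborel hartogs_dom (\<lambda>w. (norm (B z w))\<^sup>2)"
      proof (rule kernel_series_L2[OF c_nonneg monomial_L2 monomial_norm c_summable[OF z] indicator_summable[OF z] _ B_series[OF z] cont])
        show "(\<lambda>\<alpha>. c \<alpha> * norm (monomial z \<alpha>) * (norm (monomial w \<alpha>))\<^sup>2) summable_on UNIV" if "w \<in> hartogs_dom" for w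
          using c_summable[OF hartogs_dom_mult[OF hartogs_dom_mult[OF z that] that]]
          by (simp add: monomial_mult norm_mult power2_eq_square mult.assoc)
      qed
      then show ?thesis using hol by (simp add: bergman_space_def)
    qed
    show "f z = (LINT w:hartogs_dom|lborel. f w * B z w)" if "f \<in> bergman_space hartogs_dom" "z \<in> hartogs_dom" for f z
      by (rule reproducing_series[OF that c_nonneg monomial_L2 monomial_norm monomial_not_L2
            c_summable[OF that(2)] indicator_summable[OF that(2)] B_series[OF that(2)]])
  qed
qed

lemma bergman_kernel_hartogs_dom:
  assumes "z \<in> hartogs_dom" "w \<in> hartogs_dom"
  shows "bergman_kernel hartogs_dom z w = B z w"
proof -
  have "is_bergman_kernel hartogs_dom (bergman_kernel hartogs_dom)"
    unfolding bergman_kernel_def by (rule someI[of "is_bergman_kernel hartogs_dom", OF is_bergman_kernel_B])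
  from is_bergman_kernel_unique[OF this is_bergman_kernel_B assms] show ?thesis .
qed

end

theorem theorem1p1:
  fixes i1 :: "'n :: finite"
    and k :: "int ^ 'n"
    and signed_k :: "int ^ 'n"
    and K L :: int
    and l :: "'n \<Rightarrow> int"
    and G :: "(int ^ 'n) set"
    and C :: "int ^ 'n \<Rightarrow> int"
    and z w t :: "complex ^ 'n"
  assumes "CARD('n) \<ge> 2"
    and "\<And>a. k $ a > 0"
    and "Gcd (range (\<lambda>a. k $ a)) = 1"
    and "signed_k = (\<chi> a. if a = i1 then k $ a else - (k $ a))"
    and "K = Lcm (range (\<lambda>a. k $ a))"
    and "\<And>a. l a = K div (k $ a)"
    and "L = (\<Prod>a\<in>UNIV. l a)"
    and "G = {\<beta>. 0 \<le> \<beta> $ i1 \<and> \<beta> $ i1 \<le> 2 * k $ i1 - 2 \<and>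
                  (\<forall>b. b \<noteq> i1 \<longrightarrow> 0 \<le> \<beta> $ b \<and> \<beta> $ b \<le> 2 * k $ b)}"
    and "\<And>\<beta>. C \<beta> = Dcoeff K (2 * K - l i1 * (\<beta> $ i1 + 1) - 1) *
           (\<Prod>b\<in>UNIV - {i1}. Dcoeff (l b)
              (l b * (\<beta> $ b + 1) + l i1 * (\<beta> $ i1 + 1) - 2 * K - 1))"
    and "z \<in> elementary_reinhardt signed_k"
    and "w \<in> elementary_reinhardt signed_k"
    and "t = (\<chi> a. z $ a * cnj (w $ a))"
  shows "bergman_kernel (elementary_reinhardt signed_k) z w =
    1 / (of_real pi ^ CARD('n) * of_int L) *
    ((\<Sum>\<beta>\<in>G. of_int (C \<beta>) * monomial t \<beta>) /
     (((\<Prod>b\<in>UNIV - {i1}. (t $ b) powi (k $ b)) - (t $ i1) powi (k $ i1))\<^sup>2 *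
      (\<Prod>b\<in>UNIV - {i1}. (1 - t $ b)\<^sup>2)))"
proof -
  have "0 \<notin> range (\<lambda>a. k $ a)" using assms(2) by (metis less_irrefl rangeE)
  then have "K \<noteq> 0" unfolding assms(5) by (subst Lcm_0_iff) auto
  moreover have "K \<ge> 0" unfolding assms(5) by (rule Lcm_int_greater_eq_0)
  ultimately have "K > 0" by simp
  moreover have "l a * k $ a = K" for a
    unfolding assms(6) by (rule dvd_div_mult_self) (simp add: assms(5) dvd_Lcm)
  ultimately interpret H: hartogs i1 k K l
    using assms(2) by unfold_locales auto
  have hartogs_dom: "elementary_reinhardt signed_k = H.hartogs_dom"
    unfolding assms(4) by (rule H.hartogs_dom_eq_elementary_reinhardt)
  have GC: "G = H.G" "C = H.C" "L = H.L"
    unfolding assms(7,8) H.G_def H.L_def by (auto simp: H.C_def assms(9))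
  show ?thesis
    using H.bergman_kernel_hartogs_dom[of z w] assms(10,11)
    unfolding hartogs_dom H.B_def H.ker_def GC assms(12) by simp
qed

end
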